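(* Let $H$ be a complex Hilbert space and let $A$ be a bounded linear operator on $H$. Then $W(A)$ is a complete $(1+\sqrt{2})$-spectral set for $A$: for every integer $n\ge 1$ and every $n\times n$ matrix $F=(f_{ij})$ of rational functions with no poles in $\overline{W(A)}$, $$\|F(A)\|\le (1+\sqrt{2})\,\sup_{z\in W(A)}\|F(z)\|,$$ where $F(A)=(f_{ij}(A))$ is regarded as a bounded operator on $H^n$ (the Hilbert space direct sum of $n$ copies of $H$) and $\|F(z)\|$ is the operator norm of the matrix $F(z)$ on $\mathbb{C}^n$ with its Euclidean norm.
   Context: For a bounded linear operator $A$ on a complex Hilbert space $(H,\langle\cdot,\cdot\rangle)$, the numerical range is $W(A)=\{\langle Av,v\rangle : v\in H,\ \|v\|=1\}$. The spectrum of $A$ is contained in $\overline{W(A)}$, so $f(A)$ is well defined for every rational function $f$ with no poles in $\overline{W(A)}$. *)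

theory Defs
  imports
    "HOL-Analysis.Analysis"
    "HOL-Computational_Algebra.Field_as_Ring"
    "HOL-Computational_Algebra.Polynomial_Factorial"
begin

(* Following the convention <A v, v> for the numerical range, the inner product is linear in its
   FIRST argument. *)
class complex_inner = real_normed_vector +
  fixes scaleC :: "complex \<Rightarrow> 'a \<Rightarrow> 'a" (infixr "*\<^sub>C" 75)
    and cinner :: "'a \<Rightarrow> 'a \<Rightarrow> complex"
  assumes scaleC_add_right: "c *\<^sub>C (x + y) = c *\<^sub>C x + c *\<^sub>C y"
    and scaleC_add_left: "(c + d) *\<^sub>C x = c *\<^sub>C x + d *\<^sub>C x"
    and scaleC_scaleC: "c *\<^sub>C d *\<^sub>C x = (c * d) *\<^sub>C x"
    and scaleC_of_real: "complex_of_real r *\<^sub>C x = r *\<^sub>R x"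
    and cinner_commute: "cinner x y = cnj (cinner y x)"
    and cinner_add_left: "cinner (x + y) z = cinner x z + cinner y z"
    and cinner_scaleC_left: "cinner (c *\<^sub>C x) y = c * cinner x y"
    and cinner_ge_zero: "0 \<le> Re (cinner x x)"
    and cinner_eq_zero_iff: "cinner x x = 0 \<longleftrightarrow> x = 0"
    and norm_eq_sqrt_cinner: "norm x = sqrt (Re (cinner x x))"

class chilbert_space = complex_inner + complete_space

instantiation vec :: (complex_inner, finite) complex_inner
begin

definition scaleC_vec :: "complex \<Rightarrow> 'a ^ 'b \<Rightarrow> 'a ^ 'b"
  where "scaleC_vec c x = (\<chi> i. c *\<^sub>C (x $ i))"

definition cinner_vec :: "'a ^ 'b \<Rightarrow> 'a ^ 'b \<Rightarrow> complex"
  where "cinner_vec x y = (\<Sum>i\<in>UNIV. cinner (x $ i) (y $ i))"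

instance
proof
  fix c d :: complex and r :: real and x y z :: "'a ^ 'b"
  show "c *\<^sub>C (x + y) = c *\<^sub>C x + c *\<^sub>C y"
    by (simp add: scaleC_vec_def vec_eq_iff scaleC_add_right)
  show "(c + d) *\<^sub>C x = c *\<^sub>C x + d *\<^sub>C x"
    by (simp add: scaleC_vec_def vec_eq_iff scaleC_add_left)
  show "c *\<^sub>C d *\<^sub>C x = (c * d) *\<^sub>C x"
    by (simp add: scaleC_vec_def vec_eq_iff scaleC_scaleC)
  show "complex_of_real r *\<^sub>C x = r *\<^sub>R x"
    by (simp add: scaleC_vec_def vec_eq_iff scaleC_of_real)
  show "cinner x y = cnj (cinner y x)"
    unfolding cinner_vec_def cnj_sum by (intro sum.cong refl cinner_commute)
  show "cinner (x + y) z = cinner x z + cinner y z"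
    by (simp add: cinner_vec_def cinner_add_left sum.distrib)
  show "cinner (c *\<^sub>C x) y = c * cinner x y"
    by (simp add: cinner_vec_def scaleC_vec_def cinner_scaleC_left sum_distrib_left)
  have Re: "Re (cinner x x) = (\<Sum>i\<in>UNIV. (norm (x $ i))\<^sup>2)" for x :: "'a ^ 'b"
    by (simp add: cinner_vec_def norm_eq_sqrt_cinner cinner_ge_zero)
  show "0 \<le> Re (cinner x x)"
    unfolding Re by (simp add: sum_nonneg)
  show nrm: "norm x = sqrt (Re (cinner x x))"
    unfolding Re by (simp add: norm_vec_def L2_set_def)
  show "cinner x x = 0 \<longleftrightarrow> x = 0"
  proof
    assume "cinner x x = 0"
    then have "norm x = 0" by (simp add: nrm)
    then show "x = 0" by simp
  next
    assume "x = 0"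
    then show "cinner x x = 0"
      by (simp add: cinner_vec_def cinner_eq_zero_iff)
  qed
qed

end

instance vec :: (chilbert_space, finite) chilbert_space ..

definition bounded_clinear :: "('a::complex_inner \<Rightarrow> 'b::complex_inner) \<Rightarrow> bool"
  where "bounded_clinear T \<longleftrightarrow> bounded_linear T \<and> (\<forall>c x. T (c *\<^sub>C x) = c *\<^sub>C T x)"

definition numerical_range :: "('a::complex_inner \<Rightarrow> 'a) \<Rightarrow> complex set"
  where "numerical_range A = {cinner (A v) v | v. norm v = 1}"

type_synonym ratfun = "complex poly fract"

(* The library function quot_of_fract yields the representation of a fraction in lowest terms,
   with monic denominator; so the poles are exactly the roots of the denominator. *)
definition rat_numer :: "ratfun \<Rightarrow> complex poly"
  where "rat_numer f = fst (quot_of_fract f)"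

definition rat_denom :: "ratfun \<Rightarrow> complex poly"
  where "rat_denom f = snd (quot_of_fract f)"

definition is_rat_pole :: "ratfun \<Rightarrow> complex \<Rightarrow> bool"
  where "is_rat_pole f z \<longleftrightarrow> poly (rat_denom f) z = 0"

definition rat_eval :: "ratfun \<Rightarrow> complex \<Rightarrow> complex"
  where "rat_eval f z = poly (rat_numer f) z / poly (rat_denom f) z"

definition poly_op :: "complex poly \<Rightarrow> ('a::complex_inner \<Rightarrow> 'a) \<Rightarrow> 'a \<Rightarrow> 'a"
  where "poly_op p A x = (\<Sum>k\<le>degree p. coeff p k *\<^sub>C (A ^^ k) x)"

(* f(A) = p(A) q(A)^{-1} for f = p/q in lowest terms. When f has no poles in the spectrum of A,
   q(A) is bijective and the function inverse inv is its inverse operator. *)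
definition rat_op :: "ratfun \<Rightarrow> ('a::complex_inner \<Rightarrow> 'a) \<Rightarrow> 'a \<Rightarrow> 'a"
  where "rat_op f A = poly_op (rat_numer f) A \<circ> inv (poly_op (rat_denom f) A)"

definition mat_eval :: "ratfun ^ 'n ^ 'n \<Rightarrow> complex \<Rightarrow> complex ^ 'n ^ 'n"
  where "mat_eval F z = (\<chi> i j. rat_eval (F $ i $ j) z)"

definition mat_op :: "ratfun ^ 'n ^ 'n \<Rightarrow> ('a::complex_inner \<Rightarrow> 'a) \<Rightarrow> 'a ^ 'n \<Rightarrow> 'a ^ 'n"
  where "mat_op F A x = (\<chi> i. \<Sum>j\<in>UNIV. rat_op (F $ i $ j) A (x $ j))"

end

theory Submission
  imports Defs "HOL-Complex_Analysis.Complex_Analysis" "HOL-Computational_Algebra.Fundamental_Theorem_Algebra"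
begin

text \<open>
  The argument is that of Crouzeix and Palencia, in the form found by Ransford and Schwenninger.
  Let \<open>\<Omega>\<close> be a convex domain around the numerical range, with boundary point \<open>\<sigma>\<close>, outer unit normal
  \<open>\<nu>\<close> and resolvent \<open>R(\<sigma>) = (\<sigma> - A)\<^sup>-\<^sup>1\<close>. Against arc length, Cauchy's formula reads
  \<open>2 \<pi> F(A) = \<integral> F(\<sigma>) \<nu> R(\<sigma>)\<close>. To a matrix function \<open>F\<close> with \<open>\<parallel>F\<parallel> \<le> 1\<close> on \<open>\<Omega>\<close> one associates the Cauchy
  transform \<open>G\<close> of the boundary values of \<open>F\<^sup>*\<close>. Two facts make it useful.

  First, \<open>\<parallel>G\<parallel> \<le> 1\<close> on \<open>\<Omega>\<close> (lemma \<open>conjugate_transform_bound\<close>): at the boundary, \<open>G\<close> is an average of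
  \<open>F\<^sup>*\<close> with respect to a positive measure of mass one, the angle under which the boundary is seen.
  Second, \<open>\<parallel>F(A) + G(A)\<^sup>*\<parallel> \<le> 2\<close> (lemma \<open>dual_estimate\<close>): this sum is the integral of \<open>F(\<sigma>)\<close> against
  \<open>(\<nu> R(\<sigma>) + (\<nu> R(\<sigma>))\<^sup>*) / 2 \<pi>\<close>, which is positive since the numerical range lies behind the tangent at
  \<open>\<sigma>\<close>, and has total mass \<open>2\<close>. With \<open>T = F(A)\<close> and \<open>S = G(A)\<close> the identity
  \<open>T T\<^sup>* T = T (T + S\<^sup>*)\<^sup>* T - T S T\<close>, in which \<open>T S T = (F G F)(A)\<close> and \<open>\<parallel>F G F\<parallel> \<le> 1\<close>, yields
  \<open>K\<^sup>3 \<le> 2 K\<^sup>2 + K\<close> for the best constant \<open>K\<close>, that is \<open>K \<le> 1 + \<surd>2\<close>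
  (lemmas \<open>cubic_inequality\<close> and \<open>complete_spectral_set\<close>).

  For \<open>\<Omega>\<close> polygons with equally spaced normals are taken, circumscribed to the numerical range and
  moved outwards by a distance \<open>s\<close>. They approximate its closure, which is convex by the
  Toeplitz-Hausdorff theorem (lemma \<open>polygon_approximation\<close>), and each side lies in a half-plane on
  which resolvents and logarithms are holomorphic. Moving \<open>s\<close> slightly makes all functions analytic
  across the contours in use, so that no boundary regularity enters. Since \<open>G\<close> is not rational, \<open>F(A)\<close>
  is handled through a relation between holomorphic functions and operators that contains the
  rational functional calculus as well as Cauchy transforms.
\<close>

(* With the coefficient notation of formal power series, vector components would be ambiguous. *)
no_notation fps_nth (infixl "$" 75)

section \<open>Complex inner product spaces\<close>

lemma cinner_add_right: "cinner x (y + z) = cinner x y + cinner x z"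
  by (metis cinner_add_left cinner_commute complex_cnj_add)

lemma cinner_scaleC_right: "cinner x (c *\<^sub>C y) = cnj c * cinner x y"
  by (metis cinner_commute cinner_scaleC_left complex_cnj_mult)

lemma scaleR_eq_scaleC: "r *\<^sub>R x = complex_of_real r *\<^sub>C x"
  by (simp add: scaleC_of_real)

lemma cinner_scaleR_left: "cinner (r *\<^sub>R x) y = of_real r * cinner x y"
  by (simp add: scaleR_eq_scaleC cinner_scaleC_left)

lemma cinner_scaleR_right: "cinner x (r *\<^sub>R y) = of_real r * cinner x y"
  by (simp add: scaleR_eq_scaleC cinner_scaleC_right)

lemma cinner_zero_left [simp]: "cinner 0 y = 0"
  using cinner_scaleR_left[of 0 0 y] by simp

lemma cinner_zero_right [simp]: "cinner x 0 = 0"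
  using cinner_scaleR_right[of x 0 0] by simp

lemma cinner_minus_left: "cinner (- x) y = - cinner x y"
  using cinner_scaleR_left[of "-1" x y] by simp

lemma cinner_minus_right: "cinner x (- y) = - cinner x y"
  using cinner_scaleR_right[of x "-1" y] by simp

lemma cinner_diff_left: "cinner (x - y) z = cinner x z - cinner y z"
  using cinner_add_left[of x "- y" z] by (simp add: cinner_minus_left)

lemma cinner_diff_right: "cinner x (y - z) = cinner x y - cinner x z"
  using cinner_add_right[of x y "- z"] by (simp add: cinner_minus_right)

lemma cinner_sum_left: "cinner (sum f I) y = (\<Sum>i\<in>I. cinner (f i) y)"
  by (induction I rule: infinite_finite_induct) (auto simp: cinner_add_left)

lemma cinner_sum_right: "cinner x (sum f I) = (\<Sum>i\<in>I. cinner x (f i))"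
  by (induction I rule: infinite_finite_induct) (auto simp: cinner_add_right)

lemma cinner_self: "cinner x x = of_real ((norm x)\<^sup>2)"
proof -
  have "Im (cinner x x) = 0"
    using cinner_commute[of x x] by (metis Reals_cnj_iff complex_is_Real_iff)
  then show ?thesis
    by (simp add: complex_eq_iff norm_eq_sqrt_cinner cinner_ge_zero)
qed

lemma scaleC_one [simp]: "1 *\<^sub>C x = x"
  using scaleC_of_real[of 1 x] by simp

lemma scaleC_zero_left [simp]: "0 *\<^sub>C x = 0"
  using scaleC_of_real[of 0 x] by simp

lemma scaleC_zero_right [simp]: "c *\<^sub>C 0 = 0"
  using scaleC_add_right[of c 0 0] by simp

lemma scaleC_minus_left: "(- c) *\<^sub>C x = - (c *\<^sub>C x)"
  by (metis add.left_inverse add_eq_0_iff2 scaleC_add_left scaleC_zero_left)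

lemma scaleC_minus_right: "c *\<^sub>C (- x) = - (c *\<^sub>C x)"
  by (metis add.left_inverse add_eq_0_iff2 scaleC_add_right scaleC_zero_right)

lemma scaleC_diff_right: "c *\<^sub>C (x - y) = c *\<^sub>C x - c *\<^sub>C y"
  using scaleC_add_right[of c x "- y"] by (simp add: scaleC_minus_right)

lemma scaleC_diff_left: "(c - d) *\<^sub>C x = c *\<^sub>C x - d *\<^sub>C x"
  using scaleC_add_left[of c "- d" x] by (simp add: scaleC_minus_left)

lemma scaleC_scaleR_commute: "c *\<^sub>C (r *\<^sub>R x) = r *\<^sub>R (c *\<^sub>C x)"
  by (simp add: scaleR_eq_scaleC scaleC_scaleC mult.commute)

lemma scaleC_sum_right: "c *\<^sub>C (sum f I) = (\<Sum>i\<in>I. c *\<^sub>C f i)"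
  by (induction I rule: infinite_finite_induct) (auto simp: scaleC_add_right)

lemma norm_scaleC: "norm (c *\<^sub>C x) = cmod c * norm x"
proof -
  have "Re (cinner (c *\<^sub>C x) (c *\<^sub>C x)) = (cmod c * norm x)\<^sup>2"
  proof -
    have "cinner (c *\<^sub>C x) (c *\<^sub>C x) = (c * cnj c) * cinner x x"
      by (simp add: cinner_scaleC_left cinner_scaleC_right)
    also have "\<dots> = of_real ((cmod c * norm x)\<^sup>2)"
      by (simp add: cinner_self complex_norm_square[symmetric] power_mult_distrib)
    finally show ?thesis by simp
  qed
  then show ?thesis by (simp add: norm_eq_sqrt_cinner[of "c *\<^sub>C x"])
qed

subsection \<open>Positive semidefinite sesquilinear forms\<close>

locale psd_form =
  fixes B :: "'a::complex_inner \<Rightarrow> 'a \<Rightarrow> complex"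
  assumes add_left: "B (x + y) z = B x z + B y z"
    and scale_left: "B (c *\<^sub>C x) z = c * B x z"
    and herm: "B x y = cnj (B y x)"
    and nonneg: "0 \<le> Re (B x x)"
begin

lemma scale_right: "B x (c *\<^sub>C y) = cnj c * B x y"
  by (metis herm scale_left complex_cnj_mult)

lemma diff_left: "B (x - y) z = B x z - B y z"
proof -
  have "B x z = B (x - y + y) z" by simp
  then show ?thesis unfolding add_left by simp
qed

lemma diff_right: "B x (y - z) = B x y - B x z"
  by (metis diff_left herm complex_cnj_diff)

lemma self_real: "B x x = of_real (Re (B x x))"
  using herm[of x x] by (metis Reals_cnj_iff of_real_Re)

lemma cauchy_schwarz: "(cmod (B x y))\<^sup>2 \<le> Re (B x x) * Re (B y y)"
proof -
  define q where "q = (cmod (B x y))\<^sup>2"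
  define r where "r = Re (B y y)"
  have q: "B x y * cnj (B x y) = of_real q"
    unfolding q_def by (simp add: complex_norm_square[symmetric])
  have *: "0 \<le> Re (B x x) - 2 * t * q + t\<^sup>2 * q * r" for t :: real
  proof -
    define c where "c = of_real t * B x y"
    have "B (x - c *\<^sub>C y) (x - c *\<^sub>C y)
        = B x x - cnj c * B x y - c * B y x + c * cnj c * B y y"
      by (simp add: diff_left diff_right scale_left scale_right algebra_simps)
    also have "\<dots> = B x x - of_real t * (B x y * cnj (B x y)) - of_real t * (B x y * cnj (B x y))
        + of_real (t\<^sup>2) * (B x y * cnj (B x y)) * of_real r"
      using herm[of y x] self_real[of y] unfolding c_def r_def
      by (simp add: power2_eq_square algebra_simps)
    also have "Re \<dots> = Re (B x x) - 2 * t * q + t\<^sup>2 * q * r"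
      unfolding q by simp
    finally show ?thesis using nonneg[of "x - c *\<^sub>C y"] by simp
  qed
  have "q \<le> Re (B x x) * r"
  proof (cases "r = 0")
    case True
    have "q = 0"
    proof (rule ccontr)
      assume "q \<noteq> 0"
      then have "0 < q" by (simp add: q_def)
      with *[of "(Re (B x x) + 1) / (2 * q)"] True show False by simp
    qed
    with True show ?thesis by simp
  next
    case False
    then have r: "0 < r" using nonneg[of y] by (simp add: r_def)
    have "0 \<le> (Re (B x x) - 2 * (1 / r) * q + (1 / r)\<^sup>2 * q * r) * r"
      using *[of "1 / r"] r by (intro mult_nonneg_nonneg) auto
    also have "\<dots> = Re (B x x) * r - q"
      using r by (simp add: field_simps power2_eq_square)
    finally show ?thesis by simp
  qed
  then show ?thesis unfolding q_def r_def .
qed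

text \<open>Gram-Schmidt orthogonalisation, phrased for the Gram matrix so that degenerate vectors need
  no special treatment.\<close>
lemma gram_factorization:
  assumes "finite J"
  shows "\<exists>(n::nat) a. \<forall>i\<in>J. \<forall>j\<in>J. B (x i) (x j) = (\<Sum>k<n. a i k * cnj (a j k))"
  using assms
proof (induction J arbitrary: x)
  case empty
  then show ?case by simp
next
  case (insert p J)
  define d where "d = Re (B (x p) (x p))"
  have Bpp: "B (x p) (x p) = of_real d" unfolding d_def by (rule self_real)
  show ?case
  proof (cases "d = 0")
    case True
    have zero: "B (x i) (x p) = 0" "B (x p) (x i) = 0" for i
      using cauchy_schwarz[of "x i" "x p"] cauchy_schwarz[of "x p" "x i"] True
      by (simp_all add: d_def)
    obtain n a where a: "\<forall>i\<in>J. \<forall>j\<in>J. B (x i) (x j) = (\<Sum>k<(n::nat). a i k * cnj (a j k))"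
      using insert.IH[of x] by blast
    define a' where "a' = (\<lambda>i k. if i = p then 0 else a i k)"
    have "\<forall>i\<in>insert p J. \<forall>j\<in>insert p J. B (x i) (x j) = (\<Sum>k<n. a' i k * cnj (a' j k))"
    proof (intro ballI)
      fix i j assume ij: "i \<in> insert p J" "j \<in> insert p J"
      show "B (x i) (x j) = (\<Sum>k<n. a' i k * cnj (a' j k))"
        using a zero ij by (cases "i = p"; cases "j = p") (simp_all add: a'_def)
    qed
    then show ?thesis by blast
  next
    case False
    then have d: "0 < d" using nonneg[of "x p"] by (simp add: d_def)
    define x' where "x' = (\<lambda>i. x i - (B (x i) (x p) / of_real d) *\<^sub>C x p)"
    have x': "B (x' i) (x' j) = B (x i) (x j) - B (x i) (x p) * B (x p) (x j) / of_real d" for i j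
      using d herm[of "x p" "x j"]
      by (simp add: x'_def diff_left diff_right scale_left scale_right Bpp field_simps)
    obtain n a where a: "\<forall>i\<in>J. \<forall>j\<in>J. B (x' i) (x' j) = (\<Sum>k<(n::nat). a i k * cnj (a j k))"
      using insert.IH[of x'] by blast
    define a' where "a' = (\<lambda>i k. if k < n then (if i = p then 0 else a i k)
      else B (x i) (x p) / of_real (sqrt d))"
    have last: "a' i n * cnj (a' j n) = B (x i) (x p) * B (x p) (x j) / of_real d" for i j
    proof -
      have "complex_of_real (sqrt d) * of_real (sqrt d) = of_real d"
        using d by (simp flip: of_real_mult)
      then show ?thesis using herm[of "x p" "x j"] by (simp add: a'_def)
    qed
    have "B (x i) (x j) = (\<Sum>k<Suc n. a' i k * cnj (a' j k))"
      if "i \<in> insert p J" "j \<in> insert p J" for i j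
    proof (cases "i = p \<or> j = p")
      case True
      then have "(\<Sum>k<n. a' i k * cnj (a' j k)) = 0" by (auto simp: a'_def)
      then show ?thesis using True d Bpp by (auto simp: last)
    next
      case False
      then have "(\<Sum>k<n. a' i k * cnj (a' j k)) = (\<Sum>k<n. a i k * cnj (a j k))"
        by (auto simp: a'_def)
      also have "\<dots> = B (x' i) (x' j)" using a that False by auto
      finally show ?thesis unfolding sum.lessThan_Suc last x' by simp
    qed
    then show ?thesis by blast
  qed
qed

text \<open>Factoring the Gram matrix turns the ampliation of a matrix to a semi-inner product space into
  a sum of copies of the matrix itself, so the norm does not grow.\<close>
lemma matrix_ampliation_le:
  fixes F :: "'n::finite \<Rightarrow> 'n \<Rightarrow> complex" and x y :: "'n \<Rightarrow> 'a"
  assumes M: "0 \<le> M"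
    and F: "\<And>u v :: complex ^ 'n.
      cmod (\<Sum>i\<in>UNIV. \<Sum>j\<in>UNIV. F i j * u $ j * cnj (v $ i)) \<le> M * norm u * norm v"
  shows "cmod (\<Sum>i\<in>UNIV. \<Sum>j\<in>UNIV. F i j * B (x j) (y i))
      \<le> M / 2 * ((\<Sum>j\<in>UNIV. Re (B (x j) (x j))) + (\<Sum>i\<in>UNIV. Re (B (y i) (y i))))"
proof -
  obtain n a where a: "\<And>i j. B (case_sum x y i) (case_sum x y j) = (\<Sum>k<(n::nat). a i k * cnj (a j k))"
    using gram_factorization[of "UNIV :: ('n + 'n) set" "case_sum x y"] by auto
  define u v :: "nat \<Rightarrow> complex ^ 'n"
    where "u = (\<lambda>k. \<chi> j. a (Inl j) k)" and "v = (\<lambda>k. \<chi> i. a (Inr i) k)"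
  have xy: "B (x j) (y i) = (\<Sum>k<n. u k $ j * cnj (v k $ i))" for i j
    using a[of "Inl j" "Inr i"] by (simp add: u_def v_def)
  have nrm: "(norm w)\<^sup>2 = (\<Sum>i\<in>UNIV. (cmod (w $ i))\<^sup>2)" for w :: "complex ^ 'n"
    by (simp add: norm_vec_def L2_set_def sum_nonneg)
  have xx: "(\<Sum>j\<in>UNIV. Re (B (x j) (x j))) = (\<Sum>k<n. (norm (u k))\<^sup>2)"
  proof -
    have "Re (B (x j) (x j)) = (\<Sum>k<n. (cmod (u k $ j))\<^sup>2)" for j
      using a[of "Inl j" "Inl j"] by (simp add: u_def cmod_power2 flip: power2_eq_square)
    then show ?thesis by (simp add: nrm sum.swap[of _ UNIV])
  qed
  have yy: "(\<Sum>i\<in>UNIV. Re (B (y i) (y i))) = (\<Sum>k<n. (norm (v k))\<^sup>2)"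
  proof -
    have "Re (B (y i) (y i)) = (\<Sum>k<n. (cmod (v k $ i))\<^sup>2)" for i
      using a[of "Inr i" "Inr i"] by (simp add: v_def cmod_power2 flip: power2_eq_square)
    then show ?thesis by (simp add: nrm sum.swap[of _ UNIV])
  qed
  have "(\<Sum>i\<in>UNIV. \<Sum>j\<in>UNIV. F i j * B (x j) (y i))
      = (\<Sum>i\<in>UNIV. \<Sum>j\<in>UNIV. \<Sum>k<n. F i j * u k $ j * cnj (v k $ i))"
    by (simp add: xy sum_distrib_left mult.assoc)
  also have "\<dots> = (\<Sum>i\<in>UNIV. \<Sum>k<n. \<Sum>j\<in>UNIV. F i j * u k $ j * cnj (v k $ i))"
    by (intro sum.cong refl sum.swap)
  also have "\<dots> = (\<Sum>k<n. \<Sum>i\<in>UNIV. \<Sum>j\<in>UNIV. F i j * u k $ j * cnj (v k $ i))"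
    by (rule sum.swap)
  finally have "cmod (\<Sum>i\<in>UNIV. \<Sum>j\<in>UNIV. F i j * B (x j) (y i))
      \<le> (\<Sum>k<n. M * norm (u k) * norm (v k))"
    using F by (simp add: sum_norm_le)
  also have "\<dots> \<le> (\<Sum>k<n. M / 2 * ((norm (u k))\<^sup>2 + (norm (v k))\<^sup>2))"
  proof (rule sum_mono)
    fix k
    have "2 * (norm (u k) * norm (v k)) \<le> (norm (u k))\<^sup>2 + (norm (v k))\<^sup>2"
      using sum_squares_bound[of "norm (u k)" "norm (v k)"] by simp
    from mult_left_mono[OF this, of "M / 2"] M
    show "M * norm (u k) * norm (v k) \<le> M / 2 * ((norm (u k))\<^sup>2 + (norm (v k))\<^sup>2)"
      by (simp add: mult.assoc)
  qed
  also have "\<dots> = M / 2 * ((\<Sum>k<n. (norm (u k))\<^sup>2) + (\<Sum>k<n. (norm (v k))\<^sup>2))"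
    by (simp only: sum.distrib flip: sum_distrib_left)
  finally show ?thesis by (simp only: xx yy)
qed

end

interpretation cinner: psd_form cinner
  by unfold_locales
    (auto simp: cinner_add_left cinner_scaleC_left cinner_ge_zero intro: cinner_commute)

lemma cinner_cauchy_schwarz: "cmod (cinner x y) \<le> norm x * norm y"
proof -
  have "(cmod (cinner x y))\<^sup>2 \<le> (norm x * norm y)\<^sup>2"
    using cinner.cauchy_schwarz[of x y] by (simp add: cinner_self power_mult_distrib)
  then show ?thesis by (rule power2_le_imp_le) simp
qed

lemma norm_le_of_cinner_le:
  assumes "0 \<le> C" "\<And>y. cmod (cinner x y) \<le> C * norm y"
  shows "norm x \<le> C"
proof -
  have "norm x * norm x \<le> C * norm x"
    using assms(2)[of x] by (simp add: cinner_self norm_mult power2_eq_square)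
  then show ?thesis using assms(1)
    by (metis mult_le_cancel_right norm_le_zero_iff norm_zero not_le)
qed

lemma cinner_ext:
  assumes "\<And>y. cinner x y = cinner x' y"
  shows "x = x'"
proof -
  have "cinner (x - x') (x - x') = 0" using assms by (simp add: cinner_diff_left)
  then show ?thesis by (simp add: cinner_eq_zero_iff)
qed

lemma bounded_bilinear_scaleC: "bounded_bilinear ((*\<^sub>C) :: complex \<Rightarrow> 'a::complex_inner \<Rightarrow> 'a)"
proof
  show "\<exists>K. \<forall>c (x::'a). norm (c *\<^sub>C x) \<le> norm c * norm x * K"
    by (rule exI[of _ 1]) (simp add: norm_scaleC)
qed (simp_all add: scaleC_add_left scaleC_add_right scaleC_scaleR_commute scaleR_eq_scaleC
      scaleC_scaleC scaleR_conv_of_real mult.commute)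

lemma bounded_bilinear_cinner:
  "bounded_bilinear (cinner :: 'a::complex_inner \<Rightarrow> 'a \<Rightarrow> complex)"
proof
  show "\<exists>K. \<forall>(x::'a) y. norm (cinner x y) \<le> norm x * norm y * K"
    by (rule exI[of _ 1]) (simp add: cinner_cauchy_schwarz)
qed (simp_all add: cinner_add_left cinner_add_right cinner_scaleR_left cinner_scaleR_right
      scaleR_conv_of_real)

lemmas continuous_on_scaleC = bounded_bilinear.continuous_on[OF bounded_bilinear_scaleC]
lemmas continuous_on_cinner = bounded_bilinear.continuous_on[OF bounded_bilinear_cinner]

instance chilbert_space \<subseteq> banach ..

text \<open>This makes the coordinate spaces on which matrices act instances of the operator setting.\<close>
instantiation complex :: complex_inner
begin

definition scaleC_complex :: "complex \<Rightarrow> complex \<Rightarrow> complex"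
  where "scaleC_complex c x = c * x"

definition cinner_complex :: "complex \<Rightarrow> complex \<Rightarrow> complex"
  where "cinner_complex x y = x * cnj y"

instance
  by standard
    (auto simp: scaleC_complex_def cinner_complex_def algebra_simps scaleR_conv_of_real cmod_def
       power2_eq_square)

end

subsection \<open>Bounded complex-linear maps\<close>

lemma bounded_clinearI:
  assumes "\<And>x y. T (x + y) = T x + T y" "\<And>c x. T (c *\<^sub>C x) = c *\<^sub>C T x"
    and "\<And>x. norm (T x) \<le> K * norm x"
  shows "bounded_clinear T"
  unfolding bounded_clinear_def
proof
  show "bounded_linear T"
    by (rule bounded_linear_intro[of T K])
      (simp_all add: assms(1,2) scaleR_eq_scaleC assms(3) mult.commute[of "norm _"])
qed (simp add: assms)

lemma bounded_clinear_add: "bounded_clinear T \<Longrightarrow> T (x + y) = T x + T y"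
  by (simp add: bounded_clinear_def linear_simps)

lemma bounded_clinear_diff: "bounded_clinear T \<Longrightarrow> T (x - y) = T x - T y"
  by (simp add: bounded_clinear_def linear_simps)

lemma bounded_clinear_scaleC: "bounded_clinear T \<Longrightarrow> T (c *\<^sub>C x) = c *\<^sub>C T x"
  by (simp add: bounded_clinear_def)

lemma bounded_clinear_zero: "bounded_clinear T \<Longrightarrow> T 0 = 0"
  by (simp add: bounded_clinear_def linear_simps)

lemma bounded_clinear_sum: "bounded_clinear T \<Longrightarrow> T (sum f I) = (\<Sum>i\<in>I. T (f i))"
  by (simp add: bounded_clinear_def linear_sum bounded_linear.linear)

text \<open>The Lax-Milgram lemma: for small \<open>\<rho>\<close> the map \<open>x \<mapsto> x - \<rho> (T x - y)\<close> is a contraction.\<close>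
lemma lax_milgram:
  fixes T :: "'a::chilbert_space \<Rightarrow> 'a"
  assumes T: "bounded_clinear T" and b: "0 < b"
    and coercive: "\<And>x. b * (norm x)\<^sup>2 \<le> Re (cinner (T x) x)"
  shows "bij T" and "\<And>x. b * norm x \<le> norm (T x)"
proof -
  show lower: "b * norm x \<le> norm (T x)" for x
  proof (cases "x = 0")
    case False
    have "b * norm x * norm x \<le> norm (T x) * norm x"
      using coercive[of x] complex_Re_le_cmod[of "cinner (T x) x"] cinner_cauchy_schwarz[of "T x" x]
      by (simp add: power2_eq_square mult.assoc)
    with False show ?thesis by simp
  qed simp
  obtain K where K: "0 < K" "\<And>x. norm (T x) \<le> norm x * K"
    using T bounded_linear.pos_bounded[of T] by (auto simp: bounded_clinear_def)
  have inj: "inj T"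
  proof (rule injI)
    fix x y assume "T x = T y"
    then have "T (x - y) = 0" using T by (simp add: bounded_clinear_diff)
    then show "x = y" using lower[of "x - y"] b by (simp add: mult_le_0_iff)
  qed
  define \<rho> where "\<rho> = b / (K\<^sup>2 + b\<^sup>2)"
  have den: "0 < K\<^sup>2 + b\<^sup>2" using K b by (simp add: add_pos_pos)
  have \<rho>: "0 < \<rho>" using den b by (simp add: \<rho>_def)
  define c where "c = 1 - 2 * \<rho> * b + \<rho>\<^sup>2 * K\<^sup>2"
  have c1: "c < 1"
  proof -
    have "\<rho> * K\<^sup>2 < 2 * b"
      using b den K(1) by (simp add: \<rho>_def divide_simps add_pos_pos algebra_simps add_strict_increasing)
    then have "\<rho> * (\<rho> * K\<^sup>2) < \<rho> * (2 * b)" using \<rho> by simp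
    then show ?thesis by (simp add: c_def power2_eq_square algebra_simps)
  qed
  have contr: "(norm (x - \<rho> *\<^sub>R T x))\<^sup>2 \<le> c * (norm x)\<^sup>2" for x
  proof -
    have "(norm (x - \<rho> *\<^sub>R T x))\<^sup>2 = Re (cinner (x - \<rho> *\<^sub>R T x) (x - \<rho> *\<^sub>R T x))"
      by (simp add: cinner_self)
    also have "\<dots> = (norm x)\<^sup>2 - 2 * \<rho> * Re (cinner (T x) x) + \<rho>\<^sup>2 * (norm (T x))\<^sup>2"
      unfolding cinner_diff_left cinner_diff_right cinner_scaleR_left cinner_scaleR_right
      using arg_cong[OF cinner_commute[of x "T x"], of Re]
      by (simp add: cinner_self power2_eq_square algebra_simps)
    also have "\<dots> \<le> (norm x)\<^sup>2 - 2 * \<rho> * (b * (norm x)\<^sup>2) + \<rho>\<^sup>2 * (norm x * K)\<^sup>2"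
      using coercive[of x] K(2)[of x] \<rho>
      by (intro add_mono diff_mono mult_left_mono power_mono) auto
    also have "\<dots> = c * (norm x)\<^sup>2"
      by (simp add: c_def power_mult_distrib algebra_simps)
    finally show ?thesis .
  qed
  have surj: "\<exists>x. T x = y" for y
  proof (cases "\<exists>x::'a. x \<noteq> 0")
    case True
    then obtain x0 :: 'a where x0: "x0 \<noteq> 0" by blast
    have c0: "0 \<le> c"
      using contr[of x0] x0 by (meson mult_less_0_iff not_le order_trans zero_le_power2 zero_less_norm_iff zero_less_power)
    define f where "f = (\<lambda>x. x - \<rho> *\<^sub>R (T x - y))"
    have "dist (f u) (f v) \<le> sqrt c * dist u v" for u v
    proof -
      have "f u - f v = (u - v) - \<rho> *\<^sub>R T (u - v)"
        using T by (simp add: f_def bounded_clinear_diff algebra_simps)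
      then have "(dist (f u) (f v))\<^sup>2 \<le> (sqrt c * dist u v)\<^sup>2"
        using contr[of "u - v"] c0 by (simp add: dist_norm power_mult_distrib)
      then show ?thesis by (rule power2_le_imp_le) (simp add: c0)
    qed
    then have "\<exists>!x. f x = x"
      using c0 c1 by (intro banach_fix_type[of "sqrt c"]) auto
    then obtain x where "f x = x" by blast
    then show ?thesis using \<rho> by (auto simp: f_def)
  next
    case False
    then show ?thesis by metis
  qed
  show "bij T"
    using inj surj by (metis bijI surjI)
qed

subsection \<open>Convexity of the numerical range\<close>

text \<open>The Toeplitz-Hausdorff theorem. For unit vectors \<open>x\<close>, \<open>y\<close> with distinct values
  \<open>a\<close>, \<open>b\<close>, the affinely normalised form \<open>q v = (\<langle>A v, v\<rangle> - b |v|\<^sup>2) / (a - b)\<close> takes the values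
  \<open>1\<close> and \<open>0\<close> there; a unimodular factor on \<open>x\<close> makes \<open>q\<close> real on the segment between them, and the
  intermediate value theorem applies.\<close>
theorem convex_numerical_range:
  fixes A :: "'a::complex_inner \<Rightarrow> 'a"
  assumes A: "bounded_clinear A"
  shows "convex (numerical_range A)"
proof (rule convexI)
  fix a b :: complex and r s :: real
  assume a: "a \<in> numerical_range A" and b: "b \<in> numerical_range A"
    and rs: "0 \<le> r" "0 \<le> s" "r + s = 1"
  obtain x where x: "norm x = 1" "cinner (A x) x = a"
    using a by (auto simp: numerical_range_def)
  obtain y where y: "norm y = 1" "cinner (A y) y = b"
    using b by (auto simp: numerical_range_def)
  show "r *\<^sub>R a + s *\<^sub>R b \<in> numerical_range A"
  proof (cases "a = b")
    case True
    then show ?thesis using b rs by (simp flip: scaleR_add_left)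
  next
    case False
    define q where "q = (\<lambda>u v. (cinner (A u) v - b * cinner u v) / (a - b))"
    have q_add_left: "q (u + u') v = q u v + q u' v" for u u' v
      using A by (simp add: q_def bounded_clinear_add cinner_add_left algebra_simps add_divide_distrib diff_divide_distrib)
    have q_add_right: "q u (v + v') = q u v + q u v'" for u v v'
      by (simp add: q_def cinner_add_right algebra_simps add_divide_distrib diff_divide_distrib)
    have q_scale_left: "q (c *\<^sub>C u) v = c * q u v" for c u v
      using A by (simp add: q_def bounded_clinear_scaleC cinner_scaleC_left algebra_simps)
    have q_scale_right: "q u (c *\<^sub>C v) = cnj c * q u v" for c u v
      by (simp add: q_def cinner_scaleC_right algebra_simps)
    have qx: "q x x = 1" and qy: "q y y = 0"
      using x y False by (simp_all add: q_def cinner_self)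
    define \<gamma> where "\<gamma> = q x y - cnj (q y x)"
    define \<omega> where "\<omega> = (if \<gamma> = 0 then 1 else cnj \<gamma> / cmod \<gamma>)"
    have \<omega>: "cmod \<omega> = 1" by (simp add: \<omega>_def norm_divide)
    have \<omega>2: "\<omega> * cnj \<omega> = 1" using \<omega> by (simp add: complex_norm_square[symmetric])
    have "\<omega> * \<gamma> = of_real (cmod \<gamma>)"
      using complex_norm_square[of \<gamma>]
      by (simp add: \<omega>_def power2_eq_square mult.commute nonzero_divide_eq_eq)
    then have "Im (\<omega> * \<gamma>) = 0" by simp
    then have im: "Im (\<omega> * q x y + cnj \<omega> * q y x) = 0"
      by (simp add: \<gamma>_def algebra_simps)
    define p where "p = Re (\<omega> * q x y + cnj \<omega> * q y x)"
    define z where "z = (\<lambda>t::real. (of_real t * \<omega>) *\<^sub>C x + of_real (1 - t) *\<^sub>C y)"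
    have qz: "q (z t) (z t) = of_real (t\<^sup>2 + t * (1 - t) * p)" for t
    proof -
      have "q (z t) (z t) = of_real (t\<^sup>2) * (\<omega> * cnj \<omega>) * q x x
        + of_real (t * (1 - t)) * (\<omega> * q x y + cnj \<omega> * q y x) + of_real ((1 - t)\<^sup>2) * q y y"
        unfolding z_def q_add_left q_add_right q_scale_left q_scale_right
        by (simp add: power2_eq_square algebra_simps)
      also have "\<omega> * q x y + cnj \<omega> * q y x = of_real p"
        using im by (simp add: p_def complex_eq_iff)
      finally show ?thesis by (simp add: \<omega>2 qx qy)
    qed
    \<comment> \<open>linear dependence of \<open>x\<close> and \<open>y\<close> would give them the same value of \<open>q\<close>, up to a factor\<close>
    have z0: "z t \<noteq> 0" for t
    proof
      assume zt: "z t = 0"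
      have "q (z t) (z t) = 0" by (simp add: zt q_def A bounded_clinear_zero)
      have e: "of_real (1 - t) *\<^sub>C y = (- of_real t * \<omega>) *\<^sub>C x"
        using zt by (simp add: z_def scaleC_minus_left add_eq_0_iff)
      have "q (of_real (1 - t) *\<^sub>C y) (of_real (1 - t) *\<^sub>C y) = 0"
        unfolding q_scale_left q_scale_right qy by simp
      then have "(- of_real t * \<omega>) * (cnj (- of_real t * \<omega>) * q x x) = 0"
        unfolding e q_scale_left q_scale_right by simp
      then have "t = 0" using \<omega> qx by auto
      with e y show False by simp
    qed
    have contz: "continuous_on UNIV z"
      unfolding z_def by (intro continuous_intros continuous_on_scaleC)
    define f where "f = (\<lambda>t. t\<^sup>2 + t * (1 - t) * p - r * (norm (z t))\<^sup>2)"
    have "\<exists>t. 0 \<le> t \<and> t \<le> 1 \<and> f t = 0"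
    proof (rule IVT')
      show "f 0 \<le> 0" using rs by (simp add: f_def)
      show "0 \<le> f 1" using rs x \<omega> by (simp add: f_def z_def norm_scaleC)
      show "continuous_on {0..1} f" unfolding f_def
        by (intro continuous_intros continuous_on_subset[OF contz]) auto
    qed simp
    then obtain t where t: "f t = 0" by blast
    define w where "w = (1 / norm (z t)) *\<^sub>R z t"
    have w: "norm w = 1" using z0[of t] by (simp add: w_def)
    have "q w w = of_real ((1 / norm (z t))\<^sup>2) * q (z t) (z t)"
      unfolding w_def scaleR_eq_scaleC q_scale_left q_scale_right by (simp add: power2_eq_square)
    also have "\<dots> = of_real r"
      using t z0[of t] unfolding qz of_real_mult[symmetric] of_real_eq_iff
      by (simp add: f_def power2_eq_square field_simps)
    finally have "cinner (A w) w - b = of_real r * (a - b)"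
      using False w by (simp add: q_def cinner_self field_simps)
    moreover have s: "s = 1 - r" using rs by simp
    ultimately have "cinner (A w) w = r *\<^sub>R a + s *\<^sub>R b"
      unfolding s by (simp add: scaleR_conv_of_real algebra_simps)
    then show ?thesis using w unfolding numerical_range_def by (metis (mono_tags, lifting) mem_Collect_eq)
  qed
qed

section \<open>Circumscribed polygons\<close>

text \<open>The model for \<open>h\<close> is the support function of a convex set. The last hypothesis is sublinearity for
  three neighbouring directions; it says that the sides have nonnegative length. At least five sides
  make the exterior angle \<open>\<delta>\<close> acute.\<close>
locale polygon =
  fixes h :: "real \<Rightarrow> real" and N :: nat
  assumes N5: "5 \<le> N"
    and periodic: "h (\<theta> + 2 * pi) = h \<theta>"
    and sublinear: "2 * cos (2 * pi / real N) * h \<theta> \<le> h (\<theta> - 2 * pi / real N) + h (\<theta> + 2 * pi / real N)"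
begin

definition \<delta> :: real where "\<delta> = 2 * pi / real N"

abbreviation ang :: "nat \<Rightarrow> real" where "ang k \<equiv> real k * \<delta>"

abbreviation nu :: "nat \<Rightarrow> complex" where "nu k \<equiv> cis (ang k)"

lemma N_pos: "0 < N" using N5 by simp

lemma N\<delta>: "real N * \<delta> = 2 * pi"
  using N5 by (simp add: \<delta>_def)

lemma \<delta>_pos: "0 < \<delta>"
  using N5 by (simp add: \<delta>_def)

lemma \<delta>_less: "\<delta> < pi / 2"
proof -
  have "5 * \<delta> \<le> real N * \<delta>" using N5 \<delta>_pos by (intro mult_right_mono) auto
  then show ?thesis using pi_gt_zero unfolding N\<delta> by linarith
qed

lemma sin\<delta>: "0 < sin \<delta>"
  using \<delta>_pos \<delta>_less by (intro sin_gt_zero) auto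

lemma cos\<delta>: "0 < cos \<delta>"
  using \<delta>_pos \<delta>_less by (intro cos_gt_zero) auto

text \<open>The depth of \<open>z\<close> behind the side line with outer normal \<open>cis \<theta>\<close>, after moving that line outwards
  by \<open>s\<close>.\<close>
definition dep :: "real \<Rightarrow> real \<Rightarrow> complex \<Rightarrow> real"
  where "dep s \<theta> z = h \<theta> + s - Re (cis (- \<theta>) * z)"

definition Om :: "real \<Rightarrow> complex set"
  where "Om s = {z. \<forall>k<N. 0 < dep s (ang k) z}"

definition Pg :: "real \<Rightarrow> complex set"
  where "Pg s = {z. \<forall>k<N. 0 \<le> dep s (ang k) z}"

text \<open>The intersection of the side lines with normals \<open>cis \<theta>\<close> and \<open>cis (\<theta> + \<delta>)\<close>; it is the end point,
  in counterclockwise order, of the side with normal \<open>cis \<theta>\<close>.\<close>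
definition vert :: "real \<Rightarrow> real \<Rightarrow> complex"
  where "vert s \<theta> = cis \<theta> * Complex (h \<theta> + s) ((h (\<theta> + \<delta>) + s - cos \<delta> * (h \<theta> + s)) / sin \<delta>)"

definition elen :: "real \<Rightarrow> real \<Rightarrow> real"
  where "elen s \<theta> = (h (\<theta> - \<delta>) + h (\<theta> + \<delta>) + 2 * s - 2 * cos \<delta> * (h \<theta> + s)) / sin \<delta>"

definition pt :: "real \<Rightarrow> nat \<Rightarrow> real \<Rightarrow> complex"
  where "pt s k t = vert s (ang k - \<delta>) + of_real (t * elen s (ang k)) * (\<i> * nu k)"

lemma cis_period: "cis (\<theta> + 2 * pi) = cis \<theta>"
  by (simp add: complex_eq_iff)

lemma dep_period: "dep s (\<theta> + 2 * pi) z = dep s \<theta> z"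
  using cis_period[of "- \<theta> - 2 * pi"] by (simp add: dep_def periodic)

lemma vert_period: "vert s (\<theta> + 2 * pi) = vert s \<theta>"
proof -
  have "h (\<theta> + 2 * pi + \<delta>) = h (\<theta> + \<delta>)"
    using periodic[of "\<theta> + \<delta>"] by (simp add: add_ac)
  then show ?thesis by (simp only: vert_def cis_period periodic)
qed

lemma dep_vert: "dep s \<theta> (vert s \<theta>) = 0"
proof -
  have "cis (- \<theta>) * vert s \<theta> = Complex (h \<theta> + s) ((h (\<theta> + \<delta>) + s - cos \<delta> * (h \<theta> + s)) / sin \<delta>)"
    by (simp add: vert_def cis_mult flip: mult.assoc)
  then show ?thesis by (simp add: dep_def)
qed

lemma elen_nonneg: "0 \<le> s \<Longrightarrow> 0 \<le> elen s \<theta>"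
proof -
  assume s: "0 \<le> s"
  have "2 * cos \<delta> * h \<theta> \<le> h (\<theta> - \<delta>) + h (\<theta> + \<delta>)"
    using sublinear[of \<theta>] by (simp add: \<delta>_def)
  moreover have "2 * cos \<delta> * s \<le> 2 * s"
    using s cos_le_one[of \<delta>] by (simp add: mult_left_le_one_le cos\<delta> less_imp_le)
  ultimately show ?thesis
    using sin\<delta> by (simp add: elen_def divide_nonneg_pos algebra_simps)
qed

lemma vert_diff: "vert s \<theta> - vert s (\<theta> - \<delta>) = of_real (elen s \<theta>) * (\<i> * cis \<theta>)"
proof -
  define a a0 a1 where "a = h \<theta> + s" and "a0 = h (\<theta> - \<delta>) + s" and "a1 = h (\<theta> + \<delta>) + s"
  have *: "cis (- \<delta>) * Complex a0 ((a - cos \<delta> * a0) / sin \<delta>) = Complex a ((cos \<delta> * a - a0) / sin \<delta>)"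
  proof (rule complex_eqI)
    show "Re (cis (- \<delta>) * Complex a0 ((a - cos \<delta> * a0) / sin \<delta>)) = Re (Complex a ((cos \<delta> * a - a0) / sin \<delta>))"
      using sin\<delta> by simp
    have "a0 * (cos \<delta> * cos \<delta>) + a0 * (sin \<delta> * sin \<delta>) = a0"
      by (simp flip: distrib_left)
    then have "Im (cis (- \<delta>) * Complex a0 ((a - cos \<delta> * a0) / sin \<delta>)) = (cos \<delta> * a - a0) / sin \<delta>"
      using sin\<delta> by (simp add: field_simps)
    then show "Im (cis (- \<delta>) * Complex a0 ((a - cos \<delta> * a0) / sin \<delta>)) = Im (Complex a ((cos \<delta> * a - a0) / sin \<delta>))"
      by simp
  qed
  have "vert s (\<theta> - \<delta>) = cis \<theta> * (cis (- \<delta>) * Complex a0 ((a - cos \<delta> * a0) / sin \<delta>))"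
    by (simp add: vert_def a_def a0_def cis_mult flip: mult.assoc)
  also have "\<dots> = cis \<theta> * Complex a ((cos \<delta> * a - a0) / sin \<delta>)" unfolding * ..
  finally have "vert s \<theta> - vert s (\<theta> - \<delta>)
      = cis \<theta> * (Complex a ((a1 - cos \<delta> * a) / sin \<delta>) - Complex a ((cos \<delta> * a - a0) / sin \<delta>))"
    by (simp add: vert_def a_def a1_def right_diff_distrib)
  also have "Complex a ((a1 - cos \<delta> * a) / sin \<delta>) - Complex a ((cos \<delta> * a - a0) / sin \<delta>)
      = of_real (elen s \<theta>) * \<i>"
    by (simp add: complex_eq_iff elen_def a_def a0_def a1_def diff_divide_distrib add_divide_distrib algebra_simps)
  finally show ?thesis by (simp add: algebra_simps)
qed

lemma dep_add: "dep s \<theta> (z + w) = dep s \<theta> z - Re (cis (- \<theta>) * w)"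
  by (simp add: dep_def algebra_simps)

lemma dep_vert': "dep s \<theta> (vert s (\<theta> - \<delta>)) = 0"
proof -
  have "cis (- \<theta>) * (vert s \<theta> - vert s (\<theta> - \<delta>)) = of_real (elen s \<theta>) * \<i> * (cis (- \<theta>) * cis \<theta>)"
    unfolding vert_diff by (simp add: algebra_simps)
  then have "Re (cis (- \<theta>) * (vert s \<theta> - vert s (\<theta> - \<delta>))) = 0"
    by (simp add: cis_mult)
  then show ?thesis
    using dep_vert[of s \<theta>] by (simp add: dep_def right_diff_distrib)
qed

lemma pt_0: "pt s k 0 = vert s (ang k - \<delta>)"
  by (simp add: pt_def)

lemma pt_1: "pt s k 1 = vert s (ang k)"
  using vert_diff[of s "ang k"] by (simp add: pt_def diff_eq_eq add.commute)

lemma dep_convex_comb: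
  "dep s \<theta> ((1 - t) *\<^sub>R z + t *\<^sub>R w) = (1 - t) * dep s \<theta> z + t * dep s \<theta> w"
  by (simp add: dep_def algebra_simps)

lemma pt_convex_comb: "pt s k t = (1 - t) *\<^sub>R vert s (ang k - \<delta>) + t *\<^sub>R vert s (ang k)"
proof -
  have "vert s (ang k) = vert s (ang k - \<delta>) + of_real (elen s (ang k)) * (\<i> * nu k)"
    using vert_diff[of s "ang k"] by (simp add: diff_eq_eq add.commute)
  then show ?thesis by (simp add: pt_def scaleR_conv_of_real algebra_simps)
qed

lemma dep_pt: "dep s (ang k) (pt s k t) = 0"
  unfolding pt_convex_comb dep_convex_comb dep_vert dep_vert' by simp

text \<open>Walking along the polygon away from the line with normal \<open>cis \<theta>\<close>, each edge turns by
  \<open>\<delta>\<close>, and up to half a turn it leads away from that line.\<close>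
lemma dep_vert_forward:
  assumes "0 \<le> s" "real n * \<delta> \<le> pi"
  shows "0 \<le> dep s \<theta> (vert s (\<theta> + real n * \<delta>))"
  using assms(2)
proof (induction n)
  case 0
  then show ?case by (simp add: dep_vert)
next
  case (Suc n)
  define \<phi> where "\<phi> = \<theta> + real (Suc n) * \<delta>"
  have IH: "0 \<le> dep s \<theta> (vert s (\<theta> + real n * \<delta>))"
    using Suc \<delta>_pos by (simp add: algebra_simps)
  have "vert s \<phi> = vert s (\<theta> + real n * \<delta>) + of_real (elen s \<phi>) * (\<i> * cis \<phi>)"
    using vert_diff[of s \<phi>] by (simp add: \<phi>_def algebra_simps diff_eq_eq)
  then have "dep s \<theta> (vert s \<phi>) = dep s \<theta> (vert s (\<theta> + real n * \<delta>))
      - Re (cis (- \<theta>) * (of_real (elen s \<phi>) * (\<i> * cis \<phi>)))"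
    by (simp only: dep_add)
  also have "cis (- \<theta>) * (of_real (elen s \<phi>) * (\<i> * cis \<phi>))
      = of_real (elen s \<phi>) * \<i> * (cis (- \<theta>) * cis \<phi>)" by simp
  also have "Re \<dots> = - (elen s \<phi> * sin (real (Suc n) * \<delta>))"
    unfolding cis_mult by (simp add: \<phi>_def)
  finally have "dep s \<theta> (vert s \<phi>) = dep s \<theta> (vert s (\<theta> + real n * \<delta>)) + elen s \<phi> * sin (real (Suc n) * \<delta>)"
    by simp
  moreover have "0 \<le> sin (real (Suc n) * \<delta>)"
    using Suc.prems \<delta>_pos by (intro sin_ge_zero) auto
  ultimately show ?case
    using IH elen_nonneg[OF assms(1)] by (simp add: \<phi>_def)
qed

lemma dep_vert_backward:
  assumes "0 \<le> s" "real n * \<delta> \<le> pi"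
  shows "0 \<le> dep s \<theta> (vert s (\<theta> - \<delta> - real n * \<delta>))"
  using assms(2)
proof (induction n)
  case 0
  then show ?case by (simp add: dep_vert')
next
  case (Suc n)
  define \<phi> where "\<phi> = \<theta> - \<delta> - real n * \<delta>"
  have IH: "0 \<le> dep s \<theta> (vert s \<phi>)"
    using Suc \<delta>_pos by (simp add: \<phi>_def algebra_simps)
  have "vert s (\<phi> - \<delta>) = vert s \<phi> + (- (of_real (elen s \<phi>) * (\<i> * cis \<phi>)))"
    using vert_diff[of s \<phi>] by (simp add: algebra_simps)
  then have "dep s \<theta> (vert s (\<phi> - \<delta>)) = dep s \<theta> (vert s \<phi>)
      - Re (cis (- \<theta>) * (- (of_real (elen s \<phi>) * (\<i> * cis \<phi>))))"
    by (simp only: dep_add)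
  also have "cis (- \<theta>) * (- (of_real (elen s \<phi>) * (\<i> * cis \<phi>)))
      = - of_real (elen s \<phi>) * \<i> * (cis (- \<theta>) * cis \<phi>)" by simp
  also have "Re \<dots> = elen s \<phi> * sin (- \<theta> + \<phi>)"
    unfolding cis_mult by simp
  also have "- \<theta> + \<phi> = - (real (Suc n) * \<delta>)" by (simp add: \<phi>_def algebra_simps)
  finally have "dep s \<theta> (vert s (\<phi> - \<delta>)) = dep s \<theta> (vert s \<phi>) + elen s \<phi> * sin (real (Suc n) * \<delta>)"
    by simp
  moreover have "0 \<le> sin (real (Suc n) * \<delta>)"
    using Suc.prems \<delta>_pos by (intro sin_ge_zero) auto
  ultimately have "0 \<le> dep s \<theta> (vert s (\<phi> - \<delta>))"
    using IH elen_nonneg[OF assms(1)] by simp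
  moreover have "\<theta> - \<delta> - real (Suc n) * \<delta> = \<phi> - \<delta>" by (simp add: \<phi>_def algebra_simps)
  ultimately show ?case by (simp only:)
qed

lemma dep_vert_nonneg:
  assumes s: "0 \<le> s" and "j < N" "k < N"
  shows "0 \<le> dep s (ang k) (vert s (real j * \<delta>))"
proof -
  define n where "n = (if k \<le> j then j - k else N - (k - j))"
  define m where "m = N - 1 - n"
  have nN: "n < N" using assms by (auto simp: n_def)
  have "vert s (ang k + real n * \<delta>) = vert s (real j * \<delta>)"
  proof (cases "k \<le> j")
    case True
    then have "ang k + real n * \<delta> = real j * \<delta>"
      by (simp add: n_def of_nat_diff algebra_simps)
    then show ?thesis by simp
  next
    case False
    have "ang k + real n * \<delta> = real j * \<delta> + real N * \<delta>"
      using False assms by (simp add: n_def of_nat_diff algebra_simps)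
    then show ?thesis by (simp add: N\<delta> vert_period)
  qed
  moreover have "vert s (ang k - \<delta> - real m * \<delta>) = vert s (ang k + real n * \<delta>)"
  proof -
    have "ang k - \<delta> - real m * \<delta> + real N * \<delta> = ang k + real n * \<delta>"
      using nN by (simp add: m_def of_nat_diff algebra_simps)
    then show ?thesis
      using vert_period[of s "ang k - \<delta> - real m * \<delta>"] unfolding N\<delta> by metis
  qed
  moreover have "real n * \<delta> \<le> pi \<or> real m * \<delta> \<le> pi"
  proof -
    have "real n * \<delta> + real m * \<delta> = real N * \<delta> - \<delta>"
      using nN by (simp add: m_def of_nat_diff algebra_simps)
    then show ?thesis using \<delta>_pos N\<delta> by linarith
  qed
  ultimately show ?thesis
    using dep_vert_forward[OF s, of n "ang k"] dep_vert_backward[OF s, of m "ang k"]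
    by auto
qed

lemma vert_in_Pg: "0 \<le> s \<Longrightarrow> k < N \<Longrightarrow> vert s (ang k) \<in> Pg s"
  by (auto simp: Pg_def dep_vert_nonneg)

lemma minus_\<delta>: "vert s (- \<delta>) = vert s (real (N - 1) * \<delta>)" "dep s (- \<delta>) z = dep s (real (N - 1) * \<delta>) z"
proof -
  have "- \<delta> + 2 * pi = real (N - 1) * \<delta>"
    using N5 N\<delta> by (simp add: of_nat_diff left_diff_distrib)
  then show "vert s (- \<delta>) = vert s (real (N - 1) * \<delta>)" "dep s (- \<delta>) z = dep s (real (N - 1) * \<delta>) z"
    using vert_period[of s "- \<delta>"] dep_period[of s "- \<delta>"] by auto
qed

lemma vert_in_Pg': "0 \<le> s \<Longrightarrow> k < N \<Longrightarrow> vert s (ang k - \<delta>) \<in> Pg s"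
  using vert_in_Pg[of s "k - 1"] vert_in_Pg[of s "N - 1"] N5
  by (cases k) (auto simp: minus_\<delta> algebra_simps)

lemma convex_Pg: "convex (Pg s)"
proof (rule convexI)
  fix x y and u v :: real
  assume *: "x \<in> Pg s" "y \<in> Pg s" "0 \<le> u" "0 \<le> v" "u + v = 1"
  then have u: "u = 1 - v" by simp
  show "u *\<^sub>R x + v *\<^sub>R y \<in> Pg s"
    using * unfolding u by (auto simp: Pg_def dep_convex_comb)
qed

lemma convex_Om: "convex (Om s)"
proof (rule convexI)
  fix x y and u v :: real
  assume *: "x \<in> Om s" "y \<in> Om s" "0 \<le> u" "0 \<le> v" "u + v = 1"
  then have u: "u = 1 - v" by simp
  have "0 < (1 - v) * a + v * b" if "0 < a" "0 < b" for a b :: real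
    using that * by (cases "v = 0") (auto intro!: add_nonneg_pos)
  then show "u *\<^sub>R x + v *\<^sub>R y \<in> Om s"
    using * unfolding u by (auto simp: Om_def dep_convex_comb)
qed

lemma continuous_on_dep [continuous_intros]: "continuous_on S (dep s \<theta>)"
  unfolding dep_def by (intro continuous_intros)

lemma open_Om: "open (Om s)"
proof -
  have "open (dep s \<theta> -` {0<..})" for \<theta>
    by (intro open_vimage continuous_on_dep) auto
  moreover have "Om s = (\<Inter>k\<in>{..<N}. dep s (ang k) -` {0<..})"
    by (auto simp: Om_def)
  ultimately show ?thesis by (simp add: open_INT)
qed

lemma closed_Pg: "closed (Pg s)"
proof -
  have "closed (dep s \<theta> -` {0..})" for \<theta>
    by (intro closed_vimage continuous_on_dep) auto
  moreover have "Pg s = (\<Inter>k\<in>{..<N}. dep s (ang k) -` {0..})"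
    by (auto simp: Pg_def)
  ultimately show ?thesis by (simp add: closed_INT)
qed

lemma dep_shift: "dep s' \<theta> z = dep s \<theta> z + (s' - s)"
  by (simp add: dep_def)

lemma Pg_subset_Om: "s < s' \<Longrightarrow> Pg s \<subseteq> Om s'"
  by (force simp: Pg_def Om_def dep_def)

lemma Om_subset_Pg: "Om s \<subseteq> Pg s"
  by (auto simp: Pg_def Om_def less_imp_le)

lemma Om_mono: "s \<le> s' \<Longrightarrow> Om s \<subseteq> Om s'"
  by (force simp: Om_def dep_def)

lemma pt_in_Pg: "0 \<le> s \<Longrightarrow> k < N \<Longrightarrow> t \<in> {0..1} \<Longrightarrow> pt s k t \<in> Pg s"
  unfolding pt_convex_comb
  using convex_Pg[of s] vert_in_Pg[of s k] vert_in_Pg'[of s k] by (simp add: convex_alt)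

lemma frontier_Pg:
  assumes "z \<in> frontier (Pg s)"
  shows "z \<in> Pg s" "\<exists>k<N. dep s (ang k) z = 0"
proof -
  show z: "z \<in> Pg s" using assms closed_Pg by (meson frontier_subset_closed subsetD)
  have "z \<notin> Om s"
    using assms interior_maximal[OF Om_subset_Pg open_Om] by (auto simp: frontier_def)
  with z show "\<exists>k<N. dep s (ang k) z = 0"
    by (force simp: Om_def Pg_def)
qed

lemma nearest_normal: "\<exists>k<N. cos \<delta> \<le> cos (\<alpha> - ang k)"
proof -
  define m where "m = \<lfloor>\<alpha> / \<delta>\<rfloor>"
  define k where "k = nat (m mod int N)"
  have k: "k < N" using N5 by (simp add: k_def nat_less_iff)
  define q where "q = m div int N"
  have "m = int k + int N * q" using N5 by (simp add: k_def q_def)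
  then have m: "real_of_int m = real k + real N * real_of_int q" by (metis of_int_add of_int_mult of_int_of_nat_eq)
  have "real_of_int m \<le> \<alpha> / \<delta>" "\<alpha> / \<delta> < real_of_int m + 1" unfolding m_def by linarith+
  then have b: "0 \<le> \<alpha> - real_of_int m * \<delta>" "\<alpha> - real_of_int m * \<delta> \<le> \<delta>"
    using \<delta>_pos by (auto simp: field_simps)
  have "\<alpha> - ang k = (\<alpha> - real_of_int m * \<delta>) + real_of_int q * (real N * \<delta>)"
    by (simp add: m algebra_simps)
  then have "\<alpha> - ang k = (\<alpha> - real_of_int m * \<delta>) + 2 * pi * real_of_int q"
    unfolding N\<delta> by (simp add: algebra_simps)
  then have "cos (\<alpha> - ang k) = cos ((\<alpha> - real_of_int m * \<delta>) + 2 * pi * real_of_int q)"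
    by (simp only:)
  also have "\<dots> = cos (\<alpha> - real_of_int m * \<delta>)"
    using cos_int_2pin[of q] sin_int_2pin[of q] by (simp only: cos_add)
  finally have "cos (\<alpha> - ang k) = cos (\<alpha> - real_of_int m * \<delta>)" .
  moreover have "cos \<delta> \<le> cos (\<alpha> - real_of_int m * \<delta>)"
    using b \<delta>_less pi_gt_zero by (intro cos_monotone_0_pi_le) auto
  ultimately show ?thesis using k by auto
qed

lemma Re_cis_mult: "Re (cis (- \<theta>) * z) = cmod z * cos (Arg z - \<theta>)"
proof -
  have "cis (- \<theta>) * z = cis (- \<theta>) * rcis (cmod z) (Arg z)" by (simp add: rcis_cmod_Arg)
  also have "\<dots> = of_real (cmod z) * (cis (- \<theta>) * cis (Arg z))" by (simp add: rcis_def)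
  finally show ?thesis by (simp add: cis_mult)
qed

text \<open>Some normal makes an angle of at most \<open>\<delta> < \<pi> / 2\<close> with \<open>z\<close>, so the corresponding side bounds
  \<open>|z|\<close>.\<close>
lemma compact_Pg: "compact (Pg s)"
proof -
  have "cmod z \<le> ((\<Sum>k<N. \<bar>h (ang k)\<bar>) + \<bar>s\<bar>) / cos \<delta>" if z: "z \<in> Pg s" for z
  proof -
    obtain k where k: "k < N" "cos \<delta> \<le> cos (Arg z - ang k)"
      using nearest_normal by blast
    have "cmod z * cos \<delta> \<le> cmod z * cos (Arg z - ang k)"
      using k by (intro mult_left_mono) auto
    also have "\<dots> = Re (cis (- (ang k)) * z)" by (simp only: Re_cis_mult)
    also have "\<dots> \<le> h (ang k) + s" using z k by (auto simp: Pg_def dep_def)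
    also have "\<dots> \<le> \<bar>h (ang k)\<bar> + \<bar>s\<bar>" by linarith
    also have "\<bar>h (ang k)\<bar> \<le> (\<Sum>k<N. \<bar>h (ang k)\<bar>)"
      using k by (intro member_le_sum) auto
    finally show ?thesis using cos\<delta> by (simp add: pos_le_divide_eq)
  qed
  then have "bounded (Pg s)" by (auto intro: boundedI)
  then show ?thesis using closed_Pg by (simp add: compact_eq_bounded_closed)
qed

subsection \<open>Integration along the boundary\<close>

definition edge_cont :: "(nat \<Rightarrow> real \<Rightarrow> 'b::banach) \<Rightarrow> bool"
  where "edge_cont \<psi> \<longleftrightarrow> (\<forall>k<N. continuous_on {0..1} (\<psi> k))"

text \<open>Integration over the boundary with respect to arc length, for integrands given on side \<open>k\<close> as a
  function of the parameter in \<open>[0, 1]\<close>. Vector values and nonholomorphic integrands are needed, and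
  conjugates and norms pass under this integral without changing the measure.\<close>
definition arcint :: "real \<Rightarrow> (nat \<Rightarrow> real \<Rightarrow> 'b::banach) \<Rightarrow> 'b"
  where "arcint s \<psi> = (\<Sum>k<N. elen s (ang k) *\<^sub>R integral {0..1} (\<psi> k))"

lemma edge_contI: "(\<And>k. k < N \<Longrightarrow> continuous_on {0..1} (\<psi> k)) \<Longrightarrow> edge_cont \<psi>"
  by (simp add: edge_cont_def)

lemma edge_integrable: "edge_cont \<psi> \<Longrightarrow> k < N \<Longrightarrow> \<psi> k integrable_on {0..1}"
  by (simp add: edge_cont_def integrable_continuous_interval)

lemma arcint_add:
  assumes "edge_cont \<phi>" "edge_cont \<psi>"
  shows "arcint s (\<lambda>k t. \<phi> k t + \<psi> k t) = arcint s \<phi> + arcint s \<psi>"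
  using edge_integrable[OF assms(1)] edge_integrable[OF assms(2)]
  by (simp add: arcint_def integral_add scaleR_add_right sum.distrib)

lemma arcint_diff:
  assumes "edge_cont \<phi>" "edge_cont \<psi>"
  shows "arcint s (\<lambda>k t. \<phi> k t - \<psi> k t) = arcint s \<phi> - arcint s \<psi>"
  using edge_integrable[OF assms(1)] edge_integrable[OF assms(2)]
  by (simp add: arcint_def integral_diff scaleR_diff_right sum_subtractf)

lemma arcint_linear:
  assumes "bounded_linear L" "edge_cont \<psi>"
  shows "L (arcint s \<psi>) = arcint s (\<lambda>k t. L (\<psi> k t))"
proof -
  interpret bounded_linear L by fact
  have "integral {0..1} (\<lambda>t. L (\<psi> k t)) = L (integral {0..1} (\<psi> k))" if "k < N" for k
    using integral_linear[OF edge_integrable[OF assms(2) that] assms(1)] by (simp add: o_def)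
  then show ?thesis by (simp add: arcint_def sum scale)
qed

lemma arcint_mult_left: "edge_cont \<psi> \<Longrightarrow> arcint s (\<lambda>k t. (c::complex) * \<psi> k t) = c * arcint s \<psi>"
  using arcint_linear[OF bounded_linear_mult_right, of \<psi> c s] by simp

lemma arcint_Re: "edge_cont \<psi> \<Longrightarrow> arcint s (\<lambda>k t. Re (\<psi> k t)) = Re (arcint s \<psi>)"
  using arcint_linear[OF bounded_linear_Re, of \<psi> s] by simp

lemma arcint_cnj: "edge_cont \<psi> \<Longrightarrow> arcint s (\<lambda>k t. cnj (\<psi> k t)) = cnj (arcint s \<psi>)"
  using arcint_linear[OF bounded_linear_cnj, of \<psi> s] by simp

lemma arcint_cmult: "edge_cont \<psi> \<Longrightarrow> arcint s (\<lambda>k t. (c::real) * \<psi> k t) = c * arcint s \<psi>"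
  using arcint_linear[OF bounded_linear_mult_right, of \<psi> c s] by simp

lemma edge_cont_sum:
  "(\<And>i. i \<in> I \<Longrightarrow> edge_cont (\<psi> i)) \<Longrightarrow> edge_cont (\<lambda>k t. \<Sum>i\<in>I. \<psi> i k t)"
  unfolding edge_cont_def by (auto intro!: continuous_on_sum)

lemma arcint_sum:
  assumes "\<And>i. i \<in> I \<Longrightarrow> edge_cont (\<psi> i)"
  shows "arcint s (\<lambda>k t. \<Sum>i\<in>I. \<psi> i k t) = (\<Sum>i\<in>I. arcint s (\<psi> i))"
  using assms
proof (induction I rule: infinite_finite_induct)
  case (insert i I)
  then show ?case by (simp add: arcint_add edge_cont_sum)
qed (simp_all add: arcint_def)

lemma arcint_norm_le:
  assumes "0 \<le> s" "edge_cont \<psi>" "edge_cont \<rho>"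
    and "\<And>k t. k < N \<Longrightarrow> t \<in> {0..1} \<Longrightarrow> norm (\<psi> k t) \<le> \<rho> k t"
  shows "norm (arcint s \<psi>) \<le> arcint s \<rho>"
proof -
  have "norm (elen s (ang k) *\<^sub>R integral {0..1} (\<psi> k)) \<le> elen s (ang k) *\<^sub>R integral {0..1} (\<rho> k)"
    if "k < N" for k
  proof -
    have "norm (integral {0..1} (\<psi> k)) \<le> integral {0..1} (\<rho> k)"
      using assms that by (intro integral_norm_bound_integral edge_integrable) auto
    then show ?thesis using elen_nonneg[OF assms(1)] by (simp add: mult_left_mono)
  qed
  then show ?thesis unfolding arcint_def by (intro sum_norm_le) auto
qed

lemma arcint_cong:
  assumes "\<And>k t. k < N \<Longrightarrow> t \<in> {0..1} \<Longrightarrow> \<psi> k t = \<rho> k t"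
  shows "arcint s \<psi> = arcint s \<rho>"
proof -
  have "integral {0..1} (\<psi> k) = integral {0..1} (\<rho> k)" if "k < N" for k
    using assms that by (intro integral_cong) auto
  then show ?thesis by (simp add: arcint_def)
qed

lemma continuous_on_pt: "continuous_on S (pt s k)"
  unfolding pt_def by (intro continuous_intros)

lemma edge_cont_pt:
  assumes "0 \<le> s" "continuous_on (Pg s) f"
  shows "edge_cont (\<lambda>k t. f (pt s k t))"
  unfolding edge_cont_def using assms pt_in_Pg[OF assms(1)]
  by (auto intro!: continuous_on_compose2[OF assms(2) continuous_on_pt])

lemma edge_cont_holomorphic:
  assumes "0 \<le> s" "f holomorphic_on U" "Pg s \<subseteq> U"
  shows "edge_cont (\<lambda>k t. f (pt s k t))"
  using assms by (blast intro: edge_cont_pt continuous_on_subset holomorphic_on_imp_continuous_on)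

lemma edge_integral:
  assumes "\<And>t. t \<in> {0..1} \<Longrightarrow> (F has_field_derivative f (pt s k t)) (at (pt s k t) within S)"
    and "\<And>t. t \<in> {0..1} \<Longrightarrow> pt s k t \<in> S"
  shows "elen s (ang k) *\<^sub>R integral {0..1} (\<lambda>t. f (pt s k t) * (\<i> * nu k))
      = F (vert s (ang k)) - F (vert s (ang k - \<delta>))"
proof -
  define w where "w = of_real (elen s (ang k)) * (\<i> * nu k)"
  have "((\<lambda>t. w * f (pt s k t)) has_integral (F \<circ> pt s k) 1 - (F \<circ> pt s k) 0) {0..1}"
  proof (rule fundamental_theorem_of_calculus)
    fix t :: real assume t: "t \<in> {0..1}"
    have "(pt s k has_vector_derivative w) (at t within {0..1})"
      unfolding pt_def w_def of_real_mult mult.assoc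
      by (auto intro!: derivative_eq_intros simp: has_vector_derivative_def scaleR_conv_of_real)
    moreover have "(F has_field_derivative f (pt s k t)) (at (pt s k t) within pt s k ` {0..1})"
      using assms t by (blast intro: DERIV_subset)
    ultimately show "(F \<circ> pt s k has_vector_derivative w * f (pt s k t)) (at t within {0..1})"
      by (rule field_vector_diff_chain_within)
  qed simp
  from integral_unique[OF this]
  have *: "integral {0..1} (\<lambda>t. w * f (pt s k t)) = F (vert s (ang k)) - F (vert s (ang k - \<delta>))"
    by (simp only: o_def pt_0 pt_1)
  have "elen s (ang k) *\<^sub>R integral {0..1} (\<lambda>t. f (pt s k t) * (\<i> * nu k))
      = integral {0..1} (\<lambda>t. elen s (ang k) *\<^sub>R (f (pt s k t) * (\<i> * nu k)))"
    by simp
  also have "\<dots> = integral {0..1} (\<lambda>t. w * f (pt s k t))"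
    by (simp add: w_def scaleR_conv_of_real mult_ac)
  finally show ?thesis unfolding * .
qed

lemma telescope:
  fixes f :: "real \<Rightarrow> 'b::ab_group_add"
  shows "(\<Sum>k<n. f (ang k) - f (ang k - \<delta>)) = f (real n * \<delta> - \<delta>) - f (- \<delta>)"
  by (induction n) (simp_all add: algebra_simps)

lemma telescope_closed:
  fixes f :: "complex \<Rightarrow> 'b::ab_group_add"
  shows "(\<Sum>k<N. f (vert s (ang k)) - f (vert s (ang k - \<delta>))) = 0"
proof -
  have "real N * \<delta> - \<delta> = real (N - 1) * \<delta>" using N5 by (simp add: of_nat_diff algebra_simps)
  then show ?thesis
    using telescope[of "\<lambda>\<theta>. f (vert s \<theta>)" N] by (simp add: minus_\<delta>)
qed

text \<open>The complex line element on side \<open>k\<close> is \<open>\<i> nu k\<close> times arc length. Dropping the factor \<open>\<i>\<close>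
  turns contour integrals into integrals against the normal, and \<open>2 \<pi> \<i>\<close> into \<open>2 \<pi>\<close>.\<close>
lemma cauchy_theorem:
  assumes s: "0 \<le> s" and U: "convex U" "open U" "f holomorphic_on U" "Pg s \<subseteq> U"
  shows "arcint s (\<lambda>k t. f (pt s k t) * nu k) = 0"
proof -
  obtain F where F: "\<And>x. x \<in> U \<Longrightarrow> (F has_field_derivative f x) (at x within U)"
    using holomorphic_convex_primitive'[OF U(1,2,3)] by blast
  have "elen s (ang k) *\<^sub>R integral {0..1} (\<lambda>t. f (pt s k t) * (\<i> * nu k))
      = F (vert s (ang k)) - F (vert s (ang k - \<delta>))" if "k < N" for k
    using F pt_in_Pg[OF s that] U(4) by (intro edge_integral[of F f s k U]) auto
  then have "arcint s (\<lambda>k t. f (pt s k t) * (\<i> * nu k)) = 0"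
    unfolding arcint_def by (simp add: telescope_closed)
  moreover have "arcint s (\<lambda>k t. f (pt s k t) * (\<i> * nu k))
      = \<i> * arcint s (\<lambda>k t. f (pt s k t) * nu k)"
  proof -
    have "edge_cont (\<lambda>k t. f (pt s k t))" by (rule edge_cont_holomorphic[OF s U(3,4)])
    then have "edge_cont (\<lambda>k t. f (pt s k t) * nu k)"
      by (auto simp: edge_cont_def intro!: continuous_intros)
    from arcint_mult_left[OF this, of s \<i>] show ?thesis by (simp add: mult_ac)
  qed
  ultimately show ?thesis by simp
qed

lemma Ln_rotate:
  assumes "0 < Re u"
  shows "Ln (u * cis (- \<delta>)) = Ln u - \<i> * of_real \<delta>"
proof -
  have u: "u \<noteq> 0" using assms by auto
  have "\<bar>Im (Ln u)\<bar> < pi / 2" using Re_Ln_pos_lt[OF u] assms by simp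
  then have "Ln (exp (Ln u - \<i> * of_real \<delta>)) = Ln u - \<i> * of_real \<delta>"
    using \<delta>_pos \<delta>_less by (intro Ln_exp) auto
  moreover have "exp (Ln u - \<i> * of_real \<delta>) = u * cis (- \<delta>)"
    using u by (simp add: exp_diff cis_conv_exp exp_minus divide_inverse)
  ultimately show ?thesis by simp
qed

lemma Om_dep: "z \<in> Om s \<Longrightarrow> k < N \<Longrightarrow> 0 < dep s (ang k) z"
  by (simp add: Om_def)

lemma Om_dep_prev: "z \<in> Om s \<Longrightarrow> k < N \<Longrightarrow> 0 < dep s (ang k - \<delta>) z"
  using Om_dep[of z s "k - 1"] Om_dep[of z s "N - 1"] N_pos minus_\<delta>(2)[of s z]
  by (cases k) (simp_all add: algebra_simps)

lemma Re_cis_diff: "Re (cis (- \<theta>) * (w - z)) = dep s \<theta> z - dep s \<theta> w"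
  by (simp add: dep_def right_diff_distrib)

text \<open>The winding number is \<open>1\<close>: on the \<open>k\<close>-th edge the principal logarithm of
  \<open>(w - z) cis (- k \<delta>)\<close> is a primitive, and passing from one edge to the next this
  logarithm changes by \<open>- \<i> \<delta>\<close>.\<close>
lemma arcint_index:
  assumes s: "0 \<le> s" and z: "z \<in> Om s"
  shows "arcint s (\<lambda>k t. nu k / (pt s k t - z)) = 2 * pi"
proof -
  define L where "L = (\<lambda>\<theta>. Ln ((vert s \<theta> - z) * cis (- \<theta>)))"
  have edge: "elen s (ang k) *\<^sub>R integral {0..1} (\<lambda>t. 1 / (pt s k t - z) * (\<i> * nu k))
      = (L (ang k) - L (ang k - \<delta>)) + \<i> * of_real \<delta>" if k: "k < N" for k
  proof -
    define \<theta> where "\<theta> = ang k"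
    have dz: "0 < dep s \<theta> z" using z k by (simp add: Om_def \<theta>_def)
    have "elen s (ang k) *\<^sub>R integral {0..1} (\<lambda>t. 1 / (pt s k t - z) * (\<i> * nu k))
       = Ln ((vert s (ang k) - z) * cis (- \<theta>)) - Ln ((vert s (ang k - \<delta>) - z) * cis (- \<theta>))"
    proof (rule edge_integral[of "\<lambda>w. Ln ((w - z) * cis (- \<theta>))" "\<lambda>w. 1 / (w - z)" s k UNIV])
      fix t :: real
      have "0 < Re ((pt s k t - z) * cis (- \<theta>))"
        using Re_cis_diff[of \<theta> "pt s k t" z s] dep_pt[of s k t] dz by (simp add: \<theta>_def mult.commute)
      then have nz: "(pt s k t - z) * cis (- \<theta>) \<notin> \<real>\<^sub>\<le>\<^sub>0" "pt s k t \<noteq> z"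
        by (auto simp: complex_nonpos_Reals_iff)
      show "((\<lambda>w. Ln ((w - z) * cis (- \<theta>))) has_field_derivative 1 / (pt s k t - z)) (at (pt s k t) within UNIV)"
        using nz by (auto intro!: derivative_eq_intros simp: cis_mult mult.assoc divide_inverse)
    qed simp
    moreover have "Ln ((vert s (\<theta> - \<delta>) - z) * cis (- \<theta>)) = L (\<theta> - \<delta>) - \<i> * of_real \<delta>"
    proof -
      have "0 < Re ((vert s (\<theta> - \<delta>) - z) * cis (- (\<theta> - \<delta>)))"
        using Re_cis_diff[of "\<theta> - \<delta>" "vert s (\<theta> - \<delta>)" z s] Om_dep_prev[OF z k]
        by (simp add: dep_vert \<theta>_def mult.commute)
      from Ln_rotate[OF this] show ?thesis by (simp add: L_def mult.assoc cis_mult)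
    qed
    ultimately show ?thesis by (simp add: L_def \<theta>_def)
  qed
  have "L (real N * \<delta> - \<delta>) = L (- \<delta>)"
    using vert_period[of s "- \<delta>"] cis_period[of "\<delta> - 2 * pi"] by (simp add: L_def N\<delta> algebra_simps)
  then have tele: "(\<Sum>k<N. L (ang k) - L (ang k - \<delta>)) = 0"
    using telescope[of L N] by simp
  have "arcint s (\<lambda>k t. 1 / (pt s k t - z) * (\<i> * nu k))
      = (\<Sum>k<N. (L (ang k) - L (ang k - \<delta>)) + \<i> * of_real \<delta>)"
    unfolding arcint_def by (rule sum.cong[OF refl edge]) simp
  also have "\<dots> = of_nat N * (\<i> * of_real \<delta>)"
    unfolding sum.distrib tele by simp
  also have "\<dots> = \<i> * of_real (real N * \<delta>)" by simp
  finally have "arcint s (\<lambda>k t. 1 / (pt s k t - z) * (\<i> * nu k)) = \<i> * of_real (2 * pi)"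
    by (simp only: N\<delta>)
  moreover have "arcint s (\<lambda>k t. 1 / (pt s k t - z) * (\<i> * nu k))
      = \<i> * arcint s (\<lambda>k t. nu k / (pt s k t - z))"
  proof -
    have "edge_cont (\<lambda>k t. nu k / (pt s k t - z))"
    proof (rule edge_contI)
      fix k assume k: "k < N"
      have "pt s k t \<noteq> z" for t
        using dep_pt[of s k t] z k by (force simp: Om_def)
      then show "continuous_on {0..1} (\<lambda>t. nu k / (pt s k t - z))"
        by (auto intro!: continuous_intros continuous_on_pt)
    qed
    from arcint_mult_left[OF this, of s \<i>] show ?thesis by (simp add: mult_ac)
  qed
  ultimately show ?thesis by simp
qed

lemma pt_neq: "z \<in> Om s \<Longrightarrow> k < N \<Longrightarrow> pt s k t \<noteq> z"
  using dep_pt[of s k t] by (force simp: Om_def)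

lemma cauchy_formula:
  fixes f :: "complex \<Rightarrow> complex"
  assumes s: "0 \<le> s" and U: "convex U" "open U" "f holomorphic_on U" "Pg s \<subseteq> U" and z: "z \<in> Om s"
  shows "arcint s (\<lambda>k t. f (pt s k t) * nu k / (pt s k t - z)) = 2 * pi * f z"
proof -
  define g where "g = (\<lambda>w. if w = z then deriv f z else (f w - f z) / (w - z))"
  have g: "g holomorphic_on U"
    unfolding g_def by (rule pole_lemma_open[OF U(3,2)])
  have cf: "edge_cont (\<lambda>k t. f (pt s k t))" by (rule edge_cont_holomorphic[OF s U(3,4)])
  have c1: "edge_cont (\<lambda>k t. f (pt s k t) * nu k / (pt s k t - z))"
    using cf pt_neq[OF z] by (auto simp: edge_cont_def intro!: continuous_intros continuous_on_pt)
  have c2: "edge_cont (\<lambda>k t. nu k / (pt s k t - z))"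
    using pt_neq[OF z] by (auto simp: edge_cont_def intro!: continuous_intros continuous_on_pt)
  then have c3: "edge_cont (\<lambda>k t. f z * (nu k / (pt s k t - z)))"
    unfolding edge_cont_def by (intro allI impI continuous_on_mult_left) auto
  have "0 = arcint s (\<lambda>k t. g (pt s k t) * nu k)"
    using cauchy_theorem[OF s U(1,2) g U(4)] by simp
  also have "\<dots> = arcint s (\<lambda>k t. f (pt s k t) * nu k / (pt s k t - z)
      - f z * (nu k / (pt s k t - z)))"
    using pt_neq[OF z] by (intro arcint_cong) (simp add: g_def diff_divide_distrib left_diff_distrib)
  also have "\<dots> = arcint s (\<lambda>k t. f (pt s k t) * nu k / (pt s k t - z)) - f z * (2 * pi)"
    unfolding arcint_diff[OF c1 c3] arcint_mult_left[OF c2] arcint_index[OF s z] ..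
  finally show ?thesis by simp
qed

end

section \<open>Cauchy transforms of conjugates\<close>

context polygon
begin

lemma cauchy_transform_holomorphic:
  assumes q: "edge_cont q"
  shows "(\<lambda>z. arcint s (\<lambda>k t. q k t / (pt s k t - z))) holomorphic_on Om s"
proof -
  have "(\<lambda>z. integral (cbox 0 1) (\<lambda>t. q k t / (pt s k t - z))) holomorphic_on Om s" if k: "k < N" for k
  proof (rule leibniz_rule_holomorphic[where fx = "\<lambda>z t. q k t / (pt s k t - z)\<^sup>2"])
    fix z t assume z: "z \<in> Om s"
    show "((\<lambda>z. q k t / (pt s k t - z)) has_field_derivative q k t / (pt s k t - z)\<^sup>2) (at z within Om s)"
      using pt_neq[OF z k, of t] by (auto intro!: derivative_eq_intros simp: power2_eq_square)
  next
    fix z assume z: "z \<in> Om s"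
    show "(\<lambda>t. q k t / (pt s k t - z)) integrable_on cbox 0 1"
      using q k pt_neq[OF z k] unfolding cbox_interval
      by (intro integrable_continuous_interval continuous_intros continuous_on_pt)
        (auto simp: edge_cont_def)
  next
    have "continuous_on (Om s \<times> {0..1}) (\<lambda>x. q k (snd x))"
      using q k by (intro continuous_on_compose2[of "{0..1}" "q k" _ snd] continuous_on_snd continuous_on_id)
        (auto simp: edge_cont_def)
    moreover have "continuous_on (Om s \<times> {0..1}) (\<lambda>x. pt s k (snd x))"
      by (rule continuous_on_compose2[OF continuous_on_pt[of UNIV] continuous_on_snd[OF continuous_on_id]]) simp
    ultimately have "continuous_on (Om s \<times> {0..1}) (\<lambda>x. q k (snd x) / (pt s k (snd x) - fst x)\<^sup>2)"
      using pt_neq[OF _ k] by (intro continuous_on_divide continuous_on_power continuous_on_diff continuous_on_fst continuous_on_id) auto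
    then show "continuous_on (Om s \<times> cbox 0 1) (\<lambda>(z, t). q k t / (pt s k t - z)\<^sup>2)"
      unfolding cbox_interval by (simp add: case_prod_unfold)
  qed (rule convex_Om)
  then show ?thesis
    unfolding arcint_def cbox_interval scaleR_conv_of_real by (intro holomorphic_intros) auto
qed

lemma Re_kernel:
  "Re (nu k / (pt s k t - z)) = dep s (ang k) z / (cmod (pt s k t - z))\<^sup>2"
proof -
  have "Re (nu k / (pt s k t - z))
      = Re (cis (- (ang k)) * (pt s k t - z)) / (cmod (pt s k t - z))\<^sup>2"
    by (simp add: Re_divide cmod_power2)
  then show ?thesis by (simp only: Re_cis_diff[of _ _ _ s] dep_pt diff_zero)
qed

lemma edge_cont_kernel:
  assumes "edge_cont q" "\<And>k t. k < N \<Longrightarrow> t \<in> {0..1} \<Longrightarrow> pt s k t \<noteq> z"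
  shows "edge_cont (\<lambda>k t. q k t * (nu k / (pt s k t - z)))"
  using assms unfolding edge_cont_def
  by (auto intro!: continuous_intros continuous_on_pt)

text \<open>Let \<open>z\<close> have distance \<open>d\<close> to the nearest side line and let \<open>p\<close> be its mirror image in that
  line. The densities \<open>Re (\<nu> / (\<sigma> - z))\<close> and \<open>Re (\<nu> / (\<sigma> - p))\<close> of the angles under which the
  boundary is seen from \<open>z\<close> and \<open>p\<close> have total masses \<open>2 \<pi>\<close> and \<open>0\<close>. Their sum is nonnegative on every
  side, because no side line is nearer to \<open>z\<close> than the mirror. Hence the transform \<open>G\<close> satisfies
  \<open>|G z + G p + 2 \<pi> cnj (\<phi> z)| \<le> 4 \<pi> M\<close>. On the other hand \<open>G z - G p\<close>, the jump of \<open>G\<close> across the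
  boundary, is close to \<open>2 \<pi> cnj (\<phi> z)\<close>, and adding up bounds \<open>2 G z\<close>.\<close>
lemma conjugate_transform_near_boundary:
  assumes s: "0 \<le> s" "s < s1" and \<phi>: "\<phi> holomorphic_on Om s1"
    and M: "\<And>w. w \<in> Om s1 \<Longrightarrow> cmod (\<phi> w) \<le> M"
    and L: "\<And>w w'. w \<in> Pg s \<Longrightarrow> w' \<in> Pg s \<Longrightarrow> cmod (\<phi> w - \<phi> w') \<le> L * cmod (w - w')" "0 \<le> L"
    and z: "z \<in> Om s" and d: "0 < d" "d < s1 - s"
    and k0: "k0 < N" "dep s (real k0 * \<delta>) z = d" "\<And>k. k < N \<Longrightarrow> d \<le> dep s (ang k) z"
  shows "cmod (arcint s (\<lambda>k t. cnj (\<phi> (pt s k t)) * (nu k / (pt s k t - z))))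
      \<le> 2 * pi * M + L * sqrt d * (arcint s (\<lambda>k t. 1) + 2 * pi) / 2"
proof -
  define e where "e = cis (real k0 * \<delta>)"
  define p where "p = z + of_real (2 * d) * e"
  define Kz where "Kz = (\<lambda>k t. nu k / (pt s k t - z))"
  define Kp where "Kp = (\<lambda>k t. nu k / (pt s k t - p))"
  define f where "f = (\<lambda>k t. \<phi> (pt s k t))"
  define G where "G = (\<lambda>K. arcint s (\<lambda>k t. cnj (f k t) * K k t))"
  have zP: "z \<in> Pg s" using z Om_subset_Pg by blast
  have PO: "Pg s \<subseteq> Om s1" using s by (intro Pg_subset_Om)
  have ptP: "pt s k t \<in> Pg s" if "k < N" "t \<in> {0..1}" for k t
    using pt_in_Pg[OF s(1)] that by blast
  have dep_p: "dep s \<theta> p = dep s \<theta> z - 2 * d * Re (cis (- \<theta>) * e)" for \<theta>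
    unfolding p_def dep_add by (simp add: algebra_simps)
  have dep_p0: "dep s (real k0 * \<delta>) p = - d"
    unfolding dep_p k0 by (simp add: e_def cis_mult)
  have p_out: "p \<notin> Om (s + d)"
    using k0(1) dep_p0 dep_shift[of "s + d" "real k0 * \<delta>" p s] by (force simp: Om_def)
  then have p_notP: "p \<notin> Pg s" using Pg_subset_Om[of s "s + d"] d by auto
  have nz: "pt s k t \<noteq> z" if "k < N" for k t using pt_neq[OF z that] .
  have np: "pt s k t \<noteq> p" if "k < N" "t \<in> {0..1}" for k t using ptP[OF that] p_notP by auto

  have cf: "edge_cont f" unfolding f_def by (rule edge_cont_holomorphic[OF s(1) \<phi> PO])
  have c1: "edge_cont (\<lambda>k t. 1 :: complex)" by (simp add: edge_cont_def)
  note ck = edge_cont_kernel[of _ s z, folded Kz_def] edge_cont_kernel[of _ s p, folded Kp_def]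
  have cKz: "edge_cont Kz" using ck(1)[OF c1] nz by (simp add: Kz_def)
  have cKp: "edge_cont Kp" using ck(2)[OF c1] np by (simp add: Kp_def)

  have AIz: "arcint s Kz = 2 * pi" unfolding Kz_def using arcint_index[OF s(1) z] .
  have AIfz: "arcint s (\<lambda>k t. f k t * Kz k t) = 2 * pi * \<phi> z"
    using cauchy_formula[OF s(1) convex_Om open_Om \<phi> PO z] by (simp add: f_def Kz_def)
  have outside: "arcint s (\<lambda>k t. g (pt s k t) * Kp k t) = 0" if g: "g holomorphic_on Om s1" for g
  proof -
    have "(\<lambda>w. g w / (w - p)) holomorphic_on Om (s + d)"
      using p_out d by (intro holomorphic_intros holomorphic_on_subset[OF g] Om_mono) auto
    from cauchy_theorem[OF s(1) convex_Om open_Om this Pg_subset_Om] d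
    show ?thesis by (simp add: Kp_def mult_ac)
  qed
  have AIp: "arcint s Kp = 0" using outside[of "\<lambda>_. 1"] by simp
  have AIfp: "arcint s (\<lambda>k t. f k t * Kp k t) = 0" unfolding f_def by (rule outside[OF \<phi>])

  have dist_le: "cmod (pt s k t - z) \<le> cmod (pt s k t - p)" if "k < N" "t \<in> {0..1}" for k t
  proof -
    define w where "w = pt s k t - z"
    have "Re (cnj e * w) = dep s (real k0 * \<delta>) z - dep s (real k0 * \<delta>) (pt s k t)"
      using Re_cis_diff[of "real k0 * \<delta>" "pt s k t" z s] by (simp add: w_def e_def)
    then have we: "Re (cnj e * w) \<le> d" using ptP[OF that] k0 by (auto simp: Pg_def)
    have "(cmod (pt s k t - p))\<^sup>2 = (cmod (w - of_real (2 * d) * e))\<^sup>2"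
      by (simp add: w_def p_def algebra_simps)
    also have "\<dots> = (cmod w)\<^sup>2 - 4 * d * Re (cnj e * w) + 4 * d\<^sup>2 * ((Re e)\<^sup>2 + (Im e)\<^sup>2)"
      unfolding cmod_power2 by (simp add: power2_eq_square algebra_simps)
    also have "(Re e)\<^sup>2 + (Im e)\<^sup>2 = 1" by (simp add: e_def)
    finally have "(cmod (pt s k t - p))\<^sup>2 = (cmod w)\<^sup>2 + 4 * d * (d - Re (cnj e * w))"
      by (simp add: power2_eq_square algebra_simps)
    then have "(cmod w)\<^sup>2 \<le> (cmod (pt s k t - p))\<^sup>2" using we d by simp
    then show ?thesis unfolding w_def by (rule power2_le_imp_le) simp
  qed

  define \<kappa> where "\<kappa> = (\<lambda>k t. Re (Kz k t) + Re (Kp k t))"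
  have \<kappa>_nonneg: "0 \<le> \<kappa> k t" if kt: "k < N" "t \<in> {0..1}" for k t
  proof -
    define b b' where "b = dep s (ang k) z" and "b' = dep s (ang k) p"
    define r r' where "r = (cmod (pt s k t - z))\<^sup>2" and "r' = (cmod (pt s k t - p))\<^sup>2"
    have r: "0 < r" "r \<le> r'"
      using nz[OF kt(1)] dist_le[OF kt] by (auto simp: r_def r'_def intro: power_mono)
    have b: "d \<le> b" using k0 kt by (simp add: b_def)
    have "Re (cis (- (ang k)) * e) \<le> 1"
      using complex_Re_le_cmod[of "cis (- (ang k)) * e"] by (simp add: e_def norm_mult)
    then have "2 * d * Re (cis (- (ang k)) * e) \<le> 2 * d" using d by simp
    then have bb: "0 \<le> b + b'" using b unfolding b'_def dep_p b_def by simp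
    have "b / r + b' / r' \<ge> 0"
    proof (cases "0 \<le> b'")
      case True
      then show ?thesis using r b d by simp
    next
      case False
      then have "b' / r \<le> b' / r'" using r by (simp add: divide_left_mono_neg)
      moreover have "0 \<le> (b + b') / r" using bb r by simp
      ultimately show ?thesis by (simp add: add_divide_distrib)
    qed
    then show ?thesis by (simp add: \<kappa>_def Kz_def Kp_def Re_kernel b_def b'_def r_def r'_def)
  qed
  have c\<kappa>: "edge_cont \<kappa>" using cKz cKp unfolding \<kappa>_def edge_cont_def by (auto intro!: continuous_intros)
  have AI\<kappa>: "arcint s \<kappa> = 2 * pi"
  proof -
    have "edge_cont (\<lambda>k t. Re (Kz k t))" "edge_cont (\<lambda>k t. Re (Kp k t))"
      using cKz cKp unfolding edge_cont_def by (auto intro!: continuous_intros)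
    then show ?thesis unfolding \<kappa>_def
      by (simp add: arcint_add arcint_Re cKz cKp AIz AIp)
  qed

  have sum_bound: "cmod (G Kz + G Kp + 2 * pi * cnj (\<phi> z)) \<le> 4 * pi * M"
  proof -
    define H where "H = (\<lambda>k t. cnj (f k t) * of_real (2 * \<kappa> k t))"
    have cH: "edge_cont H" using cf c\<kappa> unfolding H_def edge_cont_def
      by (auto intro!: continuous_intros)
    have H: "H = (\<lambda>k t. (cnj (f k t) * Kz k t + cnj (f k t * Kz k t)) + (cnj (f k t) * Kp k t + cnj (f k t * Kp k t)))"
    proof (intro ext)
      fix k t
      have "complex_of_real (2 * \<kappa> k t) = (Kz k t + cnj (Kz k t)) + (Kp k t + cnj (Kp k t))"
        by (simp add: \<kappa>_def complex_add_cnj)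
      then show "H k t = (cnj (f k t) * Kz k t + cnj (f k t * Kz k t)) + (cnj (f k t) * Kp k t + cnj (f k t * Kp k t))"
        unfolding H_def by (simp only: complex_cnj_mult distrib_left add_ac)
    qed
    have c: "edge_cont (\<lambda>k t. f k t * Kz k t)" "edge_cont (\<lambda>k t. f k t * Kp k t)"
      "edge_cont (\<lambda>k t. cnj (f k t) * Kz k t)" "edge_cont (\<lambda>k t. cnj (f k t) * Kp k t)"
      using cf cKz cKp unfolding edge_cont_def by (auto intro!: continuous_intros)
    have c': "edge_cont (\<lambda>k t. cnj (f k t * Kz k t))" "edge_cont (\<lambda>k t. cnj (f k t * Kp k t))"
      using c unfolding edge_cont_def by (auto simp del: complex_cnj_mult intro!: continuous_intros)
    have c'': "edge_cont (\<lambda>k t. cnj (f k t) * Kz k t + cnj (f k t * Kz k t))"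
      "edge_cont (\<lambda>k t. cnj (f k t) * Kp k t + cnj (f k t * Kp k t))"
      using c c' unfolding edge_cont_def by (auto simp del: complex_cnj_mult intro!: continuous_on_add)
    have "arcint s H = G Kz + cnj (2 * pi * \<phi> z) + (G Kp + cnj 0)"
      unfolding H G_def arcint_add[OF c''] arcint_add[OF c(3) c'(1)] arcint_add[OF c(4) c'(2)]
        arcint_cnj[OF c(1)] arcint_cnj[OF c(2)] AIfz AIfp ..
    then have "G Kz + G Kp + 2 * pi * cnj (\<phi> z) = arcint s H" by simp
    also have "cmod (arcint s H) \<le> arcint s (\<lambda>k t. (2 * M) * \<kappa> k t)"
    proof (rule arcint_norm_le[OF s(1) cH])
      show "edge_cont (\<lambda>k t. 2 * M * \<kappa> k t)"
        using c\<kappa> unfolding edge_cont_def by (auto intro!: continuous_intros)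
      fix k t assume kt: "k < N" "t \<in> {0..1::real}"
      have "cmod (f k t) \<le> M" unfolding f_def using M ptP[OF kt] PO by blast
      then show "cmod (H k t) \<le> 2 * M * \<kappa> k t"
        using \<kappa>_nonneg[OF kt] by (simp add: H_def norm_mult mult_right_mono)
    qed
    also have "\<dots> = 4 * pi * M" unfolding arcint_cmult[OF c\<kappa>] AI\<kappa> by simp
    finally show ?thesis by simp
  qed

  have jump_bound: "cmod (G Kz - G Kp - 2 * pi * cnj (\<phi> z)) \<le> L * sqrt d * (arcint s (\<lambda>k t. 1) + 2 * pi)"
  proof -
    define E where "E = (\<lambda>k t. (cnj (f k t) - cnj (\<phi> z)) * (Kz k t - Kp k t))"
    have cE: "edge_cont E" using cf cKz cKp unfolding E_def edge_cont_def
      by (auto intro!: continuous_intros)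
    have c: "edge_cont (\<lambda>k t. cnj (f k t) * Kz k t)" "edge_cont (\<lambda>k t. cnj (f k t) * Kp k t)"
      "edge_cont (\<lambda>k t. cnj (\<phi> z) * Kz k t)" "edge_cont (\<lambda>k t. cnj (\<phi> z) * Kp k t)"
      using cf cKz cKp unfolding edge_cont_def by (auto intro!: continuous_intros)
    have c': "edge_cont (\<lambda>k t. cnj (f k t) * Kz k t - cnj (f k t) * Kp k t)"
       "edge_cont (\<lambda>k t. cnj (\<phi> z) * Kz k t - cnj (\<phi> z) * Kp k t)"
      using c unfolding edge_cont_def by (auto intro!: continuous_on_diff)
    have E: "E = (\<lambda>k t. (cnj (f k t) * Kz k t - cnj (f k t) * Kp k t) - (cnj (\<phi> z) * Kz k t - cnj (\<phi> z) * Kp k t))"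
      unfolding E_def by (intro ext) (simp add: algebra_simps)
    have "arcint s E = G Kz - G Kp - (cnj (\<phi> z) * (2 * pi) - cnj (\<phi> z) * 0)"
      unfolding E G_def arcint_diff[OF c'] arcint_diff[OF c(1,2)] arcint_diff[OF c(3,4)]
        arcint_mult_left[OF cKz] arcint_mult_left[OF cKp] AIz AIp ..
    then have "G Kz - G Kp - 2 * pi * cnj (\<phi> z) = arcint s E" by simp
    also have "cmod (arcint s E) \<le> arcint s (\<lambda>k t. L * sqrt d * (1 + Re (Kz k t)))"
    proof (rule arcint_norm_le[OF s(1) cE])
      show "edge_cont (\<lambda>k t. L * sqrt d * (1 + Re (Kz k t)))"
        using cKz unfolding edge_cont_def by (auto intro!: continuous_intros)
      fix k t assume kt: "k < N" "t \<in> {0..1::real}"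
      define r where "r = cmod (pt s k t - z)"
      define r' where "r' = cmod (pt s k t - p)"
      have r: "0 < r" "r \<le> r'" using nz[OF kt(1)] dist_le[OF kt] by (auto simp: r_def r'_def)
      have "Kz k t - Kp k t = nu k * (z - p) / ((pt s k t - z) * (pt s k t - p))"
        using nz[OF kt(1), of t] np[OF kt] by (simp add: Kz_def Kp_def divide_simps) (simp add: algebra_simps)
      then have "cmod (Kz k t - Kp k t) = cmod (z - p) / (r * r')"
        by (simp add: norm_mult norm_divide r_def r'_def)
      also have "cmod (z - p) = 2 * d" using d by (simp add: p_def e_def norm_mult)
      finally have K: "cmod (Kz k t - Kp k t) = 2 * d / (r * r')" .
      have "cmod (cnj (f k t) - cnj (\<phi> z)) = cmod (f k t - \<phi> z)"
        by (metis complex_cnj_diff complex_mod_cnj)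
      also have "\<dots> \<le> L * r" unfolding f_def r_def using L(1)[OF ptP[OF kt] zP] .
      finally have "cmod (E k t) \<le> L * r * (2 * d / (r * r'))"
        unfolding E_def norm_mult K using r d by (intro mult_right_mono) auto
      also have "\<dots> = L * (2 * d / r')" using r by simp
      also have "\<dots> \<le> L * (2 * d / r)"
        using r d L(2) by (intro mult_left_mono divide_left_mono) auto
      \<comment> \<open>the arithmetic-geometric mean with weights chosen such that both terms integrate to \<open>O(sqrt d)\<close>;
        \<open>d / r\<^sup>2\<close> is below the angle density, whose total mass is known\<close>
      also have "\<dots> \<le> L * (sqrt d * (1 + d / r\<^sup>2))"
      proof (intro mult_left_mono L(2))
        have "0 \<le> sqrt d * (1 - sqrt d / r)\<^sup>2" using d by simp
        also have "\<dots> = sqrt d * (1 + d / r\<^sup>2) - 2 * d / r"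
        proof -
          have "sqrt d * (1 - sqrt d / r)\<^sup>2 = sqrt d * (1 + (sqrt d)\<^sup>2 / r\<^sup>2) - 2 * (sqrt d)\<^sup>2 / r"
            using r by (simp add: field_simps power2_eq_square)
          then show ?thesis using d by simp
        qed
        finally show "2 * d / r \<le> sqrt d * (1 + d / r\<^sup>2)" by simp
      qed
      also have "\<dots> \<le> L * (sqrt d * (1 + Re (Kz k t)))"
      proof -
        have "d / r\<^sup>2 \<le> Re (Kz k t)"
          unfolding Kz_def Re_kernel r_def using k0(3)[OF kt(1)] by (intro divide_right_mono) auto
        then show ?thesis using L(2) d by (intro mult_left_mono add_left_mono) auto
      qed
      finally show "cmod (E k t) \<le> L * sqrt d * (1 + Re (Kz k t))" by (simp add: mult.assoc)
    qed
    also have "\<dots> = L * sqrt d * (arcint s (\<lambda>k t. 1) + 2 * pi)"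
    proof -
      have c: "edge_cont (\<lambda>k t. 1 :: real)" "edge_cont (\<lambda>k t. Re (Kz k t))"
        using cKz unfolding edge_cont_def by (auto intro!: continuous_intros)
      then have "edge_cont (\<lambda>k t. 1 + Re (Kz k t))"
        unfolding edge_cont_def by (auto intro: continuous_on_add)
      from arcint_cmult[OF this] show ?thesis by (simp add: arcint_add[OF c] arcint_Re[OF cKz] AIz)
    qed
    finally show ?thesis .
  qed
  have "2 * G Kz = (G Kz + G Kp + 2 * pi * cnj (\<phi> z)) + (G Kz - G Kp - 2 * pi * cnj (\<phi> z))"
    by simp
  then have "cmod (2 * G Kz) \<le> 4 * pi * M + L * sqrt d * (arcint s (\<lambda>k t. 1) + 2 * pi)"
    using norm_triangle_le[OF add_mono[OF sum_bound jump_bound]] by simp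
  then show ?thesis by (simp add: G_def f_def Kz_def norm_mult)
qed

text \<open>The maximum principle on a slightly smaller polygon carries the estimate near the boundary
  inside.\<close>
lemma conjugate_transform_bound:
  assumes s: "0 \<le> s" "s < s1" and \<phi>: "\<phi> holomorphic_on Om s1"
    and M: "\<And>w. w \<in> Om s1 \<Longrightarrow> cmod (\<phi> w) \<le> M" and z: "z \<in> Om s"
  shows "cmod (arcint s (\<lambda>k t. cnj (\<phi> (pt s k t)) * (nu k / (pt s k t - z)))) \<le> 2 * pi * M"
proof -
  define G where "G = (\<lambda>z. arcint s (\<lambda>k t. cnj (\<phi> (pt s k t)) * (nu k / (pt s k t - z))))"
  have PO: "Pg s \<subseteq> Om s1" using s by (intro Pg_subset_Om)
  have cf: "edge_cont (\<lambda>k t. \<phi> (pt s k t))" by (rule edge_cont_holomorphic[OF s(1) \<phi> PO])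
  have "edge_cont (\<lambda>k t. cnj (\<phi> (pt s k t)) * nu k)"
    using cf unfolding edge_cont_def by (auto intro!: continuous_intros)
  from cauchy_transform_holomorphic[OF this, of s] have G: "G holomorphic_on Om s"
    by (simp add: G_def)
  have "deriv \<phi> holomorphic_on Om s1" using \<phi> open_Om by (rule holomorphic_deriv)
  then have "continuous_on (Pg s) (deriv \<phi>)"
    using PO by (meson continuous_on_subset holomorphic_on_imp_continuous_on)
  then have "bounded (deriv \<phi> ` Pg s)"
    using compact_Pg by (intro compact_imp_bounded compact_continuous_image)
  then obtain L where L: "0 < L" "\<And>w. w \<in> Pg s \<Longrightarrow> cmod (deriv \<phi> w) \<le> L"
    by (auto simp: bounded_pos)
  have lip: "cmod (\<phi> w - \<phi> w') \<le> L * cmod (w - w')" if "w \<in> Pg s" "w' \<in> Pg s" for w w'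
  proof (rule field_differentiable_bound[OF convex_Pg, where f' = "deriv \<phi>"])
    fix x assume "x \<in> Pg s"
    then show "(\<phi> has_field_derivative deriv \<phi> x) (at x within Pg s)"
      using PO \<phi> open_Om holomorphic_derivI by blast
  qed (use that L in auto)
  define C where "C = L * (arcint s (\<lambda>k t. 1) + 2 * pi) / 2"
  have "0 \<le> arcint s (\<lambda>k t. 1 :: real)"
    unfolding arcint_def using elen_nonneg[OF s(1)] by (auto intro!: sum_nonneg)
  then have C: "0 < C" unfolding C_def using L by (simp add: add_nonneg_pos)
  define d1 where "d1 = Min ((\<lambda>k. dep s (ang k) z) ` {..<N})"
  have fin: "finite ((\<lambda>k. dep s (ang k) z) ` {..<N})" "(\<lambda>k. dep s (ang k) z) ` {..<N} \<noteq> {}"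
    using N_pos by auto
  have d1: "0 < d1" "\<And>k. k < N \<Longrightarrow> d1 \<le> dep s (ang k) z"
    using z fin unfolding d1_def by (auto simp: Om_def)
  show ?thesis
  proof (rule field_le_epsilon)
    fix \<epsilon> :: real assume \<epsilon>: "0 < \<epsilon>"
    define d where "d = min (min d1 ((s1 - s) / 2)) ((\<epsilon> / C)\<^sup>2)"
    have d: "0 < d" "d \<le> d1" "d < s1 - s" "d \<le> (\<epsilon> / C)\<^sup>2"
      using d1 s \<epsilon> C by (auto simp: d_def min_def)
    have "sqrt d \<le> \<epsilon> / C" using d(4) \<epsilon> C by (intro real_le_lsqrt) auto
    then have sd: "C * sqrt d \<le> \<epsilon>" using C by (simp add: field_simps)
    have sub: "Pg (s - d) \<subseteq> Om s" using d by (intro Pg_subset_Om) simp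
    have "cmod (G z) \<le> 2 * pi * M + \<epsilon>"
    proof (rule maximum_modulus_frontier[of G "Pg (s - d)"])
      show "G holomorphic_on interior (Pg (s - d))"
        using G by (rule holomorphic_on_subset) (use sub interior_subset in blast)
      show "continuous_on (closure (Pg (s - d))) G"
        using G sub closed_Pg by (simp add: holomorphic_on_imp_continuous_on holomorphic_on_subset)
      show "bounded (Pg (s - d))" using compact_Pg compact_imp_bounded by blast
      show "z \<in> Pg (s - d)"
        using d1(2) d dep_shift[of "s - d" _ z s] by (force simp: Pg_def)
      fix w assume w: "w \<in> frontier (Pg (s - d))"
      obtain k0 where k0: "k0 < N" "dep (s - d) (real k0 * \<delta>) w = 0"
        using frontier_Pg(2)[OF w] by blast
      have wP: "w \<in> Pg (s - d)" using frontier_Pg(1)[OF w] .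
      have "cmod (G w) \<le> 2 * pi * M + L * sqrt d * (arcint s (\<lambda>k t. 1) + 2 * pi) / 2"
        unfolding G_def
      proof (rule conjugate_transform_near_boundary[OF s \<phi> M lip])
        show "w \<in> Om s" using wP sub by blast
        show "dep s (real k0 * \<delta>) w = d" using k0 dep_shift[of "s - d" _ w s] by simp
        show "d \<le> dep s (ang k) w" if "k < N" for k
          using wP that dep_shift[of "s - d" "ang k" w s] by (auto simp: Pg_def)
      qed (use k0 d L in auto)
      then show "cmod (G w) \<le> 2 * pi * M + \<epsilon>" using sd by (simp add: C_def mult_ac)
    qed
    then show "cmod (arcint s (\<lambda>k t. cnj (\<phi> (pt s k t)) * (nu k / (pt s k t - z)))) \<le> 2 * pi * M + \<epsilon>"
      by (simp add: G_def)
  qed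
qed

end

section \<open>Resolvents and a functional calculus\<close>

locale range_polygon = polygon +
  fixes A :: "'a::chilbert_space \<Rightarrow> 'a"
  assumes A: "bounded_clinear A"
    and range_le: "Re (cis (- \<theta>) * cinner (A x) x) \<le> h \<theta> * (norm x)\<^sup>2"
begin

definition R :: "complex \<Rightarrow> 'a \<Rightarrow> 'a"
  where "R \<sigma> = inv (\<lambda>x. \<sigma> *\<^sub>C x - A x)"

text \<open>A point \<open>\<sigma>\<close> beyond a line that has the numerical range on its other side makes a rotation of
  \<open>\<sigma> - A\<close> coercive; the quantity \<open>- dep 0 \<theta> \<sigma>\<close> is the distance from that line.\<close>
lemma shift_coercive:
  assumes "dep 0 \<theta> \<sigma> < 0"
  shows "bij (\<lambda>x. \<sigma> *\<^sub>C x - A x)" "- dep 0 \<theta> \<sigma> * norm x \<le> norm (\<sigma> *\<^sub>C x - A x)"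
proof -
  define T where "T = (\<lambda>x. cis (- \<theta>) *\<^sub>C (\<sigma> *\<^sub>C x - A x))"
  have shift: "bounded_clinear (\<lambda>x. \<sigma> *\<^sub>C x - A x)"
  proof -
    obtain K where K: "\<And>x. norm (A x) \<le> norm x * K"
      using A bounded_linear.bounded[of A] by (auto simp: bounded_clinear_def)
    show ?thesis
    proof (rule bounded_clinearI[where K = "cmod \<sigma> + K"])
      show "norm (\<sigma> *\<^sub>C x - A x) \<le> (cmod \<sigma> + K) * norm x" for x
        using norm_triangle_ineq4[of "\<sigma> *\<^sub>C x" "A x"] K[of x] by (simp add: norm_scaleC algebra_simps)
    qed (simp_all add: bounded_clinear_add[OF A] bounded_clinear_scaleC[OF A] scaleC_add_right
          scaleC_diff_right scaleC_scaleC mult.commute)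
  qed
  have T: "bounded_clinear T"
  proof -
    obtain K where K: "\<And>x. norm (\<sigma> *\<^sub>C x - A x) \<le> norm x * K"
      using shift bounded_linear.bounded unfolding bounded_clinear_def by blast
    show ?thesis unfolding T_def
    proof (rule bounded_clinearI)
      show "norm (cis (- \<theta>) *\<^sub>C (\<sigma> *\<^sub>C x - A x)) \<le> K * norm x" for x
        using K[of x] by (simp add: norm_scaleC mult.commute)
    qed (simp_all add: bounded_clinear_add[OF A] bounded_clinear_scaleC[OF A] scaleC_add_right
          scaleC_diff_right scaleC_scaleC mult_ac)
  qed
  have coerc: "- dep 0 \<theta> \<sigma> * (norm x)\<^sup>2 \<le> Re (cinner (T x) x)" for x
  proof -
    have "cinner (T x) x = cis (- \<theta>) * \<sigma> * of_real ((norm x)\<^sup>2) - cis (- \<theta>) * cinner (A x) x"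
      by (simp add: T_def cinner_scaleC_left cinner_diff_left cinner_self right_diff_distrib mult.assoc)
    then have "Re (cinner (T x) x) = Re (cis (- \<theta>) * \<sigma>) * (norm x)\<^sup>2 - Re (cis (- \<theta>) * cinner (A x) x)"
      by (simp only: minus_complex.sel Re_complex_of_real times_complex.sel Im_complex_of_real)
    then show ?thesis using range_le[of \<theta> x] by (simp add: dep_def algebra_simps)
  qed
  have pos: "0 < - dep 0 \<theta> \<sigma>" using assms by simp
  note lm = lax_milgram[OF T pos coerc]
  have un: "(\<lambda>x. \<sigma> *\<^sub>C x - A x) = (\<lambda>x. cis \<theta> *\<^sub>C x) \<circ> T"
    by (simp add: T_def fun_eq_iff scaleC_scaleC cis_mult)
  have "bij (\<lambda>x::'a. cis \<theta> *\<^sub>C x)"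
    by (rule o_bij[where g = "\<lambda>x. cis (- \<theta>) *\<^sub>C x"]) (simp_all add: fun_eq_iff scaleC_scaleC cis_mult)
  then show "bij (\<lambda>x. \<sigma> *\<^sub>C x - A x)" unfolding un using lm(1) by (rule bij_comp[rotated])
  show "- dep 0 \<theta> \<sigma> * norm x \<le> norm (\<sigma> *\<^sub>C x - A x)"
    using lm(2)[of x] by (simp add: T_def norm_scaleC)
qed

lemma outside_PgE:
  assumes "\<sigma> \<notin> Pg 0"
  obtains k where "k < N" "dep 0 (ang k) \<sigma> < 0"
  using assms by (auto simp: Pg_def not_le)

lemma R_right: "\<sigma> \<notin> Pg 0 \<Longrightarrow> \<sigma> *\<^sub>C R \<sigma> y - A (R \<sigma> y) = y"
  using surj_f_inv_f[OF bij_is_surj[OF shift_coercive(1)], of _ \<sigma> y]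
  by (auto simp: R_def elim!: outside_PgE)

lemma R_left: "\<sigma> \<notin> Pg 0 \<Longrightarrow> R \<sigma> (\<sigma> *\<^sub>C x - A x) = x"
  using inv_f_f[OF bij_is_inj[OF shift_coercive(1)], of _ \<sigma> x]
  by (auto simp: R_def elim!: outside_PgE)

lemma R_unique: "\<sigma> \<notin> Pg 0 \<Longrightarrow> \<sigma> *\<^sub>C w - A w = y \<Longrightarrow> R \<sigma> y = w"
  using R_left by auto

lemma outside_Pg: "k < N \<Longrightarrow> dep 0 (ang k) \<sigma> < 0 \<Longrightarrow> \<sigma> \<notin> Pg 0"
  by (force simp: Pg_def)

lemma R_norm_le:
  assumes "k < N" "dep 0 (ang k) \<sigma> < 0"
  shows "norm (R \<sigma> y) \<le> norm y / - dep 0 (ang k) \<sigma>"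
  using shift_coercive(2)[OF assms(2), of "R \<sigma> y"] R_right[OF outside_Pg[OF assms], of y] assms(2)
  by (simp add: field_simps)

lemma R_bounded_clinear:
  assumes \<sigma>: "\<sigma> \<notin> Pg 0"
  shows "bounded_clinear (R \<sigma>)"
proof -
  obtain k where k: "k < N" "dep 0 (ang k) \<sigma> < 0" using \<sigma> by (rule outside_PgE)
  show ?thesis
  proof (rule bounded_clinearI)
    show "norm (R \<sigma> x) \<le> 1 / - dep 0 (ang k) \<sigma> * norm x" for x
      using R_norm_le[OF k, of x] by simp
    show "R \<sigma> (x + y) = R \<sigma> x + R \<sigma> y" for x y
      by (rule R_unique[OF \<sigma>])
        (use R_right[OF \<sigma>, of x] R_right[OF \<sigma>, of y] in
          \<open>simp add: bounded_clinear_add[OF A] scaleC_add_right algebra_simps\<close>)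
    show "R \<sigma> (c *\<^sub>C x) = c *\<^sub>C R \<sigma> x" for c x
    proof (rule R_unique[OF \<sigma>])
      have "\<sigma> *\<^sub>C c *\<^sub>C R \<sigma> x - A (c *\<^sub>C R \<sigma> x) = c *\<^sub>C (\<sigma> *\<^sub>C R \<sigma> x - A (R \<sigma> x))"
        by (simp add: bounded_clinear_scaleC[OF A] scaleC_scaleC scaleC_diff_right mult.commute)
      then show "\<sigma> *\<^sub>C c *\<^sub>C R \<sigma> x - A (c *\<^sub>C R \<sigma> x) = c *\<^sub>C x" by (simp add: R_right[OF \<sigma>])
    qed
  qed
qed

lemma resolvent_identity:
  assumes \<sigma>: "\<sigma> \<notin> Pg 0" and \<tau>: "\<tau> \<notin> Pg 0"
  shows "R \<sigma> x - R \<tau> x = (\<tau> - \<sigma>) *\<^sub>C R \<sigma> (R \<tau> x)"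
proof -
  define w where "w = R \<tau> x"
  have "\<sigma> *\<^sub>C w - A w = (\<sigma> - \<tau>) *\<^sub>C w + x"
    using R_right[OF \<tau>, of x] by (simp add: w_def scaleC_diff_left algebra_simps)
  then have "w = R \<sigma> ((\<sigma> - \<tau>) *\<^sub>C w + x)" using R_unique[OF \<sigma>] by metis
  also have "\<dots> = (\<sigma> - \<tau>) *\<^sub>C R \<sigma> w + R \<sigma> x"
    by (simp add: bounded_clinear_add[OF R_bounded_clinear[OF \<sigma>]] bounded_clinear_scaleC[OF R_bounded_clinear[OF \<sigma>]])
  finally show ?thesis by (simp add: w_def scaleC_diff_left algebra_simps)
qed

lemma R_tendsto:
  assumes \<tau>: "\<tau> \<notin> Pg 0"
  shows "((\<lambda>\<sigma>. R \<sigma> x) \<longlongrightarrow> R \<tau> x) (at \<tau>)"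
proof -
  obtain k where k: "k < N" "dep 0 (ang k) \<tau> < 0" using \<tau> by (rule outside_PgE)
  define f where "f = dep 0 (ang k)"
  have f: "(f \<longlongrightarrow> f \<tau>) (at \<tau>)"
    using continuous_on_dep[of UNIV 0 "ang k"] unfolding f_def
    by (simp add: continuous_on_def)
  have ev: "\<forall>\<^sub>F \<sigma> in at \<tau>. f \<sigma> < 0"
    using order_tendstoD(2)[OF f] k by (simp add: f_def)
  have "((\<lambda>\<sigma>. R \<sigma> x - R \<tau> x) \<longlongrightarrow> 0) (at \<tau>)"
  proof (rule Lim_null_comparison)
    show "\<forall>\<^sub>F \<sigma> in at \<tau>. norm (R \<sigma> x - R \<tau> x) \<le> cmod (\<tau> - \<sigma>) * (norm (R \<tau> x) / - f \<sigma>)"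
      using ev
    proof eventually_elim
      case (elim \<sigma>)
      then have \<sigma>: "\<sigma> \<notin> Pg 0" using outside_Pg[OF k(1)] by (simp add: f_def)
      show ?case
        unfolding resolvent_identity[OF \<sigma> \<tau>] norm_scaleC
        using R_norm_le[OF k(1), of \<sigma> "R \<tau> x"] elim by (intro mult_left_mono) (auto simp: f_def)
    qed
    have "((\<lambda>\<sigma>. cmod (\<tau> - \<sigma>) * (norm (R \<tau> x) / - f \<sigma>)) \<longlongrightarrow> cmod (\<tau> - \<tau>) * (norm (R \<tau> x) / - f \<tau>)) (at \<tau>)"
      using k by (intro tendsto_intros f) (simp add: f_def)
    then show "((\<lambda>\<sigma>. cmod (\<tau> - \<sigma>) * (norm (R \<tau> x) / - f \<sigma>)) \<longlongrightarrow> 0) (at \<tau>)" by simp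
  qed
  then show ?thesis by (simp add: LIM_zero_cancel)
qed

lemma R_continuous_on: "continuous_on (- Pg 0) (\<lambda>\<sigma>. R \<sigma> x)"
  by (simp add: continuous_on_def R_tendsto tendsto_within_subset[OF R_tendsto])

lemma R_holomorphic: "(\<lambda>\<sigma>. cinner (R \<sigma> x) y) holomorphic_on - Pg 0"
proof (rule holomorphic_onI)
  fix \<tau> assume "\<tau> \<in> - Pg 0"
  then have \<tau>: "\<tau> \<notin> Pg 0" by simp
  have "((\<lambda>\<sigma>. cinner (R \<sigma> x) y) has_field_derivative - cinner (R \<tau> (R \<tau> x)) y) (at \<tau>)"
    unfolding has_field_derivative_iff
  proof (rule Lim_transform_eventually)
    show "((\<lambda>\<sigma>. - cinner (R \<sigma> (R \<tau> x)) y) \<longlongrightarrow> - cinner (R \<tau> (R \<tau> x)) y) (at \<tau>)"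
      by (intro tendsto_minus bounded_bilinear.tendsto[OF bounded_bilinear_cinner] R_tendsto[OF \<tau>] tendsto_const)
    have "\<forall>\<^sub>F \<sigma> in at \<tau>. \<sigma> \<in> - Pg 0"
      using \<tau> closed_Pg[of 0] by (intro eventually_at_in_open') auto
    moreover have "\<forall>\<^sub>F \<sigma> in at \<tau>. \<sigma> \<noteq> \<tau>" by (simp add: eventually_neq_at_within)
    ultimately show "\<forall>\<^sub>F \<sigma> in at \<tau>. - cinner (R \<sigma> (R \<tau> x)) y = (cinner (R \<sigma> x) y - cinner (R \<tau> x) y) / (\<sigma> - \<tau>)"
    proof eventually_elim
      case (elim \<sigma>)
      have "cinner (R \<sigma> x) y - cinner (R \<tau> x) y = (\<tau> - \<sigma>) * cinner (R \<sigma> (R \<tau> x)) y"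
        using resolvent_identity[of \<sigma> \<tau> x] elim \<tau> by (simp flip: cinner_diff_left add: cinner_scaleC_left)
      then show ?case using elim by (simp add: field_simps)
    qed
  qed
  then show "(\<lambda>\<sigma>. cinner (R \<sigma> x) y) field_differentiable at \<tau> within - Pg 0"
    using field_differentiable_at_within field_differentiable_def by blast
qed

lemma dep0_pt: "dep 0 (ang k) (pt s k t) = - s"
  using dep_shift[of 0 "ang k" "pt s k t" s] by (simp add: dep_pt)

lemma pt_outside: "0 < s \<Longrightarrow> k < N \<Longrightarrow> pt s k t \<notin> Pg 0"
  using outside_Pg[of k "pt s k t"] by (simp add: dep0_pt)

lemma edge_cont_R: "0 < s \<Longrightarrow> edge_cont (\<lambda>k t. R (pt s k t) x)"
  unfolding edge_cont_def
  by (auto intro!: continuous_on_compose2[OF R_continuous_on continuous_on_pt] simp: pt_outside)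

lemma edge_cont_cinner_R: "0 < s \<Longrightarrow> edge_cont (\<lambda>k t. cinner (R (pt s k t) x) y)"
  using edge_cont_R[of s x] unfolding edge_cont_def
  by (auto intro!: continuous_on_cinner continuous_intros)

lemma edge_cont_mult:
  "edge_cont p \<Longrightarrow> edge_cont q \<Longrightarrow> edge_cont (\<lambda>k t. p k t * (q k t :: complex))"
  unfolding edge_cont_def by (auto intro!: continuous_intros)

lemma edge_cont_const: "edge_cont (\<lambda>k t. c k)"
  by (simp add: edge_cont_def)

subsection \<open>The integral of the resolvent\<close>

lemma vert_outside: "0 < s \<Longrightarrow> dep 0 \<theta> (vert s \<theta>) < 0" "0 < s \<Longrightarrow> dep 0 \<theta> (vert s (\<theta> - \<delta>)) < 0"
  using dep_shift[of 0 \<theta> "vert s \<theta>" s] dep_shift[of 0 \<theta> "vert s (\<theta> - \<delta>)" s]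
  by (simp_all add: dep_vert dep_vert')

text \<open>The \<open>k\<close>-th sides of two parallel polygons lie in a common half-plane on which the integrand
  has a primitive. The differences left over are integrals along the segments joining
  corresponding vertices, and these cancel around the polygon.\<close>
lemma arcint_independent:
  assumes r: "r holomorphic_on - Pg 0" and s: "0 < s" "0 < s'"
  shows "arcint s (\<lambda>k t. r (pt s k t) * (\<i> * nu k)) = arcint s' (\<lambda>k t. r (pt s' k t) * (\<i> * nu k))"
proof -
  define J where "J = (\<lambda>\<theta>. contour_integral (linepath (vert s \<theta>) (vert s' \<theta>)) r)"
  have edge: "elen s (ang k) *\<^sub>R integral {0..1} (\<lambda>t. r (pt s k t) * (\<i> * nu k))
      + (J (ang k) - J (ang k - \<delta>))
      = elen s' (ang k) *\<^sub>R integral {0..1} (\<lambda>t. r (pt s' k t) * (\<i> * nu k))"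
    if k: "k < N" for k
  proof -
    define \<theta> where "\<theta> = ang k"
    define U where "U = {z. dep 0 \<theta> z < 0}"
    have U: "convex U" "open U" "U \<subseteq> - Pg 0"
    proof -
      show "convex U"
      proof (rule convexI)
        fix x y and u v :: real
        assume *: "x \<in> U" "y \<in> U" "0 \<le> u" "0 \<le> v" "u + v = 1"
        then have u: "u = 1 - v" by simp
        have "(1 - v) * a + v * b < 0" if "a < 0" "b < 0" for a b :: real
          using convex_bound_lt[OF that, of "1 - v" v] * u by simp
        then show "u *\<^sub>R x + v *\<^sub>R y \<in> U" using * unfolding u by (auto simp: U_def dep_convex_comb)
      qed
      have "open (dep 0 \<theta> -` {..<0})" by (intro open_vimage continuous_on_dep) auto
      moreover have "dep 0 \<theta> -` {..<0} = U" by (auto simp: U_def)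
      ultimately show "open U" by simp
      show "U \<subseteq> - Pg 0" using outside_Pg[OF k] by (auto simp: U_def \<theta>_def)
    qed
    obtain F where F: "\<And>z. z \<in> U \<Longrightarrow> (F has_field_derivative r z) (at z within U)"
      using holomorphic_convex_primitive'[OF U(1,2) holomorphic_on_subset[OF r U(3)]] by blast
    have side: "elen v (ang k) *\<^sub>R integral {0..1} (\<lambda>t. r (pt v k t) * (\<i> * nu k))
        = F (vert v \<theta>) - F (vert v (\<theta> - \<delta>))" if "0 < v" for v
      unfolding \<theta>_def
      by (rule edge_integral[of F r v k U]) (use F that in \<open>auto simp: U_def \<theta>_def dep0_pt\<close>)
    have join: "contour_integral (linepath a b) r = F b - F a" if "a \<in> U" "b \<in> U" for a b
      using contour_integral_primitive[OF F valid_path_linepath, of a b] closed_segment_subset[OF that U(1)]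
      by (simp add: contour_integral_unique)
    have "J \<theta> = F (vert s' \<theta>) - F (vert s \<theta>)" "J (\<theta> - \<delta>) = F (vert s' (\<theta> - \<delta>)) - F (vert s (\<theta> - \<delta>))"
      unfolding J_def using vert_outside s by (auto intro!: join simp: U_def)
    then show ?thesis using side[OF s(1)] side[OF s(2)] by (simp add: \<theta>_def)
  qed
  have "J (real N * \<delta> - \<delta>) = J (- \<delta>)"
    using vert_period[of s "- \<delta>"] vert_period[of s' "- \<delta>"] by (simp add: J_def N\<delta> algebra_simps)
  then have "(\<Sum>k<N. J (ang k) - J (ang k - \<delta>)) = 0" using telescope[of J N] by simp
  then have "arcint s (\<lambda>k t. r (pt s k t) * (\<i> * nu k))
    = (\<Sum>k<N. elen s (ang k) *\<^sub>R integral {0..1} (\<lambda>t. r (pt s k t) * (\<i> * nu k))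
      + (J (ang k) - J (ang k - \<delta>)))"
    unfolding arcint_def sum.distrib by simp
  also have "\<dots> = arcint s' (\<lambda>k t. r (pt s' k t) * (\<i> * nu k))"
    unfolding arcint_def by (rule sum.cong[OF refl edge]) simp
  finally show ?thesis .
qed

lemma arcint_one_le: "\<exists>c. \<forall>s\<ge>1. arcint s (\<lambda>k t. 1 :: real) \<le> c * s"
proof -
  define c0 where "c0 = (\<Sum>k<N. elen 0 (ang k))"
  define c1 where "c1 = real N * (2 * (1 - cos \<delta>) / sin \<delta>)"
  have e: "elen s \<theta> = elen 0 \<theta> + s * (2 * (1 - cos \<delta>) / sin \<delta>)" for s \<theta>
    using sin\<delta> by (simp add: elen_def field_simps)
  have "arcint s (\<lambda>k t. 1 :: real) = c0 + s * c1" for s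
  proof -
    have "arcint s (\<lambda>k t. 1 :: real) = (\<Sum>k<N. elen s (ang k))" by (simp add: arcint_def)
    also have "\<dots> = c0 + s * c1" by (subst e) (simp add: sum.distrib c0_def c1_def)
    finally show ?thesis .
  qed
  moreover have "c0 + s * c1 \<le> (c0 + c1) * s" if "1 \<le> s" for s
  proof -
    have "0 \<le> c0" unfolding c0_def by (intro sum_nonneg elen_nonneg) simp
    then have "c0 * 1 \<le> c0 * s" using that by (intro mult_left_mono) auto
    then show ?thesis by (simp add: algebra_simps)
  qed
  ultimately show ?thesis by (intro exI[of _ "c0 + c1"]) simp
qed

text \<open>Far out, \<open>R \<sigma>\<close> differs from \<open>1 / \<sigma>\<close> by \<open>O (1 / |\<sigma>|\<^sup>2)\<close>, while the polygon has length
  \<open>O (|\<sigma>|)\<close>.\<close>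
lemma arcint_resolvent:
  assumes s: "0 < s"
  shows "arcint s (\<lambda>k t. cinner (R (pt s k t) x) y * nu k) = 2 * pi * cinner x y"
proof -
  define I where "I = (\<lambda>s. arcint s (\<lambda>k t. cinner (R (pt s k t) x) y * nu k))"
  have cI: "edge_cont (\<lambda>k t. cinner (R (pt u k t) x) y * nu k)" if "0 < u" for u x
    using edge_cont_cinner_R[OF that] by (intro edge_cont_mult edge_cont_const)
  have I: "I u = I s" if u: "0 < u" for u
  proof -
    have "arcint v (\<lambda>k t. cinner (R (pt v k t) x) y * (\<i> * nu k)) = \<i> * I v" if "0 < v" for v
      using arcint_mult_left[OF cI[OF that], of v \<i>] by (simp add: I_def mult_ac)
    then show ?thesis using arcint_independent[OF R_holomorphic u s, of x y] u s by simp
  qed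
  obtain c where c: "\<And>s. 1 \<le> s \<Longrightarrow> arcint s (\<lambda>k t. 1 :: real) \<le> c * s" using arcint_one_le by blast
  define m where "m = (\<Sum>k<N. \<bar>h (ang k)\<bar>)"
  have m: "\<bar>h (ang k)\<bar> \<le> m" if "k < N" for k
    unfolding m_def using that by (intro member_le_sum) auto
  define C where "C = 2 * norm (A x) * norm y"
  have "cmod (I u - 2 * pi * cinner x y) \<le> C * c / u" if u: "1 \<le> u" "2 * m < u" for u
  proof -
    have u0: "0 < u" using u by simp
    have dep0: "dep u (ang k) 0 = h (ang k) + u" for k by (simp add: dep_def)
    have "0 \<in> Om u" using m u by (force simp: Om_def dep0)
    note index = arcint_index[OF less_imp_le[OF u0] this]
    have nz: "pt u k t \<noteq> 0" if "k < N" for k t using pt_neq[OF \<open>0 \<in> Om u\<close> that] .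
    have ck: "edge_cont (\<lambda>k t. nu k / (pt u k t - 0))"
      unfolding edge_cont_def using nz by (auto intro!: continuous_intros continuous_on_pt)
    then have ck': "edge_cont (\<lambda>k t. cinner x y * (nu k / (pt u k t - 0)))"
      by (intro edge_cont_mult edge_cont_const)
    define E where "E = (\<lambda>k t. cinner (R (pt u k t) (A x)) y * (nu k / pt u k t))"
    have cE: "edge_cont E" unfolding E_def
      using ck edge_cont_cinner_R[OF u0] by (intro edge_cont_mult) auto
    have "I u - 2 * pi * cinner x y = I u - arcint u (\<lambda>k t. cinner x y * (nu k / (pt u k t - 0)))"
      unfolding arcint_mult_left[OF ck] index by simp
    also have "\<dots> = arcint u (\<lambda>k t. cinner (R (pt u k t) x) y * nu k
        - cinner x y * (nu k / (pt u k t - 0)))"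
      unfolding I_def arcint_diff[OF cI[OF u0] ck'] ..
    also have "\<dots> = arcint u E"
    proof (rule arcint_cong)
      fix k t assume k: "k < N"
      define \<sigma> where "\<sigma> = pt u k t"
      have \<sigma>: "\<sigma> \<notin> Pg 0" "\<sigma> \<noteq> 0" using pt_outside[OF u0 k] nz[OF k] by (auto simp: \<sigma>_def)
      have "x = R \<sigma> (\<sigma> *\<^sub>C x - A x)" using R_left[OF \<sigma>(1)] by simp
      also have "\<dots> = \<sigma> *\<^sub>C R \<sigma> x - R \<sigma> (A x)"
        using R_bounded_clinear[OF \<sigma>(1)] by (simp add: bounded_clinear_diff bounded_clinear_scaleC)
      finally have xy: "cinner x y = \<sigma> * cinner (R \<sigma> x) y - cinner (R \<sigma> (A x)) y"
        by (metis cinner_diff_left cinner_scaleC_left)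
      show "cinner (R (pt u k t) x) y * nu k - cinner x y * (nu k / (pt u k t - 0)) = E k t"
        unfolding E_def \<sigma>_def[symmetric] xy using \<sigma>(2) by (simp add: field_simps)
    qed
    finally have "cmod (I u - 2 * pi * cinner x y) = cmod (arcint u E)" by simp
    also have "\<dots> \<le> arcint u (\<lambda>k t. C / u\<^sup>2 * 1)"
    proof (rule arcint_norm_le[OF less_imp_le[OF u0] cE])
      show "edge_cont (\<lambda>k t. C / u\<^sup>2 * 1)" by (simp add: edge_cont_def)
      fix k t assume k: "k < N"
      have "norm (R (pt u k t) (A x)) \<le> norm (A x) / u"
        using R_norm_le[OF k, of "pt u k t" "A x"] u0 by (simp add: dep0_pt)
      then have "cmod (cinner (R (pt u k t) (A x)) y) \<le> norm (A x) / u * norm y"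
        using cinner_cauchy_schwarz[of "R (pt u k t) (A x)" y] by (meson mult_right_mono norm_ge_zero order_trans)
      moreover have "u / 2 \<le> cmod (pt u k t)"
      proof -
        have "h (ang k) + u = Re (cis (- (ang k)) * pt u k t)"
          using dep_pt[of u k t] by (simp add: dep_def)
        also have "\<dots> \<le> cmod (cis (- (ang k)) * pt u k t)" by (rule complex_Re_le_cmod)
        also have "\<dots> = cmod (pt u k t)" by (simp add: norm_mult)
        finally show ?thesis using m[OF k] u by linarith
      qed
      then have "1 / cmod (pt u k t) \<le> 2 / u" using u0 by (simp add: divide_simps mult.commute)
      ultimately have "cmod (cinner (R (pt u k t) (A x)) y) * (1 / cmod (pt u k t)) \<le> norm (A x) / u * norm y * (2 / u)"
        using u0 by (intro mult_mono) auto
      also have "\<dots> = C / u\<^sup>2 * 1" using u0 by (simp add: C_def power2_eq_square)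
      finally show "cmod (E k t) \<le> C / u\<^sup>2 * 1" by (simp add: E_def norm_mult norm_divide)
    qed
    also have "\<dots> = C / u\<^sup>2 * arcint u (\<lambda>k t. 1)"
      by (rule arcint_cmult) (simp add: edge_cont_def)
    also have "\<dots> \<le> C / u\<^sup>2 * (c * u)"
      using c[OF u(1)] by (intro mult_left_mono) (auto simp: C_def)
    also have "\<dots> = C * c / u" using u0 by (simp add: power2_eq_square)
    finally show ?thesis .
  qed
  then have "\<forall>\<^sub>F u in at_top. cmod (I s - 2 * pi * cinner x y) \<le> C * c / u"
    using I eventually_ge_at_top[of 1] eventually_gt_at_top[of "2 * m"]
    by (smt (verit) eventually_elim2)
  moreover have "((\<lambda>u::real. C * c / u) \<longlongrightarrow> 0) at_top"
    by (intro tendsto_divide_0[OF tendsto_const] filterlim_at_top_imp_at_infinity filterlim_ident)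
  ultimately have "cmod (I s - 2 * pi * cinner x y) \<le> 0"
    by (intro tendsto_lowerbound) auto
  then show ?thesis by (simp add: I_def)
qed

subsection \<open>Functions of the operator\<close>

text \<open>\<open>calc U \<phi> T\<close> expresses \<open>T = \<phi>(A)\<close> without choosing a contour: the singularities of
  \<open>\<phi>(\<sigma>) R(\<sigma>)\<close> inside \<open>U\<close> are those of \<open>R(\<sigma>) T\<close>. This relation passes to sums and products by
  bare algebra, and Cauchy's theorem recovers \<open>T\<close> from it.\<close>
definition calc :: "complex set \<Rightarrow> (complex \<Rightarrow> complex) \<Rightarrow> ('a \<Rightarrow> 'a) \<Rightarrow> bool"
  where "calc U \<phi> T \<longleftrightarrow> \<phi> holomorphic_on U \<and>
    (\<forall>x y. \<exists>g. g holomorphic_on U \<and>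
      (\<forall>\<sigma>\<in>U - Pg 0. g \<sigma> = \<phi> \<sigma> * cinner (R \<sigma> x) y - cinner (R \<sigma> (T x)) y))"

lemma calc_holomorphic: "calc U \<phi> T \<Longrightarrow> \<phi> holomorphic_on U"
  by (simp add: calc_def)

lemma calc_subset: "calc U \<phi> T \<Longrightarrow> V \<subseteq> U \<Longrightarrow> calc V \<phi> T"
  unfolding calc_def by (meson Diff_iff holomorphic_on_subset subsetD)

lemma calc_const: "calc U (\<lambda>z. c) (\<lambda>x. c *\<^sub>C x)"
  unfolding calc_def
  by (auto intro!: exI[of _ "\<lambda>_. 0"] simp: bounded_clinear_scaleC[OF R_bounded_clinear] cinner_scaleC_left)

lemma calc_ident: "calc U (\<lambda>z. z) A"
  unfolding calc_def
proof (intro conjI allI)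
  fix x y
  have "cinner x y = \<sigma> * cinner (R \<sigma> x) y - cinner (R \<sigma> (A x)) y" if "\<sigma> \<notin> Pg 0" for \<sigma>
  proof -
    have "\<sigma> *\<^sub>C R \<sigma> x - R \<sigma> (A x) = x"
      using R_left[OF that, of x] R_bounded_clinear[OF that]
      by (simp add: bounded_clinear_diff bounded_clinear_scaleC)
    then have "cinner x y = cinner (\<sigma> *\<^sub>C R \<sigma> x - R \<sigma> (A x)) y" by simp
    then show ?thesis by (simp only: cinner_diff_left cinner_scaleC_left)
  qed
  then show "\<exists>g. g holomorphic_on U \<and> (\<forall>\<sigma>\<in>U - Pg 0. g \<sigma> = \<sigma> * cinner (R \<sigma> x) y - cinner (R \<sigma> (A x)) y)"
    by (intro exI[of _ "\<lambda>_. cinner x y"]) auto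
qed (simp add: holomorphic_on_ident)

lemma calc_add:
  assumes "calc U \<phi> T" "calc U \<psi> S"
  shows "calc U (\<lambda>z. \<phi> z + \<psi> z) (\<lambda>x. T x + S x)"
  unfolding calc_def
proof (intro conjI allI)
  show "(\<lambda>z. \<phi> z + \<psi> z) holomorphic_on U"
    using assms by (intro holomorphic_intros) (auto simp: calc_def)
  fix x y
  obtain f where f: "f holomorphic_on U" "\<And>\<sigma>. \<sigma> \<in> U - Pg 0 \<Longrightarrow> f \<sigma> = \<phi> \<sigma> * cinner (R \<sigma> x) y - cinner (R \<sigma> (T x)) y"
    using assms(1) unfolding calc_def by blast
  obtain g where g: "g holomorphic_on U" "\<And>\<sigma>. \<sigma> \<in> U - Pg 0 \<Longrightarrow> g \<sigma> = \<psi> \<sigma> * cinner (R \<sigma> x) y - cinner (R \<sigma> (S x)) y"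
    using assms(2) unfolding calc_def by blast
  show "\<exists>g. g holomorphic_on U \<and> (\<forall>\<sigma>\<in>U - Pg 0. g \<sigma> = (\<phi> \<sigma> + \<psi> \<sigma>) * cinner (R \<sigma> x) y - cinner (R \<sigma> (T x + S x)) y)"
    using f(1) g(1) by (intro exI[of _ "\<lambda>\<sigma>. f \<sigma> + g \<sigma>"])
      (auto intro!: holomorphic_intros simp: f(2) g(2) bounded_clinear_add[OF R_bounded_clinear] cinner_add_left algebra_simps)
qed

lemma calc_mult:
  assumes "calc U \<phi> T" "calc U \<psi> S"
  shows "calc U (\<lambda>z. \<phi> z * \<psi> z) (\<lambda>x. T (S x))"
  unfolding calc_def
proof (intro conjI allI)
  show "(\<lambda>z. \<phi> z * \<psi> z) holomorphic_on U"
    using assms by (intro holomorphic_intros) (auto simp: calc_def)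
  fix x y
  obtain f where f: "f holomorphic_on U" "\<And>\<sigma>. \<sigma> \<in> U - Pg 0 \<Longrightarrow> f \<sigma> = \<phi> \<sigma> * cinner (R \<sigma> (S x)) y - cinner (R \<sigma> (T (S x))) y"
    using assms(1) unfolding calc_def by blast
  obtain g where g: "g holomorphic_on U" "\<And>\<sigma>. \<sigma> \<in> U - Pg 0 \<Longrightarrow> g \<sigma> = \<psi> \<sigma> * cinner (R \<sigma> x) y - cinner (R \<sigma> (S x)) y"
    using assms(2) unfolding calc_def by blast
  show "\<exists>g. g holomorphic_on U \<and> (\<forall>\<sigma>\<in>U - Pg 0. g \<sigma> = \<phi> \<sigma> * \<psi> \<sigma> * cinner (R \<sigma> x) y - cinner (R \<sigma> (T (S x))) y)"
    using f(1) g(1) calc_holomorphic[OF assms(1)] by (intro exI[of _ "\<lambda>\<sigma>. \<phi> \<sigma> * g \<sigma> + f \<sigma>"])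
      (auto intro!: holomorphic_intros simp: f(2) g(2) algebra_simps)
qed

lemma calc_sum:
  assumes "\<And>i. i \<in> I \<Longrightarrow> calc U (\<phi> i) (T i)"
  shows "calc U (\<lambda>z. \<Sum>i\<in>I. \<phi> i z) (\<lambda>x. \<Sum>i\<in>I. T i x)"
  using assms
proof (induction I rule: infinite_finite_induct)
  case (insert i I)
  then show ?case by (simp add: calc_add)
qed (use calc_const[of U 0] in simp_all)

text \<open>If \<open>f\<close> is the extension that belongs to \<open>T\<close> and the vector \<open>inv T x\<close>, then \<open>- f / \<phi>\<close> belongs to
  \<open>inv T\<close> and \<open>x\<close>.\<close>
lemma calc_inverse:
  assumes T: "calc U \<phi> T" "surj T" and nz: "\<And>z. z \<in> U \<Longrightarrow> \<phi> z \<noteq> 0"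
  shows "calc U (\<lambda>z. 1 / \<phi> z) (inv T)"
  unfolding calc_def
proof (intro conjI allI)
  show "(\<lambda>z. 1 / \<phi> z) holomorphic_on U"
    using T nz by (intro holomorphic_intros) (auto simp: calc_def)
  fix x y
  obtain f where f: "f holomorphic_on U"
    "\<And>\<sigma>. \<sigma> \<in> U - Pg 0 \<Longrightarrow> f \<sigma> = \<phi> \<sigma> * cinner (R \<sigma> (inv T x)) y - cinner (R \<sigma> (T (inv T x))) y"
    using T(1) unfolding calc_def by blast
  show "\<exists>g. g holomorphic_on U \<and> (\<forall>\<sigma>\<in>U - Pg 0. g \<sigma> = 1 / \<phi> \<sigma> * cinner (R \<sigma> x) y - cinner (R \<sigma> (inv T x)) y)"
    using f(1) calc_holomorphic[OF T(1)] nz by (intro exI[of _ "\<lambda>\<sigma>. - f \<sigma> / \<phi> \<sigma>"])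
      (auto intro!: holomorphic_intros simp: f(2) surj_f_inv_f[OF T(2)] diff_divide_distrib)
qed

lemma calc_cauchy_formula:
  assumes T: "calc (Om s1) \<phi> T" and s: "0 < s" "s < s1"
  shows "arcint s (\<lambda>k t. \<phi> (pt s k t) * cinner (R (pt s k t) x) y * nu k) = 2 * pi * cinner (T x) y"
proof -
  have PO: "Pg s \<subseteq> Om s1" using s by (intro Pg_subset_Om)
  obtain g where g: "g holomorphic_on Om s1"
    "\<And>\<sigma>. \<sigma> \<in> Om s1 - Pg 0 \<Longrightarrow> g \<sigma> = \<phi> \<sigma> * cinner (R \<sigma> x) y - cinner (R \<sigma> (T x)) y"
    using T unfolding calc_def by blast
  have s0: "0 \<le> s" using s by simp
  have c\<phi>: "edge_cont (\<lambda>k t. \<phi> (pt s k t))"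
    by (rule edge_cont_holomorphic[OF s0 calc_holomorphic[OF T] PO])
  have c: "edge_cont (\<lambda>k t. \<phi> (pt s k t) * cinner (R (pt s k t) x) y * nu k)"
    "edge_cont (\<lambda>k t. cinner (R (pt s k t) (T x)) y * nu k)"
    using c\<phi> edge_cont_cinner_R[OF s(1)] by (auto intro!: edge_cont_mult edge_cont_const)
  have "0 = arcint s (\<lambda>k t. g (pt s k t) * nu k)"
    using cauchy_theorem[OF s0 convex_Om open_Om g(1) PO] by simp
  also have "\<dots> = arcint s (\<lambda>k t. \<phi> (pt s k t) * cinner (R (pt s k t) x) y * nu k
      - cinner (R (pt s k t) (T x)) y * nu k)"
  proof (rule arcint_cong)
    fix k t assume kt: "k < N" "t \<in> {0..1::real}"
    have "pt s k t \<in> Om s1 - Pg 0" using pt_in_Pg[OF s0 kt] PO pt_outside[OF s(1) kt(1)] by blast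
    then show "g (pt s k t) * nu k = \<phi> (pt s k t) * cinner (R (pt s k t) x) y * nu k
      - cinner (R (pt s k t) (T x)) y * nu k" by (simp add: g(2) left_diff_distrib)
  qed
  also have "\<dots> = arcint s (\<lambda>k t. \<phi> (pt s k t) * cinner (R (pt s k t) x) y * nu k) - 2 * pi * cinner (T x) y"
    unfolding arcint_diff[OF c] arcint_resolvent[OF s(1)] ..
  finally show ?thesis by simp
qed

text \<open>A crude bound, whose constant depends on the contour only; it makes the best constant finite.\<close>
lemma calc_norm_le:
  assumes T: "calc (Om s1) \<phi> T" and s: "0 < s" "s < s1"
    and M: "\<And>z. z \<in> Om s1 \<Longrightarrow> cmod (\<phi> z) \<le> M" "0 \<le> M"
  shows "norm (T x) \<le> M * arcint s (\<lambda>k t. 1) / (2 * pi * s) * norm x"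
proof (rule norm_le_of_cinner_le)
  have s0: "0 \<le> s" using s by simp
  have PO: "Pg s \<subseteq> Om s1" using s by (intro Pg_subset_Om)
  have "0 \<le> arcint s (\<lambda>k t. 1 :: real)"
    unfolding arcint_def using elen_nonneg[OF s0] by (auto intro!: sum_nonneg)
  then show "0 \<le> M * arcint s (\<lambda>k t. 1) / (2 * pi * s) * norm x" using s M by simp
  fix y
  have c\<phi>: "edge_cont (\<lambda>k t. \<phi> (pt s k t))"
    by (rule edge_cont_holomorphic[OF s0 calc_holomorphic[OF T] PO])
  have c: "edge_cont (\<lambda>k t. \<phi> (pt s k t) * cinner (R (pt s k t) x) y * nu k)"
    using c\<phi> edge_cont_cinner_R[OF s(1)] by (auto intro!: edge_cont_mult edge_cont_const)
  have "cmod (2 * pi * cinner (T x) y) \<le> arcint s (\<lambda>k t. M * (norm x / s * norm y) * 1)"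
    unfolding calc_cauchy_formula[OF T s, symmetric]
  proof (rule arcint_norm_le[OF s0 c])
    show "edge_cont (\<lambda>k t. M * (norm x / s * norm y) * 1)" by (simp add: edge_cont_def)
    fix k t assume kt: "k < N" "t \<in> {0..1::real}"
    have "norm (R (pt s k t) x) \<le> norm x / s"
      using R_norm_le[OF kt(1), of "pt s k t" x] s by (simp add: dep0_pt)
    then have "cmod (cinner (R (pt s k t) x) y) \<le> norm x / s * norm y"
      using cinner_cauchy_schwarz[of "R (pt s k t) x" y] by (meson mult_right_mono norm_ge_zero order_trans)
    moreover have "cmod (\<phi> (pt s k t)) \<le> M" using M(1) pt_in_Pg[OF s0 kt] PO by blast
    ultimately show "cmod (\<phi> (pt s k t) * cinner (R (pt s k t) x) y * nu k) \<le> M * (norm x / s * norm y) * 1"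
      using M(2) by (simp only: norm_mult norm_cis mult_1_right) (intro mult_mono norm_ge_zero)
  qed
  also have "\<dots> = M * (norm x / s * norm y) * arcint s (\<lambda>k t. 1)"
    by (rule arcint_cmult) (simp add: edge_cont_def)
  finally have "2 * pi * cmod (cinner (T x) y) \<le> M * (norm x / s * norm y) * arcint s (\<lambda>k t. 1)"
    by (simp add: norm_mult)
  then show "cmod (cinner (T x) y) \<le> M * arcint s (\<lambda>k t. 1) / (2 * pi * s) * norm x * norm y"
    using s by (simp add: field_simps)
qed

lemma calc_bounded_clinear:
  assumes T: "calc (Om s1) \<phi> T" and s1: "0 < s1"
  shows "bounded_clinear T"
proof -
  obtain s s' where s: "0 < s" "s < s'" "s' < s1"
    using s1 dense by (metis dense)
  have T': "calc (Om s') \<phi> T" using T by (rule calc_subset) (use s in \<open>simp add: Om_mono\<close>)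
  have "continuous_on (Pg s') \<phi>"
    using calc_holomorphic[OF T] Pg_subset_Om[OF s(3)] by (meson continuous_on_subset holomorphic_on_imp_continuous_on)
  then have "bounded (\<phi> ` Pg s')"
    using compact_Pg by (intro compact_imp_bounded compact_continuous_image)
  then obtain M where M: "0 < M" "\<And>z. z \<in> Pg s' \<Longrightarrow> cmod (\<phi> z) \<le> M" by (auto simp: bounded_pos)
  have nrm: "norm (T x) \<le> M * arcint s (\<lambda>k t. 1) / (2 * pi * s) * norm x" for x
    by (rule calc_norm_le[OF T' s(1,2)]) (use M Om_subset_Pg in \<open>auto intro: less_imp_le\<close>)
  have s0: "0 < s" "s < s1" using s by auto
  have c: "edge_cont (\<lambda>k t. \<phi> (pt s k t) * cinner (R (pt s k t) x) y * nu k)" for x y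
  proof -
    have "edge_cont (\<lambda>k t. \<phi> (pt s k t))"
      by (rule edge_cont_holomorphic[OF less_imp_le[OF s(1)] calc_holomorphic[OF T] Pg_subset_Om[OF s0(2)]])
    then show ?thesis using edge_cont_cinner_R[OF s(1)] by (intro edge_cont_mult edge_cont_const)
  qed
  note cf = calc_cauchy_formula[OF T s0, symmetric]
  show ?thesis
  proof (rule bounded_clinearI[OF _ _ nrm])
    fix x x'
    show "T (x + x') = T x + T x'"
    proof (rule cinner_ext)
      fix y
      have "2 * pi * cinner (T (x + x')) y = arcint s (\<lambda>k t. \<phi> (pt s k t) * cinner (R (pt s k t) x) y * nu k
          + \<phi> (pt s k t) * cinner (R (pt s k t) x') y * nu k)"
        unfolding cf using pt_outside[OF s(1)]
        by (intro arcint_cong) (simp add: bounded_clinear_add[OF R_bounded_clinear] cinner_add_left algebra_simps)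
      also have "\<dots> = 2 * pi * cinner (T x) y + 2 * pi * cinner (T x') y" unfolding arcint_add[OF c c] cf ..
      finally show "cinner (T (x + x')) y = cinner (T x + T x') y"
        by (simp add: cinner_add_left flip: distrib_left)
    qed
  next
    fix a x
    show "T (a *\<^sub>C x) = a *\<^sub>C T x"
    proof (rule cinner_ext)
      fix y
      have "2 * pi * cinner (T (a *\<^sub>C x)) y = arcint s (\<lambda>k t. a * (\<phi> (pt s k t) * cinner (R (pt s k t) x) y * nu k))"
        unfolding cf using pt_outside[OF s(1)]
        by (intro arcint_cong) (simp add: bounded_clinear_scaleC[OF R_bounded_clinear] cinner_scaleC_left)
      also have "\<dots> = a * (2 * pi * cinner (T x) y)" unfolding arcint_mult_left[OF c] cf ..
      finally show "cinner (T (a *\<^sub>C x)) y = cinner (a *\<^sub>C T x) y"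
        by (simp add: cinner_scaleC_left)
    qed
  qed
qed

text \<open>Cauchy transforms are functions of the operator, obtained by replacing the Cauchy kernel with
  the resolvent.\<close>
lemma calc_cauchy_transform:
  assumes s: "0 < s" and q: "edge_cont q"
  shows "calc (Om s) (\<lambda>z. arcint s (\<lambda>k t. q k t / (pt s k t - z))) (\<lambda>x. arcint s (\<lambda>k t. q k t *\<^sub>C R (pt s k t) x))"
  unfolding calc_def
proof (intro conjI allI)
  show "(\<lambda>z. arcint s (\<lambda>k t. q k t / (pt s k t - z))) holomorphic_on Om s"
    by (rule cauchy_transform_holomorphic[OF q])
  fix x y
  define g where "g = (\<lambda>z. arcint s (\<lambda>k t. q k t * cinner (R (pt s k t) x) y / (pt s k t - z)))"
  have "g holomorphic_on Om s" unfolding g_def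
    by (intro cauchy_transform_holomorphic edge_cont_mult q edge_cont_cinner_R s)
  moreover have "g \<sigma> = arcint s (\<lambda>k t. q k t / (pt s k t - \<sigma>)) * cinner (R \<sigma> x) y
      - cinner (R \<sigma> (arcint s (\<lambda>k t. q k t *\<^sub>C R (pt s k t) x))) y" if "\<sigma> \<in> Om s - Pg 0" for \<sigma>
  proof -
    have \<sigma>: "\<sigma> \<in> Om s" "\<sigma> \<notin> Pg 0" using that by auto
    have bl: "bounded_linear (\<lambda>v. cinner (R \<sigma> v) y)"
      using R_bounded_clinear[OF \<sigma>(2)] unfolding bounded_clinear_def
      by (intro bounded_linear_compose[OF bounded_bilinear.bounded_linear_left[OF bounded_bilinear_cinner]]) auto
    have c1: "edge_cont (\<lambda>k t. q k t *\<^sub>C R (pt s k t) x)"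
      using q edge_cont_R[OF s, of x] unfolding edge_cont_def by (auto intro!: continuous_on_scaleC)
    have c2: "edge_cont (\<lambda>k t. cinner (R \<sigma> (q k t *\<^sub>C R (pt s k t) x)) y)"
      using c1 bounded_linear.continuous_on[OF bl] unfolding edge_cont_def by blast
    have c3: "edge_cont (\<lambda>k t. q k t / (pt s k t - \<sigma>))"
      using q pt_neq[OF \<sigma>(1)] unfolding edge_cont_def by (auto intro!: continuous_intros continuous_on_pt)
    then have c4: "edge_cont (\<lambda>k t. cinner (R \<sigma> x) y * (q k t / (pt s k t - \<sigma>)))"
      by (intro edge_cont_mult edge_cont_const)
    have "g \<sigma> = arcint s (\<lambda>k t. cinner (R \<sigma> x) y * (q k t / (pt s k t - \<sigma>))
        - cinner (R \<sigma> (q k t *\<^sub>C R (pt s k t) x)) y)"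
      unfolding g_def
    proof (rule arcint_cong)
      fix k t assume k: "k < N"
      define p where "p = pt s k t"
      have p: "p \<notin> Pg 0" "p \<noteq> \<sigma>" using pt_outside[OF s k] pt_neq[OF \<sigma>(1) k] by (auto simp: p_def)
      have "cinner (R \<sigma> x) y - cinner (R p x) y = (p - \<sigma>) * cinner (R \<sigma> (R p x)) y"
        using resolvent_identity[OF \<sigma>(2) p(1), of x] by (metis cinner_diff_left cinner_scaleC_left)
      then have "cinner (R p x) y = cinner (R \<sigma> x) y - (p - \<sigma>) * cinner (R \<sigma> (R p x)) y"
        by (simp add: algebra_simps)
      then show "q k t * cinner (R (pt s k t) x) y / (pt s k t - \<sigma>)
        = cinner (R \<sigma> x) y * (q k t / (pt s k t - \<sigma>)) - cinner (R \<sigma> (q k t *\<^sub>C R (pt s k t) x)) y"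
        using p(2) R_bounded_clinear[OF \<sigma>(2)]
        by (simp add: p_def[symmetric] bounded_clinear_scaleC cinner_scaleC_left diff_divide_distrib right_diff_distrib)
    qed
    also have "\<dots> = cinner (R \<sigma> x) y * arcint s (\<lambda>k t. q k t / (pt s k t - \<sigma>))
        - cinner (R \<sigma> (arcint s (\<lambda>k t. q k t *\<^sub>C R (pt s k t) x))) y"
      unfolding arcint_diff[OF c4 c2] arcint_mult_left[OF c3] arcint_linear[OF bl c1] ..
    finally show ?thesis by simp
  qed
  ultimately show "\<exists>g. g holomorphic_on Om s \<and> (\<forall>\<sigma>\<in>Om s - Pg 0.
      g \<sigma> = arcint s (\<lambda>k t. q k t / (pt s k t - \<sigma>)) * cinner (R \<sigma> x) y
        - cinner (R \<sigma> (arcint s (\<lambda>k t. q k t *\<^sub>C R (pt s k t) x))) y)"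
    by blast
qed

end

section \<open>Operator matrices\<close>

definition opmat :: "('n::finite \<Rightarrow> 'n \<Rightarrow> 'a::complex_inner \<Rightarrow> 'a) \<Rightarrow> 'a ^ 'n \<Rightarrow> 'a ^ 'n"
  where "opmat T x = (\<chi> i. \<Sum>j\<in>UNIV. T i j (x $ j))"

definition mat_norm_le :: "real \<Rightarrow> ('n::finite \<Rightarrow> 'n \<Rightarrow> complex) \<Rightarrow> bool"
  where "mat_norm_le M F \<longleftrightarrow> (\<forall>u :: complex ^ 'n. norm (\<chi> i. \<Sum>j\<in>UNIV. F i j * u $ j) \<le> M * norm u)"

lemma norm_vec_squared: "(norm x)\<^sup>2 = (\<Sum>i\<in>UNIV. (norm (x $ i))\<^sup>2)"
  by (simp add: norm_vec_def L2_set_def sum_nonneg)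

lemma norm_le_sum_components: "norm (x :: 'b::real_normed_vector ^ 'n::finite) \<le> (\<Sum>i\<in>UNIV. norm (x $ i))"
  unfolding norm_vec_def by (rule L2_set_le_sum) simp

lemma opmat_norm_le:
  fixes x :: "'a::complex_inner ^ 'n::finite"
  assumes "\<And>i j x. norm (T i j x) \<le> K i j * norm x"
  shows "norm (opmat T x) \<le> (\<Sum>i\<in>UNIV. \<Sum>j\<in>UNIV. \<bar>K i j\<bar>) * norm x"
proof -
  have "norm (opmat T x) \<le> (\<Sum>i\<in>UNIV. norm (opmat T x $ i))" by (rule norm_le_sum_components)
  also have "\<dots> \<le> (\<Sum>i\<in>UNIV. \<Sum>j\<in>UNIV. \<bar>K i j\<bar> * norm x)"
  proof (rule sum_mono)
    fix i
    have "norm (T i j (x $ j)) \<le> \<bar>K i j\<bar> * norm x" for j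
    proof -
      have "norm (T i j (x $ j)) \<le> \<bar>K i j\<bar> * norm (x $ j)"
        using assms[of i j "x $ j"] by (meson abs_ge_self mult_right_mono norm_ge_zero order_trans)
      also have "\<dots> \<le> \<bar>K i j\<bar> * norm x" by (intro mult_left_mono Finite_Cartesian_Product.norm_nth_le) auto
      finally show ?thesis .
    qed
    then show "norm (opmat T x $ i) \<le> (\<Sum>j\<in>UNIV. \<bar>K i j\<bar> * norm x)"
      by (simp add: opmat_def sum_norm_le)
  qed
  finally show ?thesis by (simp add: sum_distrib_right)
qed

lemma opmat_bounded_clinear:
  fixes T :: "'n::finite \<Rightarrow> 'n \<Rightarrow> 'a::complex_inner \<Rightarrow> 'a"
  assumes "\<And>i j. bounded_clinear (T i j)"
  shows "bounded_clinear (opmat T)"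
proof -
  have "\<exists>K. \<forall>x. norm (T i j x) \<le> K * norm x" for i j
    using assms[of i j] bounded_linear.bounded unfolding bounded_clinear_def by (metis mult.commute)
  then obtain K where K: "\<And>i j x. norm (T i j x) \<le> K i j * norm x" by metis
  show ?thesis
  proof (rule bounded_clinearI[OF _ _ opmat_norm_le[OF K]])
    show "opmat T (x + y) = opmat T x + opmat T y" for x y
      by (simp add: opmat_def vec_eq_iff bounded_clinear_add[OF assms] sum.distrib)
    show "opmat T (c *\<^sub>C x) = c *\<^sub>C opmat T x" for c x
      by (simp add: opmat_def vec_eq_iff scaleC_vec_def bounded_clinear_scaleC[OF assms] scaleC_sum_right)
  qed
qed

lemma cinner_matrix_vector:
  "cinner (\<chi> i. \<Sum>j\<in>UNIV. F i j * u $ j) v = (\<Sum>i\<in>UNIV. \<Sum>j\<in>UNIV. F i j * u $ j * cnj (v $ i))"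
  by (simp add: cinner_vec_def cinner_complex_def sum_distrib_right)

lemma mat_norm_le_form:
  assumes "mat_norm_le M F"
  shows "cmod (\<Sum>i\<in>UNIV. \<Sum>j\<in>UNIV. F i j * u $ j * cnj (v $ i)) \<le> M * norm u * norm v"
proof -
  define w where "w = (\<chi> i. \<Sum>j\<in>UNIV. F i j * u $ j)"
  have "cmod (cinner w v) \<le> norm w * norm v" by (rule cinner_cauchy_schwarz)
  also have "\<dots> \<le> M * norm u * norm v"
    using assms unfolding mat_norm_le_def w_def by (intro mult_right_mono) auto
  finally show ?thesis unfolding w_def cinner_matrix_vector .
qed

lemma mat_norm_le_formI:
  assumes "0 \<le> M"
    and "\<And>u v. cmod (\<Sum>i\<in>UNIV. \<Sum>j\<in>UNIV. F i j * u $ j * cnj (v $ i)) \<le> M * norm u * norm v"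
  shows "mat_norm_le M F"
  unfolding mat_norm_le_def
  by (intro allI, rule norm_le_of_cinner_le) (use assms in \<open>simp_all add: cinner_matrix_vector\<close>)

lemma mat_norm_le_mult:
  assumes F: "mat_norm_le M F" and G: "mat_norm_le M' G" and M: "0 \<le> M"
  shows "mat_norm_le (M * M') (\<lambda>i j. \<Sum>k\<in>UNIV. F i k * G k j)"
  unfolding mat_norm_le_def
proof
  fix u :: "complex ^ 'a"
  define w where "w = (\<chi> k. \<Sum>j\<in>UNIV. G k j * u $ j)"
  have "(\<Sum>j\<in>UNIV. (\<Sum>k\<in>UNIV. F i k * G k j) * u $ j) = (\<Sum>k\<in>UNIV. F i k * w $ k)" for i
  proof -
    have "(\<Sum>j\<in>UNIV. (\<Sum>k\<in>UNIV. F i k * G k j) * u $ j) = (\<Sum>j\<in>UNIV. \<Sum>k\<in>UNIV. F i k * (G k j * u $ j))"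
      by (simp add: sum_distrib_right mult.assoc)
    also have "\<dots> = (\<Sum>k\<in>UNIV. \<Sum>j\<in>UNIV. F i k * (G k j * u $ j))" by (rule sum.swap)
    finally show ?thesis by (simp add: w_def sum_distrib_left)
  qed
  then have "norm (\<chi> i. \<Sum>j\<in>UNIV. (\<Sum>k\<in>UNIV. F i k * G k j) * u $ j) \<le> M * norm w"
    using F unfolding mat_norm_le_def by simp
  also have "\<dots> \<le> M * (M' * norm u)"
    using G M unfolding mat_norm_le_def w_def by (intro mult_left_mono) auto
  finally show "norm (\<chi> i. \<Sum>j\<in>UNIV. (\<Sum>k\<in>UNIV. F i k * G k j) * u $ j) \<le> M * M' * norm u"
    by (simp add: mult.assoc)
qed

lemma mat_norm_le_entry:
  assumes "mat_norm_le M F"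
  shows "cmod (F i j) \<le> M"
proof -
  have "F i j = (\<chi> i. \<Sum>l\<in>UNIV. F i l * axis j 1 $ l) $ i"
    by (simp add: axis_def if_distrib sum.delta cong: if_cong)
  also have "cmod \<dots> \<le> norm (\<chi> i. \<Sum>l\<in>UNIV. F i l * (axis j 1 :: complex ^ 'a) $ l)"
    by (rule Finite_Cartesian_Product.norm_nth_le)
  also have "\<dots> \<le> M * norm (axis j 1 :: complex ^ 'a)" using assms by (simp only: mat_norm_le_def)
  finally show ?thesis by (simp add: norm_axis_1)
qed

lemma mat_norm_le_perturb:
  assumes F: "mat_norm_le M F" and G: "(\<Sum>i\<in>UNIV. \<Sum>j\<in>UNIV. cmod (G i j - F i j)) \<le> \<eta>"
  shows "mat_norm_le (M + \<eta>) G"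
  unfolding mat_norm_le_def
proof
  fix u :: "complex ^ 'a"
  have "(\<chi> i. \<Sum>j\<in>UNIV. G i j * u $ j) = (\<chi> i. \<Sum>j\<in>UNIV. F i j * u $ j) + opmat (\<lambda>i j z. (G i j - F i j) * z) u"
    by (simp add: opmat_def vec_eq_iff left_diff_distrib sum_subtractf)
  then have "norm (\<chi> i. \<Sum>j\<in>UNIV. G i j * u $ j)
      \<le> norm (\<chi> i. \<Sum>j\<in>UNIV. F i j * u $ j) + norm (opmat (\<lambda>i j z. (G i j - F i j) * z) u)"
    by (simp add: norm_triangle_ineq)
  also have "norm (\<chi> i. \<Sum>j\<in>UNIV. F i j * u $ j) \<le> M * norm u"
    using F by (simp add: mat_norm_le_def)
  also have "norm (opmat (\<lambda>i j z. (G i j - F i j) * z) u) \<le> (\<Sum>i\<in>UNIV. \<Sum>j\<in>UNIV. \<bar>cmod (G i j - F i j)\<bar>) * norm u"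
    by (rule opmat_norm_le) (simp add: norm_mult)
  also have "\<dots> \<le> \<eta> * norm u" using G by (intro mult_right_mono) auto
  finally show "norm (\<chi> i. \<Sum>j\<in>UNIV. G i j * u $ j) \<le> (M + \<eta>) * norm u"
    by (simp add: distrib_right)
qed

section \<open>The extremal inequality\<close>

text \<open>With adjoints this is \<open>T T\<^sup>* T = T (T + S\<^sup>*)\<^sup>* T - T S T\<close> together with
  \<open>\<parallel>T T\<^sup>* T\<parallel> = \<parallel>T\<parallel>\<^sup>3\<close>. Adjoints are avoided by testing on a vector \<open>x\<close> that almost attains the norm
  \<open>m\<close> of \<open>T\<close>: then \<open>T\<^sup>* T x\<close> is almost \<open>m\<^sup>2 x\<close>, which is Cauchy-Schwarz for the semidefinite form
  \<open>m\<^sup>2 \<langle>v, w\<rangle> - \<langle>T v, T w\<rangle>\<close>.\<close>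
lemma cubic_inequality:
  fixes T S :: "'a::complex_inner \<Rightarrow> 'a"
  assumes T: "bounded_clinear T"
    and TS: "\<And>x y. cmod (cinner (T x) y + cinner x (S y)) \<le> 2 * norm x * norm y"
    and K: "\<And>x. norm (T (S (T x))) \<le> K * norm x" "0 \<le> K"
  shows "(onorm T)^3 \<le> 2 * (onorm T)\<^sup>2 + K"
proof (cases "onorm T = 0")
  case True
  then show ?thesis using K by simp
next
  case False
  define m where "m = onorm T"
  have bl: "bounded_linear T" using T by (simp add: bounded_clinear_def)
  have m: "0 < m" using onorm_pos_le[OF bl] False by (simp add: m_def)
  have Tm: "norm (T x) \<le> m * norm x" for x unfolding m_def by (rule onorm[OF bl])
  have approx: "m\<^sup>2 * (m - \<eta>) \<le> m * (2 * m + m * sqrt (2 * m * \<eta>)) + K" if \<eta>: "0 < \<eta>" "\<eta> < m" for \<eta>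
  proof -
    have "\<exists>x. norm x = 1 \<and> m - \<eta> < norm (T x)"
    proof (rule ccontr)
      assume no: "\<not> (\<exists>x. norm x = 1 \<and> m - \<eta> < norm (T x))"
      have "norm (T x) \<le> (m - \<eta>) * norm x" for x
      proof (cases "x = 0")
        case False
        have eq: "norm (T ((1 / norm x) *\<^sub>R x)) = norm (T x) / norm x"
          by (simp add: scaleR_eq_scaleC bounded_clinear_scaleC[OF T] norm_scaleC norm_divide)
        have "norm (T ((1 / norm x) *\<^sub>R x)) \<le> m - \<eta>" using no False by (simp add: not_less)
        then show ?thesis unfolding eq using False by (simp add: pos_divide_le_eq)
      qed (simp add: bounded_clinear_zero[OF T])
      then have "onorm T \<le> m - \<eta>" using \<eta> by (intro onorm_bound) auto
      then show False using \<eta> by (simp add: m_def)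
    qed
    then obtain x where x: "norm x = 1" "m - \<eta> < norm (T x)" by blast
    define Q where "Q = (\<lambda>v w. of_real (m\<^sup>2) * cinner v w - cinner (T v) (T w))"
    interpret Q: psd_form Q
    proof
      fix v w z and c :: complex
      show "Q (v + w) z = Q v z + Q w z"
        by (simp add: Q_def bounded_clinear_add[OF T] cinner_add_left algebra_simps)
      show "Q (c *\<^sub>C v) z = c * Q v z"
        by (simp add: Q_def bounded_clinear_scaleC[OF T] cinner_scaleC_left algebra_simps)
      show "Q v w = cnj (Q w v)"
        using cinner_commute[of v w] cinner_commute[of "T v" "T w"] by (simp add: Q_def)
      have "(norm (T v))\<^sup>2 \<le> (m * norm v)\<^sup>2" using Tm by (intro power_mono) auto
      then show "0 \<le> Re (Q v v)" by (simp add: Q_def cinner_self power_mult_distrib)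
    qed
    have Qxx: "Re (Q x x) \<le> 2 * m * \<eta>"
    proof -
      have "(m - \<eta>)\<^sup>2 \<le> (norm (T x))\<^sup>2" using x \<eta> by (intro power_mono) auto
      moreover have "m\<^sup>2 - 2 * m * \<eta> \<le> (m - \<eta>)\<^sup>2" by (simp add: power2_diff)
      ultimately show ?thesis using x by (simp add: Q_def cinner_self)
    qed
    define z where "z = of_real (m\<^sup>2) *\<^sub>C x + S (T x)"
    have "(cmod (Q z x))\<^sup>2 \<le> Re (Q z z) * Re (Q x x)" by (rule Q.cauchy_schwarz)
    also have "\<dots> \<le> (m * norm z)\<^sup>2 * (2 * m * \<eta>)"
    proof (intro mult_mono Qxx)
      show "Re (Q z z) \<le> (m * norm z)\<^sup>2" by (simp add: Q_def cinner_self power_mult_distrib)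
    qed (use Q.nonneg in auto)
    also have "\<dots> = (m * norm z * sqrt (2 * m * \<eta>))\<^sup>2"
      using m \<eta> by (simp add: power_mult_distrib)
    finally have Qzx: "cmod (Q z x) \<le> m * norm z * sqrt (2 * m * \<eta>)"
      by (rule power2_le_imp_le) (use m \<eta> in auto)
    have "norm z \<le> 2 * m + m * sqrt (2 * m * \<eta>)"
    proof (cases "z = 0")
      case False
      have "cinner z z = of_real (m\<^sup>2) * cinner z x + cinner z (S (T x))"
        by (subst (2) z_def) (simp add: cinner_add_right cinner_scaleC_right)
      then have "cinner z z = Q z x + (cinner (T z) (T x) + cinner z (S (T x)))"
        by (simp add: Q_def)
      then have "cmod (cinner z z) \<le> cmod (Q z x) + cmod (cinner (T z) (T x) + cinner z (S (T x)))"
        by (simp add: norm_triangle_ineq)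
      also have "\<dots> \<le> m * norm z * sqrt (2 * m * \<eta>) + 2 * norm z * norm (T x)"
        by (intro add_mono Qzx TS)
      also have "\<dots> \<le> m * norm z * sqrt (2 * m * \<eta>) + 2 * norm z * m"
        using Tm[of x] x by (intro add_left_mono mult_left_mono) auto
      finally have "norm z * norm z \<le> norm z * (2 * m + m * sqrt (2 * m * \<eta>))"
        by (simp add: cinner_self norm_mult power2_eq_square algebra_simps)
      with False show ?thesis by simp
    qed (use m \<eta> in simp)
    then have Tz: "norm (T z) \<le> m * (2 * m + m * sqrt (2 * m * \<eta>))"
      using Tm[of z] m by (meson mult_left_mono less_imp_le order_trans)
    have "of_real (m\<^sup>2) *\<^sub>C T x = T z - T (S (T x))"
      by (simp add: z_def bounded_clinear_add[OF T] bounded_clinear_scaleC[OF T] del: of_real_power)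
    then have "norm (of_real (m\<^sup>2) *\<^sub>C T x) \<le> norm (T z) + norm (T (S (T x)))"
      by (simp add: norm_triangle_ineq4)
    also have "norm (of_real (m\<^sup>2) *\<^sub>C T x) = m\<^sup>2 * norm (T x)"
      unfolding norm_scaleC norm_of_real by simp
    finally have "m\<^sup>2 * norm (T x) \<le> m * (2 * m + m * sqrt (2 * m * \<eta>)) + K"
      using Tz K(1)[of x] x by simp
    moreover have "m\<^sup>2 * (m - \<eta>) \<le> m\<^sup>2 * norm (T x)" using x by (intro mult_left_mono) auto
    ultimately show ?thesis by linarith
  qed
  have "m\<^sup>2 * (m - 0) \<le> m * (2 * m + m * sqrt (2 * m * 0)) + K"
  proof (rule tendsto_le)
    show "((\<lambda>\<eta>. m * (2 * m + m * sqrt (2 * m * \<eta>)) + K) \<longlongrightarrow> m * (2 * m + m * sqrt (2 * m * 0)) + K) (at_right 0)"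
      by (intro tendsto_intros)
    show "((\<lambda>\<eta>. m\<^sup>2 * (m - \<eta>)) \<longlongrightarrow> m\<^sup>2 * (m - 0)) (at_right 0)"
      by (intro tendsto_intros)
    show "\<forall>\<^sub>F \<eta> in at_right 0. m\<^sup>2 * (m - \<eta>) \<le> m * (2 * m + m * sqrt (2 * m * \<eta>)) + K"
      using eventually_at_right_less eventually_at_right_real[OF m]
      by (auto elim!: eventually_mono intro: approx)
  qed simp
  then show ?thesis by (simp add: m_def power3_eq_cube power2_eq_square mult.assoc)
qed

lemma cubic_root_bound:
  fixes K :: real
  assumes "0 \<le> K" "K^3 \<le> 2 * K\<^sup>2 + K"
  shows "K \<le> 1 + sqrt 2"
proof (cases "K = 0")
  case False
  have "K * K\<^sup>2 \<le> K * (2 * K + 1)" using assms by (simp add: power3_eq_cube power2_eq_square algebra_simps)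
  then have "K\<^sup>2 \<le> 2 * K + 1" using False assms(1) by simp
  then have "(K - 1)\<^sup>2 \<le> 2" by (simp add: power2_diff)
  then have "K - 1 \<le> sqrt 2" by (rule real_le_rsqrt)
  then show ?thesis by simp
qed (simp add: add_nonneg_nonneg)

context range_polygon
begin

definition mcalc :: "complex set \<Rightarrow> ('n::finite \<Rightarrow> 'n \<Rightarrow> complex \<Rightarrow> complex) \<Rightarrow> ('n \<Rightarrow> 'n \<Rightarrow> 'a \<Rightarrow> 'a) \<Rightarrow> bool"
  where "mcalc U \<Phi> T \<longleftrightarrow> (\<forall>i j. calc U (\<Phi> i j) (T i j))"

lemma mcalc_subset: "mcalc U \<Phi> T \<Longrightarrow> V \<subseteq> U \<Longrightarrow> mcalc V \<Phi> T"
  unfolding mcalc_def using calc_subset by blast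

lemma mcalc_mult:
  assumes "mcalc U \<Phi> T" "mcalc U \<Psi> S"
  shows "mcalc U (\<lambda>i j z. \<Sum>k\<in>UNIV. \<Phi> i k z * \<Psi> k j z) (\<lambda>i j x. \<Sum>k\<in>UNIV. T i k (S k j x))"
  unfolding mcalc_def
proof (intro allI)
  fix i j
  show "calc U (\<lambda>z. \<Sum>k\<in>UNIV. \<Phi> i k z * \<Psi> k j z) (\<lambda>x. \<Sum>k\<in>UNIV. T i k (S k j x))"
    by (rule calc_sum, rule calc_mult) (use assms in \<open>auto simp: mcalc_def\<close>)
qed

lemma mcalc_bounded_clinear: "mcalc (Om s) \<Phi> T \<Longrightarrow> 0 < s \<Longrightarrow> bounded_clinear (opmat T)"
  unfolding mcalc_def by (intro opmat_bounded_clinear) (blast intro: calc_bounded_clinear)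

lemma opmat_mult:
  assumes "\<And>i j. bounded_clinear (T i j)"
  shows "opmat (\<lambda>i j x. \<Sum>k\<in>UNIV. T i k (S k j x)) x = opmat T (opmat S x)"
  by (simp add: opmat_def vec_eq_iff bounded_clinear_sum[OF assms]) (intro allI sum.swap)

text \<open>The Cauchy transform of \<open>\<Phi>\<^sup>*\<close> over the polygon at distance \<open>s\<close>, as an operator matrix and as a
  matrix function; hence the interchanged indices.\<close>
definition dual_op :: "real \<Rightarrow> ('n::finite \<Rightarrow> 'n \<Rightarrow> complex \<Rightarrow> complex) \<Rightarrow> 'n \<Rightarrow> 'n \<Rightarrow> 'a \<Rightarrow> 'a"
  where "dual_op s \<Phi> i j x
    = arcint s (\<lambda>k t. (cnj (\<Phi> j i (pt s k t)) * nu k / (2 * pi)) *\<^sub>C R (pt s k t) x)"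

definition dual_fun :: "real \<Rightarrow> ('n::finite \<Rightarrow> 'n \<Rightarrow> complex \<Rightarrow> complex) \<Rightarrow> 'n \<Rightarrow> 'n \<Rightarrow> complex \<Rightarrow> complex"
  where "dual_fun s \<Phi> i j z
    = arcint s (\<lambda>k t. cnj (\<Phi> j i (pt s k t)) * nu k / (2 * pi) / (pt s k t - z))"

context
  fixes \<Phi> :: "'n::finite \<Rightarrow> 'n \<Rightarrow> complex \<Rightarrow> complex" and T :: "'n \<Rightarrow> 'n \<Rightarrow> 'a \<Rightarrow> 'a"
    and s s1 M :: real
  assumes T: "mcalc (Om s1) \<Phi> T" and s: "0 < s" "s < s1"
    and M: "0 \<le> M" "\<And>z. z \<in> Om s1 \<Longrightarrow> mat_norm_le M (\<lambda>i j. \<Phi> i j z)"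
begin

lemma edge_cont_entry: "edge_cont (\<lambda>k t. \<Phi> i j (pt s k t))"
proof -
  have "calc (Om s1) (\<Phi> i j) (T i j)" using T by (simp add: mcalc_def)
  then show ?thesis
    by (rule edge_cont_holomorphic[OF less_imp_le[OF s(1)] calc_holomorphic Pg_subset_Om[OF s(2)]])
qed

lemma edge_cont_dual: "edge_cont (\<lambda>k t. cnj (\<Phi> j i (pt s k t)) * nu k / (2 * pi))"
  using edge_cont_entry[of j i] unfolding edge_cont_def
  by (auto intro!: continuous_intros)

lemma mcalc_dual: "mcalc (Om s) (dual_fun s \<Phi>) (dual_op s \<Phi>)"
  unfolding mcalc_def dual_fun_def[abs_def] dual_op_def[abs_def]
  by (intro allI) (rule calc_cauchy_transform[OF s(1) edge_cont_dual])

text \<open>The scalar bound applies to each matrix coefficient \<open>\<langle>\<Phi>(w) v, u\<rangle>\<close>.\<close>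
lemma mat_norm_le_dual:
  assumes z: "z \<in> Om s"
  shows "mat_norm_le M (\<lambda>i j. dual_fun s \<Phi> i j z)"
proof (rule mat_norm_le_formI[OF M(1)])
  fix u v :: "complex ^ 'n"
  define \<phi> where "\<phi> = (\<lambda>w. \<Sum>j\<in>UNIV. \<Sum>i\<in>UNIV. \<Phi> j i w * v $ i * cnj (u $ j))"
  have \<phi>: "\<phi> holomorphic_on Om s1" unfolding \<phi>_def
    using T by (intro holomorphic_intros) (auto simp: mcalc_def intro: calc_holomorphic)
  have \<phi>M: "cmod (\<phi> w) \<le> M * norm u * norm v" if "w \<in> Om s1" for w
    using mat_norm_le_form[OF M(2)[OF that], of v u] by (simp add: \<phi>_def mult_ac)
  have c: "edge_cont (\<lambda>k t. dual_q k t / (pt s k t - z))" if "edge_cont dual_q" for dual_q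
    using that pt_neq[OF z] unfolding edge_cont_def by (auto intro!: continuous_intros continuous_on_pt)
  define q where "q = (\<lambda>i j k t. cnj (\<Phi> j i (pt s k t)) * nu k / (2 * pi) / (pt s k t - z))"
  have cq: "edge_cont (q i j)" for i j unfolding q_def by (rule c[OF edge_cont_dual])
  have cq': "edge_cont (\<lambda>k t. u $ j * cnj (v $ i) * q i j k t)" for i j
    by (intro edge_cont_mult cq edge_cont_const)
  have dq: "dual_fun s \<Phi> i j z = arcint s (q i j)" for i j
    by (simp add: dual_fun_def q_def)
  have "(\<Sum>i\<in>UNIV. \<Sum>j\<in>UNIV. dual_fun s \<Phi> i j z * u $ j * cnj (v $ i))
      = (\<Sum>i\<in>UNIV. \<Sum>j\<in>UNIV. arcint s (\<lambda>k t. u $ j * cnj (v $ i) * q i j k t))"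
    unfolding arcint_mult_left[OF cq] dq by (simp only: mult_ac)
  also have "\<dots> = arcint s (\<lambda>k t. \<Sum>i\<in>UNIV. \<Sum>j\<in>UNIV. u $ j * cnj (v $ i) * q i j k t)"
    by (simp add: arcint_sum cq' edge_cont_sum)
  also have "\<dots> = arcint s (\<lambda>k t. 1 / (2 * pi) * (cnj (\<phi> (pt s k t)) * (nu k / (pt s k t - z))))"
  proof (rule arcint_cong)
    fix k t
    have "cnj (\<phi> (pt s k t)) = (\<Sum>j\<in>UNIV. \<Sum>i\<in>UNIV. u $ j * cnj (v $ i) * cnj (\<Phi> j i (pt s k t)))"
      by (simp add: \<phi>_def mult_ac)
    also have "\<dots> = (\<Sum>i\<in>UNIV. \<Sum>j\<in>UNIV. u $ j * cnj (v $ i) * cnj (\<Phi> j i (pt s k t)))"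
      by (rule sum.swap)
    finally show "(\<Sum>i\<in>UNIV. \<Sum>j\<in>UNIV. u $ j * cnj (v $ i) * q i j k t)
      = 1 / (2 * pi) * (cnj (\<phi> (pt s k t)) * (nu k / (pt s k t - z)))"
      by (simp add: q_def sum_divide_distrib sum_distrib_left sum_distrib_right mult_ac)
  qed
  also have "\<dots> = 1 / (2 * pi) * arcint s (\<lambda>k t. cnj (\<phi> (pt s k t)) * (nu k / (pt s k t - z)))"
  proof (rule arcint_mult_left)
    have "edge_cont (\<lambda>k t. \<phi> (pt s k t))"
      unfolding \<phi>_def by (intro edge_cont_sum edge_cont_mult edge_cont_entry edge_cont_const)
    then have "edge_cont (\<lambda>k t. cnj (\<phi> (pt s k t)) * nu k)"
      unfolding edge_cont_def by (auto intro!: continuous_intros)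
    from c[OF this] show "edge_cont (\<lambda>k t. cnj (\<phi> (pt s k t)) * (nu k / (pt s k t - z)))"
      by simp
  qed
  finally have "cmod (\<Sum>i\<in>UNIV. \<Sum>j\<in>UNIV. dual_fun s \<Phi> i j z * u $ j * cnj (v $ i))
      = 1 / (2 * pi) * cmod (arcint s (\<lambda>k t. cnj (\<phi> (pt s k t)) * (nu k / (pt s k t - z))))"
    by (simp add: norm_mult norm_divide)
  also have "\<dots> \<le> 1 / (2 * pi) * (2 * pi * (M * norm u * norm v))"
    using conjugate_transform_bound[OF less_imp_le[OF s(1)] s(2) \<phi> \<phi>M z] by (intro mult_left_mono) auto
  finally show "cmod (\<Sum>i\<in>UNIV. \<Sum>j\<in>UNIV. dual_fun s \<Phi> i j z * u $ j * cnj (v $ i)) \<le> M * norm u * norm v"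
    by simp
qed

text \<open>The real part of \<open>cis \<theta> R(\<sigma>)\<close> is a positive operator on the side with normal \<open>cis \<theta>\<close>,
  because the numerical range lies behind that side.\<close>
lemma resolvent_form_psd:
  assumes k: "k < N"
  shows "psd_form (\<lambda>x y. nu k * cinner (R (pt s k t) x) y + cis (- (ang k)) * cinner x (R (pt s k t) y))"
proof
  define \<sigma> where "\<sigma> = pt s k t"
  have \<sigma>: "\<sigma> \<notin> Pg 0" using pt_outside[OF s(1) k] by (simp add: \<sigma>_def)
  note R = R_bounded_clinear[OF \<sigma>]
  fix x y z and c :: complex
  define \<theta> where "\<theta> = ang k"
  have "0 \<le> Re (cis \<theta> * cinner (R \<sigma> x) x + cis (- \<theta>) * cinner x (R \<sigma> x))"
  proof -
    define w where "w = R \<sigma> x"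
    have x: "x = \<sigma> *\<^sub>C w - A w" using R_right[OF \<sigma>, of x] by (simp add: w_def)
    have "cis \<theta> * cinner w x = cnj (cis (- \<theta>) * cinner x w)"
      using cinner_commute[of w x] by (simp add: cis_cnj)
    then have "Re (cis \<theta> * cinner w x + cis (- \<theta>) * cinner x w) = 2 * Re (cis (- \<theta>) * cinner x w)"
      by (simp only: plus_complex.sel cnj.sel)
    moreover have "Re (cis (- \<theta>) * cinner x w)
        = (norm w)\<^sup>2 * (h \<theta> + s) - Re (cis (- \<theta>) * cinner (A w) w)"
    proof -
      have "cis (- \<theta>) * cinner x w = of_real ((norm w)\<^sup>2) * (cis (- \<theta>) * \<sigma>) - cis (- \<theta>) * cinner (A w) w"
        unfolding x by (simp add: cinner_diff_left cinner_scaleC_left cinner_self algebra_simps)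
      then have "Re (cis (- \<theta>) * cinner x w)
          = (norm w)\<^sup>2 * Re (cis (- \<theta>) * \<sigma>) - Re (cis (- \<theta>) * cinner (A w) w)"
        by (simp only: minus_complex.sel Re_complex_of_real times_complex.sel Im_complex_of_real)
      also have "Re (cis (- \<theta>) * \<sigma>) = h \<theta> + s"
        using dep_pt[of s k t] by (simp add: dep_def \<sigma>_def \<theta>_def)
      finally show ?thesis .
    qed
    moreover have "0 \<le> (norm w)\<^sup>2 * (h \<theta> + s) - Re (cis (- \<theta>) * cinner (A w) w)"
    proof -
      have "0 \<le> (norm w)\<^sup>2 * s" using s(1) by simp
      moreover have "(norm w)\<^sup>2 * (h \<theta> + s) = h \<theta> * (norm w)\<^sup>2 + (norm w)\<^sup>2 * s"
        by (simp add: algebra_simps)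
      ultimately show ?thesis using range_le[of \<theta> w] by linarith
    qed
    ultimately have "0 \<le> Re (cis \<theta> * cinner w x + cis (- \<theta>) * cinner x w)" by linarith
    then show ?thesis unfolding w_def .
  qed
  then show "0 \<le> Re (nu k * cinner (R (pt s k t) x) x + cis (- (ang k)) * cinner x (R (pt s k t) x))"
    by (simp add: \<sigma>_def \<theta>_def)
  show "nu k * cinner (R (pt s k t) (x + y)) z + cis (- (ang k)) * cinner (x + y) (R (pt s k t) z)
      = nu k * cinner (R (pt s k t) x) z + cis (- (ang k)) * cinner x (R (pt s k t) z)
      + (nu k * cinner (R (pt s k t) y) z + cis (- (ang k)) * cinner y (R (pt s k t) z))"
    using R by (simp add: bounded_clinear_add cinner_add_left algebra_simps flip: \<sigma>_def)
  show "nu k * cinner (R (pt s k t) (c *\<^sub>C x)) z + cis (- (ang k)) * cinner (c *\<^sub>C x) (R (pt s k t) z)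
      = c * (nu k * cinner (R (pt s k t) x) z + cis (- (ang k)) * cinner x (R (pt s k t) z))"
    using R by (simp add: bounded_clinear_scaleC cinner_scaleC_left algebra_simps flip: \<sigma>_def)
  show "nu k * cinner (R (pt s k t) x) y + cis (- (ang k)) * cinner x (R (pt s k t) y)
     = cnj (nu k * cinner (R (pt s k t) y) x + cis (- (ang k)) * cinner y (R (pt s k t) x))"
    using cinner_commute[of "R (pt s k t) x" y] cinner_commute[of x "R (pt s k t) y"]
    by (simp add: cis_cnj)
qed

text \<open>Writing \<open>B\<close> for the positive form of the previous lemma at a boundary point, the left-hand side is
  \<open>1 / 2 \<pi>\<close> times the integral of \<open>\<Sum> \<Phi>\<^sub>i\<^sub>j(\<sigma>) B(x\<^sub>j, y\<^sub>i)\<close>. The ampliation lemma bounds the integrand by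
  diagonal terms, which integrate exactly.\<close>
lemma dual_estimate_squares:
  "cmod (cinner (opmat T x) y + cinner x (opmat (dual_op s \<Phi>) y)) \<le> M * ((norm x)\<^sup>2 + (norm y)\<^sup>2)"
proof -
  define B where "B = (\<lambda>k t x y. nu k * cinner (R (pt s k t) x) y
    + cis (- (ang k)) * cinner x (R (pt s k t) y))"
  define f where "f = (\<lambda>i j k t. \<Phi> i j (pt s k t))"
  have s0: "0 \<le> s" using s by simp
  have cf: "edge_cont (f i j)" for i j unfolding f_def by (rule edge_cont_entry)
  have cR: "edge_cont (\<lambda>k t. cinner (R (pt s k t) x) y * nu k)" for x y
    by (intro edge_cont_mult edge_cont_cinner_R s edge_cont_const)
  have cR': "edge_cont (\<lambda>k t. cnj (cinner (R (pt s k t) x) y * nu k))" for x y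
    using cR[of x y] unfolding edge_cont_def by (auto simp del: complex_cnj_mult intro!: continuous_on_cnj)
  have B: "B = (\<lambda>k t x y. cinner (R (pt s k t) x) y * nu k
      + cnj (cinner (R (pt s k t) y) x * nu k))"
  proof (intro ext)
    fix k t and x y :: 'a
    show "B k t x y = cinner (R (pt s k t) x) y * nu k + cnj (cinner (R (pt s k t) y) x * nu k)"
      using cinner_commute[of x "R (pt s k t) y"] by (simp add: B_def cis_cnj mult.commute)
  qed
  have cB: "edge_cont (\<lambda>k t. B k t x y)" for x y
    unfolding B using cR[of x y] cR'[of y x] unfolding edge_cont_def by (auto intro!: continuous_on_add)
  have AIB: "arcint s (\<lambda>k t. B k t x y) = 4 * pi * cinner x y" for x y
    unfolding B arcint_add[OF cR cR'] arcint_cnj[OF cR] arcint_resolvent[OF s(1)]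
    using cinner_commute[of x y] by simp
  have T': "calc (Om s1) (\<Phi> i j) (T i j)" for i j using T by (simp add: mcalc_def)
  have c1: "edge_cont (\<lambda>k t. f i j k t * cinner (R (pt s k t) x) y * nu k)" for i j x y
    by (intro edge_cont_mult cf edge_cont_cinner_R s edge_cont_const)
  have c2: "edge_cont (\<lambda>k t. f i j k t * cnj (cinner (R (pt s k t) x) y * nu k))" for i j x y
    by (intro edge_cont_mult cf cR')
  have c3: "edge_cont (\<lambda>k t. f i j k t * B k t x y)" for i j x y
    by (intro edge_cont_mult cf cB)
  have entry_T: "2 * pi * cinner (T i j v) w = arcint s (\<lambda>k t. f i j k t * cinner (R (pt s k t) v) w * nu k)" for i j v w
    unfolding f_def calc_cauchy_formula[OF T' s] ..
  have entry_S: "2 * pi * cinner v (dual_op s \<Phi> j i w)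
      = arcint s (\<lambda>k t. f i j k t * cnj (cinner (R (pt s k t) w) v * nu k))" for i j v w
  proof -
    define q where "q = (\<lambda>k t. cnj (\<Phi> i j (pt s k t)) * nu k / (2 * pi))"
    have cq: "edge_cont (\<lambda>k t. q k t *\<^sub>C R (pt s k t) w)"
      using edge_cont_dual[of i j] edge_cont_R[OF s(1), of w] unfolding edge_cont_def q_def
      by (auto intro!: continuous_on_scaleC)
    have bl: "bounded_linear (\<lambda>x. cinner v x)"
      by (rule bounded_bilinear.bounded_linear_right[OF bounded_bilinear_cinner])
    have cq': "edge_cont (\<lambda>k t. cinner v (q k t *\<^sub>C R (pt s k t) w))"
      using cq bounded_linear.continuous_on[OF bl] unfolding edge_cont_def by blast
    have dq: "dual_op s \<Phi> j i w = arcint s (\<lambda>k t. q k t *\<^sub>C R (pt s k t) w)"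
      by (simp add: dual_op_def q_def)
    have "2 * pi * cinner v (dual_op s \<Phi> j i w) = arcint s (\<lambda>k t. 2 * pi * cinner v (q k t *\<^sub>C R (pt s k t) w))"
      unfolding arcint_mult_left[OF cq'] dq arcint_linear[OF bl cq] ..
    also have "\<dots> = arcint s (\<lambda>k t. f i j k t * cnj (cinner (R (pt s k t) w) v * nu k))"
    proof (rule arcint_cong)
      fix k t
      show "2 * pi * cinner v (q k t *\<^sub>C R (pt s k t) w) = f i j k t * cnj (cinner (R (pt s k t) w) v * nu k)"
        using cinner_commute[of v "R (pt s k t) w"] by (simp add: q_def f_def cinner_scaleC_right)
    qed
    finally show ?thesis .
  qed
  have "cinner (opmat T x) y + cinner x (opmat (dual_op s \<Phi>) y)
      = (\<Sum>i\<in>UNIV. \<Sum>j\<in>UNIV. cinner (T i j (x $ j)) (y $ i) + cinner (x $ j) (dual_op s \<Phi> j i (y $ i)))"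
  proof -
    have "cinner x (opmat (dual_op s \<Phi>) y) = (\<Sum>j\<in>UNIV. \<Sum>i\<in>UNIV. cinner (x $ j) (dual_op s \<Phi> j i (y $ i)))"
      by (simp add: cinner_vec_def opmat_def cinner_sum_right)
    also have "\<dots> = (\<Sum>i\<in>UNIV. \<Sum>j\<in>UNIV. cinner (x $ j) (dual_op s \<Phi> j i (y $ i)))"
      by (rule sum.swap)
    finally show ?thesis by (simp add: cinner_vec_def opmat_def cinner_sum_left sum.distrib)
  qed
  then have "2 * pi * (cinner (opmat T x) y + cinner x (opmat (dual_op s \<Phi>) y))
      = (\<Sum>i\<in>UNIV. \<Sum>j\<in>UNIV. 2 * pi * cinner (T i j (x $ j)) (y $ i) + 2 * pi * cinner (x $ j) (dual_op s \<Phi> j i (y $ i)))"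
    by (simp add: sum_distrib_left distrib_left)
  also have "\<dots> = (\<Sum>i\<in>UNIV. \<Sum>j\<in>UNIV. arcint s (\<lambda>k t. f i j k t * B k t (x $ j) (y $ i)))"
    unfolding entry_T entry_S arcint_add[OF c1 c2, symmetric] by (simp add: B algebra_simps)
  also have "\<dots> = arcint s (\<lambda>k t. \<Sum>i\<in>UNIV. \<Sum>j\<in>UNIV. f i j k t * B k t (x $ j) (y $ i))"
    by (simp add: arcint_sum c3 edge_cont_sum)
  finally have eq: "2 * pi * (cinner (opmat T x) y + cinner x (opmat (dual_op s \<Phi>) y))
     = arcint s (\<lambda>k t. \<Sum>i\<in>UNIV. \<Sum>j\<in>UNIV. f i j k t * B k t (x $ j) (y $ i))" .
  have "2 * pi * cmod (cinner (opmat T x) y + cinner x (opmat (dual_op s \<Phi>) y))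
     = cmod (2 * pi * (cinner (opmat T x) y + cinner x (opmat (dual_op s \<Phi>) y)))"
    by (simp add: norm_mult)
  also have "\<dots> = cmod (arcint s (\<lambda>k t. \<Sum>i\<in>UNIV. \<Sum>j\<in>UNIV. f i j k t * B k t (x $ j) (y $ i)))"
    unfolding eq ..
  also have "\<dots> \<le> arcint s (\<lambda>k t. M / 2 * ((\<Sum>j\<in>UNIV. Re (B k t (x $ j) (x $ j))) + (\<Sum>i\<in>UNIV. Re (B k t (y $ i) (y $ i)))))"
  proof (rule arcint_norm_le[OF s0])
    show "edge_cont (\<lambda>k t. \<Sum>i\<in>UNIV. \<Sum>j\<in>UNIV. f i j k t * B k t (x $ j) (y $ i))"
      by (intro edge_cont_sum c3)
    show "edge_cont (\<lambda>k t. M / 2 * ((\<Sum>j\<in>UNIV. Re (B k t (x $ j) (x $ j))) + (\<Sum>i\<in>UNIV. Re (B k t (y $ i) (y $ i)))))"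
      using cB unfolding edge_cont_def by (auto intro!: continuous_intros)
    fix k t assume kt: "k < N" "t \<in> {0..1::real}"
    have "pt s k t \<in> Om s1" using pt_in_Pg[OF s0 kt] Pg_subset_Om[OF s(2)] by blast
    from psd_form.matrix_ampliation_le[OF resolvent_form_psd[OF kt(1), of t] M(1) mat_norm_le_form[OF M(2)[OF this]]]
    show "cmod (\<Sum>i\<in>UNIV. \<Sum>j\<in>UNIV. f i j k t * B k t (x $ j) (y $ i))
       \<le> M / 2 * ((\<Sum>j\<in>UNIV. Re (B k t (x $ j) (x $ j))) + (\<Sum>i\<in>UNIV. Re (B k t (y $ i) (y $ i))))"
      unfolding f_def B_def .
  qed
  also have "\<dots> = M / 2 * (4 * pi * (norm x)\<^sup>2 + 4 * pi * (norm y)\<^sup>2)"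
  proof -
    have cRe: "edge_cont (\<lambda>k t. Re (B k t x x))" for x
      using cB unfolding edge_cont_def by (auto intro!: continuous_intros)
    have Re: "arcint s (\<lambda>k t. \<Sum>j\<in>UNIV. Re (B k t (x $ j) (x $ j))) = 4 * pi * (norm x)\<^sup>2" for x :: "'a ^ 'n"
    proof -
      have "arcint s (\<lambda>k t. \<Sum>j\<in>UNIV. Re (B k t (x $ j) (x $ j))) = (\<Sum>j\<in>UNIV. 4 * pi * (norm (x $ j))\<^sup>2)"
        by (simp add: arcint_sum cRe arcint_Re cB AIB cinner_self)
      then show ?thesis by (simp add: norm_vec_squared sum_distrib_left)
    qed
    have c: "edge_cont (\<lambda>k t. \<Sum>j\<in>UNIV. Re (B k t (x $ j) (x $ j)))" for x :: "'a ^ 'n"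
      by (intro edge_cont_sum cRe)
    then have c': "edge_cont (\<lambda>k t. (\<Sum>j\<in>UNIV. Re (B k t (x $ j) (x $ j))) + (\<Sum>i\<in>UNIV. Re (B k t (y $ i) (y $ i))))"
      unfolding edge_cont_def by (auto intro!: continuous_on_add)
    show ?thesis unfolding arcint_cmult[OF c'] arcint_add[OF c c] Re ..
  qed
  also have "\<dots> = 2 * pi * (M * ((norm x)\<^sup>2 + (norm y)\<^sup>2))" by (simp add: algebra_simps)
  finally show ?thesis by (rule mult_left_le_imp_le) simp
qed

lemma dual_estimate:
  "cmod (cinner (opmat T x) y + cinner x (opmat (dual_op s \<Phi>) y)) \<le> 2 * M * norm x * norm y"
proof -
  have T': "bounded_clinear (opmat T)" using mcalc_bounded_clinear[OF T] s by simp
  have S': "bounded_clinear (opmat (dual_op s \<Phi>))" using mcalc_bounded_clinear[OF mcalc_dual s(1)] .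
  define f where "f = (\<lambda>x y. cinner (opmat T x) y + cinner x (opmat (dual_op s \<Phi>) y))"
  have scale: "f (of_real a *\<^sub>C x) (of_real b *\<^sub>C y) = of_real (a * b) * f x y" for a b x y
    by (simp add: f_def bounded_clinear_scaleC[OF T'] bounded_clinear_scaleC[OF S'] cinner_scaleC_left cinner_scaleC_right algebra_simps)
  show ?thesis
  proof (cases "x = 0 \<or> y = 0")
    case True
    then show ?thesis using bounded_clinear_zero[OF T'] bounded_clinear_zero[OF S'] by auto
  next
    case False
    then have n: "0 < norm x" "0 < norm y" by auto
    define x' y' where "x' = of_real (1 / norm x) *\<^sub>C x" and "y' = of_real (1 / norm y) *\<^sub>C y"
    have "norm x' = 1" "norm y' = 1" using n unfolding x'_def y'_def norm_scaleC norm_of_real by auto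
    then have "cmod (f x' y') \<le> 2 * M" using dual_estimate_squares[of x' y'] by (simp add: f_def)
    moreover have "cmod (f x' y') = cmod (f x y) / (norm x * norm y)"
      unfolding x'_def y'_def scale norm_mult norm_of_real using n by (simp add: abs_mult)
    ultimately show ?thesis using n by (simp add: f_def field_simps)
  qed
qed

end

text \<open>Let \<open>K\<close> be the best constant for functions on neighbourhoods of the closed polygon \<open>Pg s0\<close>,
  which is finite by Cauchy's formula. If \<open>\<Phi>\<close> is contractive on \<open>Om s1\<close>, its dual \<open>\<Psi>\<close>, formed on a
  polygon between the two, is contractive there, and so is \<open>\<Phi> \<Psi> \<Phi>\<close>. Hence \<open>\<parallel>T S T\<parallel> \<le> K\<close>, and
  \<open>K\<^sup>3 \<le> 2 K\<^sup>2 + K\<close> follows.\<close>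
lemma complete_spectral_set_unit:
  fixes \<Phi> :: "'n::finite \<Rightarrow> 'n \<Rightarrow> complex \<Rightarrow> complex"
  assumes T: "mcalc (Om s1) \<Phi> T" and s: "0 < s0" "s0 < s1"
    and contr: "\<And>z. z \<in> Om s1 \<Longrightarrow> mat_norm_le 1 (\<lambda>i j. \<Phi> i j z)"
  shows "onorm (opmat T) \<le> 1 + sqrt 2"
proof -
  define X where "X = {onorm (opmat T) | (T :: 'n \<Rightarrow> 'n \<Rightarrow> 'a \<Rightarrow> 'a) \<Phi> s1. s0 < s1 \<and> mcalc (Om s1) \<Phi> T
    \<and> (\<forall>z\<in>Om s1. mat_norm_le 1 (\<lambda>i j. \<Phi> i j z))}"
  have mem: "onorm (opmat T) \<in> X" using assms unfolding X_def by blast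
  have XE: thesis
    if "m \<in> X" and *: "\<And>(T :: 'n \<Rightarrow> 'n \<Rightarrow> 'a \<Rightarrow> 'a) \<Phi> s1. m = onorm (opmat T) \<Longrightarrow> s0 < s1 \<Longrightarrow> mcalc (Om s1) \<Phi> T \<Longrightarrow>
      (\<And>z. z \<in> Om s1 \<Longrightarrow> mat_norm_le 1 (\<lambda>i j. \<Phi> i j z)) \<Longrightarrow> thesis" for m thesis
    using that(1) unfolding X_def mem_Collect_eq by (elim exE conjE) (rule *, auto)
  have pos: "0 \<le> m" if mX: "m \<in> X" for m
  proof -
    obtain T :: "'n \<Rightarrow> 'n \<Rightarrow> 'a \<Rightarrow> 'a" and \<Phi> s1 where "m = onorm (opmat T)" "s0 < s1" "mcalc (Om s1) \<Phi> T"
       "\<And>z. z \<in> Om s1 \<Longrightarrow> mat_norm_le 1 (\<lambda>i j. \<Phi> i j z)"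
      by (rule XE[OF mX]) blast
    then show ?thesis
      using mcalc_bounded_clinear[of s1 \<Phi> T] s by (auto simp: bounded_clinear_def intro: onorm_pos_le)
  qed
  define c where "c = arcint s0 (\<lambda>k t. 1) / (2 * pi * s0)"
  have "m \<le> (\<Sum>i\<in>(UNIV::'n set). \<Sum>j\<in>(UNIV::'n set). \<bar>c\<bar>)" if mX: "m \<in> X" for m
  proof -
    obtain T :: "'n \<Rightarrow> 'n \<Rightarrow> 'a \<Rightarrow> 'a" and \<Phi> s1 where m: "m = onorm (opmat T)" "s0 < s1" "mcalc (Om s1) \<Phi> T"
       "\<And>z. z \<in> Om s1 \<Longrightarrow> mat_norm_le 1 (\<lambda>i j. \<Phi> i j z)"
      by (rule XE[OF mX]) blast
    have "norm (T i j x) \<le> c * norm x" for i j x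
    proof -
      have "calc (Om s1) (\<Phi> i j) (T i j)" using m by (simp add: mcalc_def)
      from calc_norm_le[OF this s(1) m(2) mat_norm_le_entry[OF m(4)]] show ?thesis by (simp add: c_def)
    qed
    from opmat_norm_le[of T "\<lambda>_ _. c", OF this] show ?thesis
      unfolding m(1) by (intro onorm_bound) (auto intro!: sum_nonneg)
  qed
  then have bdd: "bdd_above X" by (rule bdd_aboveI)
  define K where "K = Sup X"
  have le_K: "m \<le> K" if "m \<in> X" for m unfolding K_def using that bdd by (rule cSup_upper)
  have K0: "0 \<le> K" using pos[OF mem] le_K[OF mem] by simp
  have cubic: "m^3 \<le> 2 * m\<^sup>2 + K" if mX: "m \<in> X" for m
  proof -
    obtain T :: "'n \<Rightarrow> 'n \<Rightarrow> 'a \<Rightarrow> 'a" and \<Phi> s1 where m: "m = onorm (opmat T)" "s0 < s1" "mcalc (Om s1) \<Phi> T"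
       "\<And>z. z \<in> Om s1 \<Longrightarrow> mat_norm_le 1 (\<lambda>i j. \<Phi> i j z)"
      by (rule XE[OF mX]) blast
    obtain s where s': "s0 < s" "s < s1" using m(2) dense by blast
    have sp: "0 < s" using s s' by simp
    define S where "S = dual_op s \<Phi>"
    define \<Psi> where "\<Psi> = dual_fun s \<Phi>"
    have Ts: "mcalc (Om s) \<Phi> T" using m(3) by (rule mcalc_subset) (use s' in \<open>simp add: Om_mono\<close>)
    have mat_norm_le_s: "mat_norm_le 1 (\<lambda>i j. \<Phi> i j z)" if "z \<in> Om s" for z
      using m(4) that Om_mono[of s s1] s' by auto
    have S: "mcalc (Om s) \<Psi> S" unfolding S_def \<Psi>_def by (rule mcalc_dual[OF m(3) sp s'(2) zero_le_one m(4)])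
    have mat_norm_le_\<Psi>: "mat_norm_le 1 (\<lambda>i j. \<Psi> i j z)" if "z \<in> Om s" for z
      unfolding \<Psi>_def by (rule mat_norm_le_dual[OF m(3) sp s'(2) zero_le_one m(4) that])
    have Tb: "bounded_clinear (T i j)" for i j
      using Ts sp by (auto simp: mcalc_def intro: calc_bounded_clinear)
    define TS where "TS = (\<lambda>i j x. \<Sum>k\<in>UNIV. T i k (S k j x))"
    define TST where "TST = (\<lambda>i j x. \<Sum>k\<in>UNIV. TS i k (T k j x))"
    have TS: "mcalc (Om s) (\<lambda>i j z. \<Sum>k\<in>UNIV. \<Phi> i k z * \<Psi> k j z) TS"
      unfolding TS_def by (rule mcalc_mult[OF Ts S])
    have TST: "mcalc (Om s) (\<lambda>i j z. \<Sum>l\<in>UNIV. (\<Sum>k\<in>UNIV. \<Phi> i k z * \<Psi> k l z) * \<Phi> l j z) TST"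
      unfolding TST_def by (rule mcalc_mult[OF TS Ts])
    have TSb: "bounded_clinear (TS i j)" for i j
      using TS sp by (auto simp: mcalc_def intro: calc_bounded_clinear)
    have "mat_norm_le 1 (\<lambda>i j. \<Sum>l\<in>UNIV. (\<Sum>k\<in>UNIV. \<Phi> i k z * \<Psi> k l z) * \<Phi> l j z)" if z: "z \<in> Om s" for z
      using mat_norm_le_mult[OF mat_norm_le_mult[OF mat_norm_le_s[OF z] mat_norm_le_\<Psi>[OF z]] mat_norm_le_s[OF z]] by simp
    then have "onorm (opmat TST) \<in> X" unfolding X_def using TST s' by blast
    then have nTST: "onorm (opmat TST) \<le> K" by (rule le_K)
    have bTST: "bounded_linear (opmat TST)"
      using mcalc_bounded_clinear[OF TST sp] by (simp add: bounded_clinear_def)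
    have "(onorm (opmat T))^3 \<le> 2 * (onorm (opmat T))\<^sup>2 + K"
    proof (rule cubic_inequality[where S = "opmat S"])
      show "bounded_clinear (opmat T)" using mcalc_bounded_clinear[OF Ts sp] .
      show "cmod (cinner (opmat T x) y + cinner x (opmat S y)) \<le> 2 * norm x * norm y" for x y
        using dual_estimate[OF m(3) sp s'(2) zero_le_one m(4), of x y] by (simp add: S_def)
      show "norm (opmat T (opmat S (opmat T x))) \<le> K * norm x" for x
      proof -
        have "opmat TST x = opmat T (opmat S (opmat T x))"
          unfolding TST_def opmat_mult[OF TSb] unfolding TS_def opmat_mult[OF Tb] ..
        then have "norm (opmat T (opmat S (opmat T x))) \<le> onorm (opmat TST) * norm x"
          using onorm[OF bTST, of x] by simp
        also have "\<dots> \<le> K * norm x" using nTST by (intro mult_right_mono) auto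
        finally show ?thesis .
      qed
    qed (rule K0)
    then show ?thesis by (simp add: m(1))
  qed
  have "K \<in> closure X" unfolding K_def using mem bdd by (intro closure_contains_Sup) auto
  moreover have "closure X \<subseteq> {m. m^3 \<le> 2 * m\<^sup>2 + K}"
    using cubic by (intro closure_minimal closed_Collect_le continuous_intros) auto
  ultimately have "K^3 \<le> 2 * K\<^sup>2 + K" by blast
  from cubic_root_bound[OF K0 this] le_K[OF mem] show ?thesis by simp
qed

lemma complete_spectral_set:
  fixes \<Phi> :: "'n::finite \<Rightarrow> 'n \<Rightarrow> complex \<Rightarrow> complex"
  assumes T: "mcalc (Om s) \<Phi> T" and s: "0 < s" and M: "0 < M"
    and contr: "\<And>z. z \<in> Om s \<Longrightarrow> mat_norm_le M (\<lambda>i j. \<Phi> i j z)"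
  shows "onorm (opmat T) \<le> (1 + sqrt 2) * M"
proof -
  define \<Phi>' where "\<Phi>' = (\<lambda>i j z. of_real (1 / M) * \<Phi> i j z)"
  define T' where "T' = (\<lambda>i j x. of_real (1 / M) *\<^sub>C T i j x)"
  have T': "mcalc (Om s) \<Phi>' T'"
    unfolding mcalc_def \<Phi>'_def T'_def
    by (intro allI, rule calc_mult[OF calc_const]) (use T in \<open>simp add: mcalc_def\<close>)
  have "mat_norm_le 1 (\<lambda>i j. \<Phi>' i j z)" if "z \<in> Om s" for z
    unfolding mat_norm_le_def
  proof
    fix u :: "complex ^ 'n"
    have "(\<chi> i. \<Sum>j\<in>UNIV. \<Phi>' i j z * u $ j) = of_real (1 / M) *\<^sub>C (\<chi> i. \<Sum>j\<in>UNIV. \<Phi> i j z * u $ j)"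
      by (simp add: vec_eq_iff \<Phi>'_def scaleC_vec_def scaleC_complex_def sum_distrib_left mult.assoc)
    then have "norm (\<chi> i. \<Sum>j\<in>UNIV. \<Phi>' i j z * u $ j) = 1 / M * norm (\<chi> i. \<Sum>j\<in>UNIV. \<Phi> i j z * u $ j)"
      using M by (simp only: norm_scaleC norm_of_real) simp
    also have "\<dots> \<le> 1 / M * (M * norm u)"
      using contr[OF that] M by (intro mult_left_mono) (auto simp: mat_norm_le_def)
    finally show "norm (\<chi> i. \<Sum>j\<in>UNIV. \<Phi>' i j z * u $ j) \<le> 1 * norm u" using M by simp
  qed
  then have n: "onorm (opmat T') \<le> 1 + sqrt 2"
    using s by (intro complete_spectral_set_unit[OF T', of "s / 2"]) auto
  have bl: "bounded_linear (opmat T')"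
    using mcalc_bounded_clinear[OF T' s] by (simp add: bounded_clinear_def)
  have "norm (opmat T x) \<le> (1 + sqrt 2) * M * norm x" for x
  proof -
    have "opmat T' x = of_real (1 / M) *\<^sub>C opmat T x"
      by (simp add: opmat_def T'_def vec_eq_iff scaleC_vec_def scaleC_sum_right)
    then have "norm (opmat T' x) = 1 / M * norm (opmat T x)"
      using M by (simp only: norm_scaleC norm_of_real) simp
    then have "norm (opmat T x) = M * norm (opmat T' x)" using M by (simp add: field_simps)
    also have "\<dots> \<le> M * ((1 + sqrt 2) * norm x)"
      using onorm[OF bl, of x] n M
      by (intro mult_left_mono) (auto intro: order_trans[OF _ mult_right_mono])
    finally show ?thesis by (simp add: mult_ac)
  qed
  then show ?thesis using M by (intro onorm_bound) auto
qed

end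

section \<open>Rational functions of the operator\<close>

lemma poly_op_pCons:
  fixes A :: "'a::complex_inner \<Rightarrow> 'a"
  shows "poly_op (pCons a p) A x = a *\<^sub>C x + poly_op p A (A x)"
proof (cases "p = 0")
  case False
  have "poly_op (pCons a p) A x = (\<Sum>k\<le>Suc (degree p). coeff (pCons a p) k *\<^sub>C (A ^^ k) x)"
    using False by (simp add: poly_op_def)
  also have "\<dots> = a *\<^sub>C x + (\<Sum>k\<le>degree p. coeff p k *\<^sub>C (A ^^ Suc k) x)"
    by (subst sum.atMost_Suc_shift) simp
  finally show ?thesis by (simp add: poly_op_def funpow_swap1)
qed (simp add: poly_op_def)

context range_polygon
begin

text \<open>Uniqueness turns identities between functions, such as \<open>q \<cdot> (1 / q) = 1\<close>, into identities
  between operators.\<close>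
lemma calc_unique:
  assumes T: "calc (Om s1) \<phi> T" "calc (Om s1) \<phi>' T'" and s1: "0 < s1"
    and eq: "\<And>z. z \<in> Om s1 \<Longrightarrow> \<phi> z = \<phi>' z"
  shows "T = T'"
proof
  fix x
  obtain s where s: "0 < s" "s < s1" using s1 dense by blast
  show "T x = T' x"
  proof (rule cinner_ext)
    fix y
    have "2 * pi * cinner (T x) y = 2 * pi * cinner (T' x) y"
      unfolding calc_cauchy_formula[OF T(1) s, symmetric] calc_cauchy_formula[OF T(2) s, symmetric]
    proof (rule arcint_cong)
      fix k t assume "k < N" "t \<in> {0..1::real}"
      then have "pt s k t \<in> Om s1"
        using pt_in_Pg[OF less_imp_le[OF s(1)]] Pg_subset_Om[OF s(2)] by blast
      then show "\<phi> (pt s k t) * cinner (R (pt s k t) x) y * nu k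
          = \<phi>' (pt s k t) * cinner (R (pt s k t) x) y * nu k"
        by (simp add: eq)
    qed
    then show "cinner (T x) y = cinner (T' x) y" by simp
  qed
qed

lemma calc_poly: "calc U (poly p) (poly_op p A)"
proof (induction p)
  case 0
  have "poly 0 = (\<lambda>z. 0 :: complex)" "poly_op 0 A = (\<lambda>x. 0 *\<^sub>C x)"
    by (simp_all add: fun_eq_iff poly_op_def)
  then show ?case using calc_const[of U 0] by simp
next
  case (pCons a p)
  have "poly (pCons a p) = (\<lambda>z. a + poly p z * z)" "poly_op (pCons a p) A = (\<lambda>x. a *\<^sub>C x + poly_op p A (A x))"
    by (simp_all add: fun_eq_iff poly_op_pCons mult.commute)
  then show ?case
    using calc_add[OF calc_const[of U a] calc_mult[OF pCons.IH calc_ident]] by simp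
qed

text \<open>Inverting one linear factor after the other; the root \<open>r\<close> lies outside, so \<open>A - r\<close> is
  invertible.\<close>
lemma calc_inverse_poly:
  assumes s1: "0 < s1" and q: "q \<noteq> 0" "\<And>z. z \<in> Om s1 \<Longrightarrow> poly q z \<noteq> 0"
  shows "\<exists>Q. calc (Om s1) (\<lambda>z. 1 / poly q z) Q"
  using q
proof (induction "degree q" arbitrary: q rule: less_induct)
  case less
  show ?case
  proof (cases "\<exists>r. poly q r = 0")
    case True
    then obtain r where r: "poly q r = 0" by blast
    then obtain q' where q': "q = [:- r, 1:] * q'" by (auto simp: poly_eq_0_iff_dvd)
    have "q' \<noteq> 0" using less.prems(1) q' by auto
    moreover from this have "degree q' < degree q" unfolding q' by (subst degree_mult_eq) auto
    moreover have "poly q' z \<noteq> 0" if "z \<in> Om s1" for z using less.prems(2)[OF that] by (auto simp: q')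
    ultimately obtain Q' where Q': "calc (Om s1) (\<lambda>z. 1 / poly q' z) Q'" using less.hyps by blast
    have rO: "r \<notin> Om s1" using less.prems(2) r by blast
    then have rP: "r \<notin> Pg 0" using Pg_subset_Om[OF s1] by blast
    have "surj (poly_op [:- r, 1:] A)"
    proof (rule surjI)
      fix y
      have "r *\<^sub>C R r (- y) - A (R r (- y)) = - y" by (rule R_right[OF rP])
      then show "poly_op [:- r, 1:] A (R r (- y)) = y"
        by (simp add: poly_op_pCons poly_op_def scaleC_minus_left)
          (metis add.inverse_inverse minus_diff_eq uminus_add_conv_diff)
    qed
    from calc_inverse[OF calc_poly this]
    have "calc (Om s1) (\<lambda>z. 1 / poly [:- r, 1:] z) (inv (poly_op [:- r, 1:] A))"
      using rO by auto
    from calc_mult[OF this Q'] show ?thesis unfolding q' poly_mult by (simp del: poly_pCons) blast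
  next
    case False
    then have "constant (poly q)" using Fundamental_Theorem_Algebra.fundamental_theorem_of_algebra[of q] by blast
    then obtain c where c: "\<And>z. poly q z = c" unfolding constant_def by blast
    show ?thesis unfolding c by (rule exI, rule calc_const)
  qed
qed

lemma calc_rat:
  assumes s1: "0 < s1" and np: "\<And>z. z \<in> Om s1 \<Longrightarrow> \<not> is_rat_pole f z"
  shows "calc (Om s1) (rat_eval f) (rat_op f A)"
proof -
  define q where "q = rat_denom f"
  have q0: "q \<noteq> 0" by (simp add: q_def rat_denom_def)
  have nz: "poly q z \<noteq> 0" if "z \<in> Om s1" for z using np[OF that] by (simp add: is_rat_pole_def q_def)
  obtain Q where Q: "calc (Om s1) (\<lambda>z. 1 / poly q z) Q" using calc_inverse_poly[OF s1 q0 nz] by blast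
  have "(\<lambda>x. poly_op q A (Q x)) = (\<lambda>x. 1 *\<^sub>C x)"
    by (rule calc_unique[OF calc_mult[OF calc_poly Q] calc_const s1]) (simp add: nz)
  then have "surj (poly_op q A)" by (intro surjI[of _ Q]) (simp add: fun_eq_iff)
  from calc_mult[OF calc_poly calc_inverse[OF calc_poly this nz], of "Om s1" "rat_numer f"]
  show ?thesis by (simp add: rat_eval_def[abs_def] rat_op_def o_def q_def)
qed

end

section \<open>Polygons close to the numerical range\<close>

definition support_fun :: "('a::complex_inner \<Rightarrow> 'a) \<Rightarrow> real \<Rightarrow> real"
  where "support_fun A \<theta> = (SUP w\<in>numerical_range A. Re (cis (- \<theta>) * w))"

lemma numerical_range_bounded:
  assumes "bounded_clinear A"
  obtains K where "0 < K" "\<And>w. w \<in> numerical_range A \<Longrightarrow> cmod w \<le> K"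
proof -
  obtain K where K: "0 < K" "\<And>x. norm (A x) \<le> norm x * K"
    using assms bounded_linear.pos_bounded[of A] by (auto simp: bounded_clinear_def)
  have "cmod w \<le> K" if w: "w \<in> numerical_range A" for w
  proof -
    obtain v where v: "w = cinner (A v) v" "norm v = 1" using w by (auto simp: numerical_range_def)
    then show ?thesis using cinner_cauchy_schwarz[of "A v" v] K(2)[of v] by simp
  qed
  then show thesis using K(1) that by blast
qed

lemma support_fun_upper:
  assumes "bounded_clinear A" "w \<in> numerical_range A"
  shows "Re (cis (- \<theta>) * w) \<le> support_fun A \<theta>"
proof -
  obtain K where K: "\<And>w. w \<in> numerical_range A \<Longrightarrow> cmod w \<le> K"
    using numerical_range_bounded[OF assms(1)] by metis
  have "bdd_above ((\<lambda>w. Re (cis (- \<theta>) * w)) ` numerical_range A)"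
  proof (rule bdd_aboveI2)
    fix w assume "w \<in> numerical_range A"
    then show "Re (cis (- \<theta>) * w) \<le> K"
      using complex_Re_le_cmod[of "cis (- \<theta>) * w"] K[of w] by (simp add: norm_mult)
  qed
  then show ?thesis unfolding support_fun_def using assms(2) by (rule cSUP_upper[rotated])
qed

lemma support_fun_least:
  assumes "numerical_range A \<noteq> {}" "\<And>w. w \<in> numerical_range A \<Longrightarrow> Re (cis (- \<theta>) * w) \<le> c"
  shows "support_fun A \<theta> \<le> c"
  unfolding support_fun_def using assms by (rule cSUP_least)

lemma range_polygon_support_fun:
  fixes A :: "'a::chilbert_space \<Rightarrow> 'a"
  assumes A: "bounded_clinear A" and ne: "numerical_range A \<noteq> {}" and N: "5 \<le> N"
  shows "range_polygon (support_fun A) N A"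
proof
  show "5 \<le> N" by fact
  show "bounded_clinear A" by fact
  fix \<theta> :: real
  have "cis (- (\<theta> + 2 * pi)) = cis (- \<theta>)" by (simp add: complex_eq_iff cos_diff sin_diff)
  then show "support_fun A (\<theta> + 2 * pi) = support_fun A \<theta>" by (simp only: support_fun_def)
  define d where "d = 2 * pi / real N"
  have "d \<le> 2 * pi / 5" unfolding d_def using N by (intro divide_left_mono) auto
  then have "d \<le> pi / 2" using pi_gt_zero by linarith
  moreover have "0 \<le> d" by (simp add: d_def)
  ultimately have cosd: "0 \<le> cos d" by (intro cos_ge_zero) auto
  show "2 * cos (2 * pi / real N) * support_fun A \<theta>
      \<le> support_fun A (\<theta> - 2 * pi / real N) + support_fun A (\<theta> + 2 * pi / real N)"
    unfolding d_def[symmetric]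
  proof (cases "cos d = 0")
    case True
    obtain w where w: "w \<in> numerical_range A" using ne by blast
    have "Re (cis (- (\<theta> - d)) * w) + Re (cis (- (\<theta> + d)) * w) = 2 * cos d * Re (cis (- \<theta>) * w)"
      by (simp add: cos_diff cos_add sin_diff sin_add algebra_simps)
    then show "2 * cos d * support_fun A \<theta> \<le> support_fun A (\<theta> - d) + support_fun A (\<theta> + d)"
      using support_fun_upper[OF A w, of "\<theta> - d"] support_fun_upper[OF A w, of "\<theta> + d"] True by simp
  next
    case False
    with cosd have c: "0 < cos d" by simp
    have "support_fun A \<theta> \<le> (support_fun A (\<theta> - d) + support_fun A (\<theta> + d)) / (2 * cos d)"
    proof (rule support_fun_least[OF ne])
      fix w assume w: "w \<in> numerical_range A"
      have "Re (cis (- (\<theta> - d)) * w) + Re (cis (- (\<theta> + d)) * w) = 2 * cos d * Re (cis (- \<theta>) * w)"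
        by (simp add: cos_diff cos_add sin_diff sin_add algebra_simps)
      then show "Re (cis (- \<theta>) * w) \<le> (support_fun A (\<theta> - d) + support_fun A (\<theta> + d)) / (2 * cos d)"
        using support_fun_upper[OF A w, of "\<theta> - d"] support_fun_upper[OF A w, of "\<theta> + d"] c
        by (simp add: pos_le_divide_eq mult_ac)
    qed
    then show "2 * cos d * support_fun A \<theta> \<le> support_fun A (\<theta> - d) + support_fun A (\<theta> + d)"
      using c by (simp add: pos_le_divide_eq mult_ac)
  qed
  fix x :: 'a
  show "Re (cis (- \<theta>) * cinner (A x) x) \<le> support_fun A \<theta> * (norm x)\<^sup>2"
  proof (cases "x = 0")
    case False
    define v where "v = of_real (1 / norm x) *\<^sub>C x"
    have "norm v = 1" using False unfolding v_def norm_scaleC norm_of_real by simp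
    then have "cinner (A v) v \<in> numerical_range A" by (auto simp: numerical_range_def)
    from support_fun_upper[OF A this, of \<theta>]
    have "Re (cis (- \<theta>) * cinner (A v) v) \<le> support_fun A \<theta>" .
    moreover have "cis (- \<theta>) * cinner (A v) v = of_real (1 / (norm x)\<^sup>2) * (cis (- \<theta>) * cinner (A x) x)"
      unfolding v_def bounded_clinear_scaleC[OF A] cinner_scaleC_left cinner_scaleC_right
      by (simp add: power2_eq_square)
    then have "Re (cis (- \<theta>) * cinner (A v) v) = Re (cis (- \<theta>) * cinner (A x) x) / (norm x)\<^sup>2"
      by (simp only: Re_complex_of_real times_complex.sel Im_complex_of_real) simp
    ultimately show ?thesis using False by (simp add: pos_divide_le_eq)
  qed (simp add: bounded_clinear_zero[OF A])
qed

lemma norm_cis_diff_le: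
  assumes "cos d \<le> cos (a - b)"
  shows "cmod (cis (- a) - cis (- b)) \<le> \<bar>d\<bar>"
proof -
  have "(cmod (cis (- a) - cis (- b)))\<^sup>2
      = ((cos a)\<^sup>2 + (sin a)\<^sup>2) + ((cos b)\<^sup>2 + (sin b)\<^sup>2) - 2 * (cos a * cos b + sin a * sin b)"
    unfolding cmod_power2 by (simp add: power2_eq_square algebra_simps)
  also have "\<dots> = 2 - 2 * cos (a - b)" by (simp add: cos_diff)
  also have "\<dots> \<le> 2 - 2 * cos d" using assms by simp
  also have "\<dots> = (2 * sin (d / 2))\<^sup>2"
    using cos_double_sin[of "d / 2"] by (simp add: power_mult_distrib)
  also have "\<dots> \<le> d\<^sup>2"
  proof -
    have "\<bar>2 * sin (d / 2)\<bar> \<le> \<bar>d\<bar>" using abs_sin_x_le_abs_x[of "d / 2"] by (simp add: abs_mult)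
    then show ?thesis by (simp only: abs_le_square_iff)
  qed
  finally have "(cmod (cis (- a) - cis (- b)))\<^sup>2 \<le> \<bar>d\<bar>\<^sup>2" by simp
  then show ?thesis by (rule power2_le_imp_le) simp
qed

text \<open>A point far from the compact convex set \<open>closure (numerical_range A)\<close> is cut off by a
  supporting line, and hence by a line whose normal is one of finitely many equally spaced ones.\<close>
lemma polygon_approximation:
  fixes A :: "'a::chilbert_space \<Rightarrow> 'a"
  assumes A: "bounded_clinear A" and ne: "numerical_range A \<noteq> {}"
    and U: "open U" "closure (numerical_range A) \<subseteq> U"
  obtains N s where "range_polygon (support_fun A) N A" "0 < s" "polygon.Om (support_fun A) N s \<subseteq> U"
proof -
  define C where "C = closure (numerical_range A)"
  obtain K where K: "0 < K" "\<And>w. w \<in> numerical_range A \<Longrightarrow> cmod w \<le> K"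
    using numerical_range_bounded[OF A] by metis
  have KC: "cmod w \<le> K" if "w \<in> C" for w
  proof -
    have "numerical_range A \<subseteq> cball 0 K" using K by auto
    then have "C \<subseteq> cball 0 K" unfolding C_def by (rule closure_minimal) simp
    then show ?thesis using that by auto
  qed
  have C: "convex C" "closed C" "C \<noteq> {}" "compact C"
  proof -
    show "convex C" unfolding C_def by (intro convex_closure convex_numerical_range A)
    show "closed C" "C \<noteq> {}" using ne by (auto simp: C_def)
    then show "compact C" using KC by (auto simp: compact_eq_bounded_closed intro!: boundedI)
  qed
  obtain \<epsilon> where \<epsilon>: "0 < \<epsilon>" "{z. infdist z C \<le> \<epsilon>} \<subseteq> U"
    using compact_in_open_separated[OF C(3,4) U(1)] U(2) unfolding C_def by blast
  define N where "N = nat \<lceil>16 * pi * K / \<epsilon>\<rceil> + 6"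
  have N: "6 \<le> N" "16 * pi * K / \<epsilon> \<le> real N" unfolding N_def by linarith+
  interpret range_polygon "support_fun A" N A
    using range_polygon_support_fun[OF A ne] N(1) by simp
  have "6 * \<delta> \<le> real N * \<delta>" using N(1) \<delta>_pos by (intro mult_right_mono) auto
  then have "\<delta> \<le> pi / 3" unfolding N\<delta> by linarith
  then have "cos (pi / 3) \<le> cos \<delta>" using \<delta>_pos pi_gt_zero by (intro cos_monotone_0_pi_le) auto
  then have cos_half: "1 / 2 \<le> cos \<delta>" by (simp add: cos_60)
  have small: "2 * K * \<delta> \<le> \<epsilon> / 4"
  proof -
    have "16 * pi * K \<le> \<epsilon> * real N" using N(2) \<epsilon>(1) by (simp add: pos_divide_le_eq mult.commute)
    then have "2 * K * (2 * pi) / real N \<le> \<epsilon> / 4" using N(1) by (simp add: pos_divide_le_eq mult_ac)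
    then show ?thesis by (simp add: \<delta>_def)
  qed
  have "z \<in> U" if z: "z \<in> Om (\<epsilon> / 4)" for z
  proof (rule ccontr)
    assume "z \<notin> U"
    then have "\<not> infdist z C \<le> \<epsilon>" using \<epsilon>(2) by blast
    then have far: "\<epsilon> < infdist z C" by simp
    define c where "c = closest_point C z"
    have c: "c \<in> C" unfolding c_def using C by (intro closest_point_in_set)
    define r where "r = cmod (z - c)"
    have r: "\<epsilon> < r" using far infdist_le[OF c, of z] by (simp add: r_def dist_norm)
    obtain k where k: "k < N" "cos \<delta> \<le> cos (Arg (z - c) - ang k)" using nearest_normal by blast
    define \<theta> where "\<theta> = ang k"
    define \<alpha> where "\<alpha> = Arg (z - c)"
    have polar: "z - c = of_real r * cis \<alpha>"
      using rcis_cmod_Arg[of "z - c"] by (simp add: rcis_def r_def \<alpha>_def)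
    have "support_fun A \<theta> \<le> Re (cis (- \<theta>) * c) + 2 * K * \<delta>"
    proof (rule support_fun_least[OF ne])
      fix w assume w: "w \<in> numerical_range A"
      have wC: "w \<in> C" using w closure_subset unfolding C_def by blast
      have "inner (z - c) (w - c) \<le> 0"
        unfolding c_def using C wC by (intro closest_point_dot)
      moreover have "inner (z - c) (w - c) = r * Re (cis (- \<alpha>) * (w - c))"
        unfolding polar by (simp add: inner_complex_def algebra_simps)
      ultimately have neg: "Re (cis (- \<alpha>) * (w - c)) \<le> 0"
        using r \<epsilon>(1) by (simp add: mult_le_0_iff)
      have "Re ((cis (- \<theta>) - cis (- \<alpha>)) * (w - c)) \<le> cmod (cis (- \<theta>) - cis (- \<alpha>)) * cmod (w - c)"
        using complex_Re_le_cmod by (metis norm_mult)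
      also have "\<dots> \<le> \<delta> * (2 * K)"
      proof (intro mult_mono)
        have "cos \<delta> \<le> cos (\<theta> - \<alpha>)" using k(2) by (simp add: \<theta>_def \<alpha>_def cos_diff mult.commute)
        from norm_cis_diff_le[OF this] show "cmod (cis (- \<theta>) - cis (- \<alpha>)) \<le> \<delta>" using \<delta>_pos by simp
        show "cmod (w - c) \<le> 2 * K" using norm_triangle_ineq4[of w c] KC[OF wC] KC[OF c] by simp
      qed (use \<delta>_pos in auto)
      finally have "Re ((cis (- \<theta>) - cis (- \<alpha>)) * (w - c)) \<le> 2 * K * \<delta>" by (simp add: mult_ac)
      moreover have "cis (- \<theta>) * w = cis (- \<theta>) * c + (cis (- \<alpha>) * (w - c) + (cis (- \<theta>) - cis (- \<alpha>)) * (w - c))"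
        by (simp add: algebra_simps)
      then have "Re (cis (- \<theta>) * w) = Re (cis (- \<theta>) * c)
          + (Re (cis (- \<alpha>) * (w - c)) + Re ((cis (- \<theta>) - cis (- \<alpha>)) * (w - c)))"
        by (simp only: plus_complex.sel)
      ultimately show "Re (cis (- \<theta>) * w) \<le> Re (cis (- \<theta>) * c) + 2 * K * \<delta>" using neg by linarith
    qed
    moreover have "Re (cis (- \<theta>) * (z - c)) \<ge> \<epsilon> / 2"
    proof -
      have "\<epsilon> * (1 / 2) \<le> r * cos (Arg (z - c) - \<theta>)"
        using r \<epsilon>(1) cos_half k(2) by (intro mult_mono) (auto simp: \<theta>_def)
      then show ?thesis by (simp only: Re_cis_mult r_def)
    qed
    moreover have "Re (cis (- \<theta>) * z) = Re (cis (- \<theta>) * c) + Re (cis (- \<theta>) * (z - c))"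
      by (simp add: algebra_simps)
    moreover have "0 < dep (\<epsilon> / 4) \<theta> z" using Om_dep[OF z k(1)] by (simp add: \<theta>_def)
    ultimately show False using small unfolding dep_def by linarith
  qed
  then show thesis
    using that[of N "\<epsilon> / 4"] range_polygon_axioms \<epsilon>(1) by auto
qed

section \<open>The numerical range is a complete spectral set\<close>

lemma mat_norm_le_onorm:
  fixes F :: "complex ^ 'n::finite ^ 'n"
  assumes "onorm (\<lambda>v. F *v v) \<le> M"
  shows "mat_norm_le M (\<lambda>i j. F $ i $ j)"
  unfolding mat_norm_le_def
proof
  fix u :: "complex ^ 'n"
  have "norm (F *v u) \<le> onorm (\<lambda>v. F *v v) * norm u"
    by (rule onorm) (rule matrix_vector_mul_bounded_linear)
  also have "\<dots> \<le> M * norm u" using assms by (intro mult_right_mono) auto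
  finally show "norm (\<chi> i. \<Sum>j\<in>UNIV. F $ i $ j * u $ j) \<le> M * norm u"
    by (simp add: matrix_vector_mult_def)
qed

lemma mat_op_opmat: "mat_op F A = opmat (\<lambda>i j. rat_op (F $ i $ j) A)"
  by (simp add: fun_eq_iff mat_op_def opmat_def)

lemma finite_poles: "finite {z. is_rat_pole f z}"
  unfolding is_rat_pole_def by (rule poly_roots_finite) (simp add: rat_denom_def)

lemma continuous_on_rat_eval: "continuous_on {z. \<not> is_rat_pole f z} (rat_eval f)"
  unfolding rat_eval_def[abs_def] is_rat_pole_def by (intro continuous_intros) auto

theorem mainTheorem2:
  fixes A :: "'a::chilbert_space \<Rightarrow> 'a"
    and F :: "ratfun ^ 'n::finite ^ 'n"
  assumes "bounded_clinear A"
    and "\<And>i j z. z \<in> closure (numerical_range A) \<Longrightarrow> \<not> is_rat_pole (F $ i $ j) z"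
  shows "bounded_clinear (mat_op F A) \<and>
    ennreal (onorm (mat_op F A))
      \<le> ennreal (1 + sqrt 2) *
        (SUP z\<in>numerical_range A. ennreal (onorm (\<lambda>v. mat_eval F z *v v)))"
proof (cases "numerical_range A = {}")
  case True
  have trivial: "x = 0" for x :: 'a
  proof (rule ccontr)
    assume "x \<noteq> 0"
    then have "norm ((1 / norm x) *\<^sub>R x) = 1" by simp
    with True show False unfolding numerical_range_def by blast
  qed
  then have zero: "mat_op F A = (\<lambda>x. 0)" by (simp add: fun_eq_iff vec_eq_iff)
  show ?thesis unfolding zero
    by (auto intro!: bounded_clinearI[where K = 0] simp: onorm_zero)
next
  case ne: False
  define W where "W = numerical_range A"
  define f where "f = (\<lambda>z i j. rat_eval (F $ i $ j) z)"
  define U1 where "U1 = {z. \<forall>i j. \<not> is_rat_pole (F $ i $ j) z}"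
  have "finite (\<Union>i. \<Union>j. {z. is_rat_pole (F $ i $ j) z})" by (simp add: finite_poles)
  then have "open (- (\<Union>i. \<Union>j. {z. is_rat_pole (F $ i $ j) z}))" by (intro open_Compl finite_imp_closed)
  moreover have "- (\<Union>i. \<Union>j. {z. is_rat_pole (F $ i $ j) z}) = U1" by (auto simp: U1_def)
  ultimately have U1: "open U1" by simp
  have WU1: "closure W \<subseteq> U1" using assms(2) by (auto simp: U1_def W_def)
  have f_cont: "continuous_on U1 (\<lambda>z. f z i j)" for i j
    unfolding f_def by (rule continuous_on_subset[OF continuous_on_rat_eval]) (auto simp: U1_def)
  define D where "D = (\<lambda>z z0. \<Sum>i\<in>UNIV. \<Sum>j\<in>UNIV. cmod (f z i j - f z0 i j))"
  have D_cont: "continuous_on U1 (\<lambda>z. D z z0)" for z0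
    unfolding D_def by (intro continuous_intros f_cont)
  have approx: "bounded_clinear (mat_op F A) \<and> onorm (mat_op F A) \<le> (1 + sqrt 2) * (M + \<eta>)"
    if \<eta>: "0 < \<eta>" and M: "0 \<le> M" "\<And>z. z \<in> W \<Longrightarrow> mat_norm_le M (f z)" for M \<eta>
  proof -
    \<comment> \<open>on this neighbourhood of the closure all entries are close to their values at some point of the
      numerical range, and a polygon fits in between\<close>
    define U where "U = (\<Union>z0\<in>W. {z \<in> U1. D z z0 < \<eta>})"
    have "open {z \<in> U1. D z z0 < \<eta>}" for z0
    proof -
      have "open (U1 \<inter> (\<lambda>z. D z z0) -` {..<\<eta>})"
        by (rule continuous_open_preimage[OF D_cont U1]) simp
      moreover have "U1 \<inter> (\<lambda>z. D z z0) -` {..<\<eta>} = {z \<in> U1. D z z0 < \<eta>}" by auto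
      ultimately show ?thesis by simp
    qed
    then have U: "open U" unfolding U_def by blast
    have WU: "closure W \<subseteq> U"
    proof
      fix z assume z: "z \<in> closure W"
      then have zU1: "z \<in> U1" using WU1 by blast
      have "open {z' \<in> U1. D z' z < \<eta>}"
      proof -
        have "open (U1 \<inter> (\<lambda>z'. D z' z) -` {..<\<eta>})"
          by (rule continuous_open_preimage[OF D_cont U1]) simp
        moreover have "U1 \<inter> (\<lambda>z'. D z' z) -` {..<\<eta>} = {z' \<in> U1. D z' z < \<eta>}" by auto
        ultimately show ?thesis by simp
      qed
      moreover have "z \<in> {z' \<in> U1. D z' z < \<eta>}" using zU1 \<eta> by (simp add: D_def)
      ultimately obtain z0 where z0: "z0 \<in> W" "D z0 z < \<eta>"
        using z closure_iff_nhds_not_empty[of z W] by blast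
      have "D z z0 < \<eta>" using z0(2) by (simp add: D_def norm_minus_commute)
      then show "z \<in> U" using z0(1) zU1 by (auto simp: U_def)
    qed
    obtain N s where N: "range_polygon (support_fun A) N A" and s: "0 < s"
      and sub: "polygon.Om (support_fun A) N s \<subseteq> U"
      using polygon_approximation[OF assms(1) ne U WU[unfolded W_def]] by metis
    interpret range_polygon "support_fun A" N A by (rule N)
    have T: "mcalc (Om s) (\<lambda>i j. rat_eval (F $ i $ j)) (\<lambda>i j. rat_op (F $ i $ j) A)"
      unfolding mcalc_def by (intro allI calc_rat[OF s]) (use sub in \<open>auto simp: U_def U1_def\<close>)
    have "mat_norm_le (M + \<eta>) (\<lambda>i j. rat_eval (F $ i $ j) z)" if "z \<in> Om s" for z
    proof -
      have "z \<in> U" using that sub by blast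
      then obtain z0 where z0: "z0 \<in> W" "D z z0 < \<eta>" unfolding U_def by blast
      have "mat_norm_le (M + \<eta>) (f z)"
        by (rule mat_norm_le_perturb[OF M(2)[OF z0(1)]]) (use z0(2) in \<open>simp add: D_def\<close>)
      then show ?thesis by (simp add: f_def)
    qed
    then have "onorm (mat_op F A) \<le> (1 + sqrt 2) * (M + \<eta>)"
      unfolding mat_op_opmat using M \<eta> by (intro complete_spectral_set[OF T s]) auto
    moreover have "bounded_clinear (mat_op F A)"
      unfolding mat_op_opmat by (rule mcalc_bounded_clinear[OF T s])
    ultimately show ?thesis by blast
  qed
  define S where "S = (SUP z\<in>W. ennreal (onorm (\<lambda>v. mat_eval F z *v v)))"
  have mat_norm_le_of: "mat_norm_le M (f z)" if "0 \<le> M" "S \<le> ennreal M" "z \<in> W" for M z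
  proof -
    have "ennreal (onorm (\<lambda>v. mat_eval F z *v v)) \<le> S" unfolding S_def using that(3) by (rule SUP_upper)
    then have "onorm (\<lambda>v. mat_eval F z *v v) \<le> M" using that by (meson ennreal_le_iff order_trans)
    from mat_norm_le_onorm[OF this] show ?thesis by (simp add: mat_eval_def f_def)
  qed
  have bcl: "bounded_clinear (mat_op F A)"
  proof -
    obtain K where "\<And>w. w \<in> W \<Longrightarrow> cmod w \<le> K"
      using numerical_range_bounded[OF assms(1)] unfolding W_def by metis
    then have "bounded W" by (auto intro: boundedI)
    then have "compact (closure W)" by (simp add: compact_closure)
    moreover have "continuous_on (closure W) (\<lambda>z. \<Sum>i\<in>UNIV. \<Sum>j\<in>UNIV. cmod (f z i j))"
      by (intro continuous_intros continuous_on_subset[OF f_cont WU1])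
    ultimately have "bounded ((\<lambda>z. \<Sum>i\<in>UNIV. \<Sum>j\<in>UNIV. cmod (f z i j)) ` closure W)"
      by (intro compact_imp_bounded compact_continuous_image)
    then obtain B where B: "0 < B" "\<And>z. z \<in> closure W \<Longrightarrow> norm (\<Sum>i\<in>UNIV. \<Sum>j\<in>UNIV. cmod (f z i j)) \<le> B"
      by (auto simp: bounded_pos)
    have "mat_norm_le B (f z)" if "z \<in> W" for z
    proof -
      have "mat_norm_le 0 (\<lambda>(i::'n) (j::'n). 0)" by (simp add: mat_norm_le_def zero_vec_def[symmetric])
      moreover have "(\<Sum>i\<in>UNIV. \<Sum>j\<in>UNIV. cmod (f z i j - 0)) \<le> B"
        using B(2)[of z] that closure_subset[of W] by (auto dest: abs_le_D1)
      ultimately show ?thesis using mat_norm_le_perturb[of 0 "\<lambda>i j. 0" "f z" B] by simp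
    qed
    then show ?thesis using approx[of 1 B] B(1) by simp
  qed
  show ?thesis
    unfolding W_def[symmetric] S_def[symmetric]
  proof (cases "S = top")
    case True
    have "ennreal (1 + sqrt 2) \<noteq> 0" by (simp add: ennreal_eq_0_iff not_le add_pos_nonneg)
    then have "ennreal (1 + sqrt 2) * S = top" unfolding True by (simp add: ennreal_mult_top)
    then show "bounded_clinear (mat_op F A) \<and> ennreal (onorm (mat_op F A)) \<le> ennreal (1 + sqrt 2) * S"
      using bcl by simp
  next
    case False
    define M where "M = enn2real S"
    have M: "0 \<le> M" "S = ennreal M" using False by (auto simp: M_def less_top)
    note mat_norm_le_M = mat_norm_le_of[OF M(1)]
    have "onorm (mat_op F A) \<le> (1 + sqrt 2) * M"
    proof (rule field_le_epsilon)
      fix e :: real assume e: "0 < e"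
      have "onorm (mat_op F A) \<le> (1 + sqrt 2) * (M + e / (1 + sqrt 2))"
        using approx[of "e / (1 + sqrt 2)" M] M mat_norm_le_M e by (simp add: add_pos_nonneg)
      also have "\<dots> = (1 + sqrt 2) * M + e"
      proof -
        have "1 + sqrt 2 \<noteq> 0" by (metis add_pos_nonneg less_irrefl real_sqrt_ge_zero zero_le_numeral zero_less_one)
        then show ?thesis by (simp only: distrib_left) simp
      qed
      finally show "onorm (mat_op F A) \<le> (1 + sqrt 2) * M + e" .
    qed
    then have "ennreal (onorm (mat_op F A)) \<le> ennreal ((1 + sqrt 2) * M)" by (rule ennreal_leI)
    then show "bounded_clinear (mat_op F A) \<and> ennreal (onorm (mat_op F A)) \<le> ennreal (1 + sqrt 2) * S"
      using bcl M by (simp add: ennreal_mult)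
  qed
qed

end
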